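(* Let $V$ satisfy (P) and (G), let all coefficients satisfy (C), let $\Xi_0\in\mathcal H^\beta([0,U],H)$ with $\beta>1$ and $\kappa+\eta_0\le\Xi_0\le K-\eta_0$ on $[0,U]$ for some $\eta_0>0$, and let $\mathfrak X_m$ be the ReQU sieve of the context, $m\ge m_0$. Let $X_1,\dots,X_n$ ($n\ge2$) be i.i.d. from $\pi_0$ and let $\widehat\Xi_n\in\arg\min_{\xi\in\mathfrak X_m}\frac1n\sum_{i=1}^n-\log\pi_\xi(X_i)$. Fix $c_a<\kappa$, choose $\varepsilon>0$ with $\Xi_0(0)-\varepsilon>c_a$, and let $M_n=v_\star+C_{\rm tr}\log n$ with $C_{\rm tr}>0$, $C_{\rm tr}c_a>1$; let $\delta\in(0,1)$. Fix a compact interval $I=[r_-,r_+]\subset(0,a_0)$ and suppose there is a compact interval $S_I\subset(v_\star,\infty)$ disjoint from the critical values of $V$ such that $s_{\Xi_0}(I)\subseteq S_I$. Let $$\mathfrak R_{n,m,\delta,M_n}=C_{\rm or}\left(m^{-2(\beta+1)}+\frac{b_n(m\log n+\log(1/\delta))}n+d_m(M_n)+\bar R_m(M_n)\right).$$ There exists $C_{\rm mode}>0$, depending on $I,a_0,d,V,K$, such that the inequality $\mathfrak R_{n,m,\delta,M_n}\le C_{\rm mode}$ implies $$\|\widehat\Xi_n-\Xi_0\|_{L^2(I)}\le C_{\rm inv}\,\mathfrak R_{n,m,\delta,M_n}^{\beta/(2(\beta+1))}$$ with probability at least $(1-\delta)(1-\tau_0(M_n))^n$, for some constant $C_{\rm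 inv}$ depending on $I,a_0,V,\kappa,K,\beta,H,H_1$. Optimizing in $m$ (i.e. $m\asymp(n/(b_n\log n))^{1/(2\beta+3)}$) gives $$\|\widehat\Xi_n-\Xi_0\|_{L^2(I)}=O_{\mathbb P}\left(\left(\frac{b_n\log n}n\right)^{\beta/(2\beta+3)}\right).$$
   Context: (P): $d\ge1$; $V:\mathbb R^d\to[v_\star,\infty)$ is $C^2$, coercive, $v_\star=\min V$, $e^{-aV}$ integrable for every $a>0$; $m_V(s)=\int_{\{V=s\}}\|\nabla V\|_2^{-1}\mathrm d\mathcal H^{d-1}$ ($s>v_\star$) is locally finite and bounded above and below by positive constants on compact intervals away from critical values; $\int\varphi(V(x))\mathrm dx=\int_{v_\star}^\infty\varphi(s)m_V(s)\mathrm ds$ for measurable $\varphi\ge0$. (G): there are $C_V<\infty$, $\alpha\ge0$, $v_V>v_\star$ with $m_V(s)\le C_V(1+s-v_\star)^\alpha$ for $s\ge v_V$. (C): with constants $0<\kappa<K<\infty$, $L<\infty$, every coefficient considered ($\Xi_0$ and all $\xi\in\mathfrak X_m$) satisfies $\kappa\le\xi\le K$, $|\xi(r)-\xi(u)|\le L|r-u|$ on $[0,\infty)$. Stationary densities: $g_\xi(r)=\int_1^r(u\xi(u))^{-1}\mathrm du$; $\mu_\xi$ is the unique constant with $\int_{v_\star}^\infty g_\xi^{-1}(\mu_\xi-s)m_V(s)\mathrm ds=1$; $q_\xi(s)=g_\xi^{-1}(\mu_\xi-s)$; $\pi_\xi(x)=q_\xi(V(x))$; $a_\xi=q_\xi(v_\star)=\max\pi_\xi$;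 $s_\xi(r)=q_\xi^{-1}(r)=\mu_\xi-g_\xi(r)$; $\pi_0=\pi_{\Xi_0}$, $a_0=a_{\Xi_0}$. $Z_c=\int e^{-c(V-v_\star)}\mathrm dx$, $c_\infty=Z_K/Z_\kappa$, $U\ge\max\{1,Z_K^{-1}\}$ fixed. $\mathcal H^\beta([0,U],H)$: functions with $k=\lceil\beta\rceil-1$ continuous derivatives and Hölder norm (sup norms of derivatives up to order $k$ plus $(\beta-k)$-Hölder seminorm of the $k$-th derivative) at most $H$. Sieve: $\mathfrak X_m=\{\kappa+(K-\kappa)S_\tau(N_\theta):N_\theta\in\mathrm{NN}(L_{\rm net},\mathbf p_m,s_m,B_m)\}\cap\mathcal H^\beta([0,U],H_1)$ (functions on $[0,U]$, extended by their value at $U$), where $\mathrm{NN}(L_{\rm net},\mathbf p,s,B)$ are feedforward networks $\mathbb R\to\mathbb R$ with activation $(z_+)^2$, depth $L_{\rm net}$, width vector $\mathbf p$, at most $s$ nonzero parameters bounded by $B$; $L_{\rm net}$ is fixed, $\max_jp_{m,j}\le C_pm$, $s_m=\lceil C_sm\rceil$, $B_m\le m^{C_B}$; $0<\tau<\eta_0/(4(K-\kappa))$, $S_\tau:\mathbb R\to[0,1]$ globally Lipschitz with $S_\tau(z)=z$ on $[\tau,1-\tau]$. The fixed constants $L_{\rm net},C_p,C_s,C_B,H_1,m_0$ are large enough that for every $m\ge m_0$ there is $\xi_m\in\mathfrak X_m$ with $\mathrm{KL}(\pi_0\Vert\pi_{\xi_m})\le C_{\rm KL}m^{-2(\beta+1)}$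 and $\log N(\varepsilon,\mathfrak X_m,\|\cdot\|_\infty)\le C_{\rm ent}m\log(C_{\rm ent}m/\varepsilon)$ for $\varepsilon\in(0,1]$ (existence established in the paper). Truncation: $A_M=\{V\le M\}$, $\tau_\xi(M)=\int_{A_M^c}\pi_\xi$, $\tau_0=\tau_{\Xi_0}$, $\pi_\xi^M=\pi_\xi\mathbf 1_{A_M}/(1-\tau_\xi(M))$, $\bar\tau_m(M)=\sup_{\xi\in\mathfrak X_m\cup\{\Xi_0\}}\tau_\xi(M)$, $d_m(M)=-\log(1-\bar\tau_m(M))$, $\bar R_m(M)=\sup_{\xi\in\mathfrak X_m}\int_{A_M^c}\pi_0|\log(\pi_0/\pi_\xi)|\mathrm dx$. $C_{\rm or}$ is the fixed constant (depending only on $C_{\rm KL}$, $C_{\rm ent}$, $c_\infty$, $C_{\rm tr}$ and a constant $C_{\rm st}=C(V,\kappa,K)$ with $\sup_{A_M}|\log\pi^M_\xi-\log\pi^M_\zeta|\le C_{\rm st}(1+M)\|\xi-\zeta\|_{\infty,[0,U]}$ on $\mathfrak X_m$) for which $\mathrm{KL}(\pi_0\Vert\pi_{\widehat\Xi_n})\le\mathfrak R_{n,m,\delta,M_n}$ with probability at least $(1-\delta)(1-\tau_0(M_n))^n$. $b_n$ is the order of $B_{\gamma_{M_n}}$, where $B_\gamma=(\log(1/\gamma))^2/(\log(1/\gamma)-1+\gamma)$ and $\gamma_M\in(0,1)$ satisfies $\gamma_M\le\pi_0^M/\pi_\xi^M\le\gamma_M^{-1}$ on $A_M$ for all $\xi\in\mathfrak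 X_m$; $b_n=O(1)$ in the compact (bounded-domain) case, $b_n\le O(\log n)$ in the noncompact case. *)

theory Defs
  imports "HOL-Probability.Probability" "HOL-Library.Landau_Symbols"
begin

section \<open>Hausdorff measure and the level-set density of the potential\<close>

text \<open>
  Integer-dimensional Hausdorff measure, normalised so that it agrees with Lebesgue measure in
  dimension \<open>k\<close>. The empty set is treated separately because \<open>0 ^ 0 = 1\<close> (this makes the
  0-dimensional measure the counting measure), and boundedness is required because
  \<^const>\<open>diameter\<close> is only meaningful for bounded sets. The outer measure is a metric outer measure,
  hence countably additive on the Borel sets.
\<close>

definition hausdorff_pre :: "nat \<Rightarrow> real \<Rightarrow> 'a::metric_space set \<Rightarrow> ennreal" where
  "hausdorff_pre k \<delta> A =
    (INF C \<in> {C :: nat \<Rightarrow> 'a set. A \<subseteq> (\<Union>i. C i) \<and> (\<forall>i. bounded (C i) \<and> diameter (C i) \<le> \<delta>)}.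
       \<Sum>i. if C i = {} then 0 else ennreal (unit_ball_vol (real k) * (diameter (C i) / 2) ^ k))"

definition hausdorff_outer :: "nat \<Rightarrow> 'a::metric_space set \<Rightarrow> ennreal" where
  "hausdorff_outer k A = (SUP \<delta>\<in>{0<..}. hausdorff_pre k \<delta> A)"

definition hausdorff_measure :: "nat \<Rightarrow> 'a::metric_space measure" where
  "hausdorff_measure k = measure_of UNIV (sets borel) (hausdorff_outer k)"

definition grad :: "('a::real_inner \<Rightarrow> real) \<Rightarrow> 'a \<Rightarrow> 'a" where
  "grad V x = (THE D. GDERIV V x :> D)"

definition C2 :: "(real ^ 'd \<Rightarrow> real) \<Rightarrow> bool" where
  "C2 V \<longleftrightarrow> (\<exists>G D2. (\<forall>x. GDERIV V x :> G x) \<and>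
      (\<forall>x. (G has_derivative blinfun_apply (D2 x)) (at x)) \<and> continuous_on UNIV D2)"

definition critical_values :: "(real ^ 'd \<Rightarrow> real) \<Rightarrow> real set" where
  "critical_values V = {V x | x. grad V x = 0}"

definition vmin :: "(real ^ 'd \<Rightarrow> real) \<Rightarrow> real" where
  "vmin V = Inf (range V)"

text \<open>Extended-valued: \<open>inverse 0 = \<infinity>\<close>, so the density may be infinite at critical values.\<close>

definition level_density :: "(real ^ 'd \<Rightarrow> real) \<Rightarrow> real \<Rightarrow> ennreal" where
  "level_density V s =
    (\<integral>\<^sup>+ x \<in> {x. V x = s}. inverse (ennreal (norm (grad V x)))
       \<partial>(hausdorff_measure (CARD('d) - 1) :: (real ^ 'd) measure))"

text \<open>
  Local finiteness of \<open>m\<^sub>V\<close> is that of the measure \<open>m\<^sub>V(s) ds\<close>; pointwise finiteness is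
  required only away from the critical values. Measurability of \<open>m\<^sub>V\<close> is part of the meaning of the
  coarea identity in the last clause.
\<close>

definition cond_P :: "(real ^ 'd \<Rightarrow> real) \<Rightarrow> bool" where
  "cond_P V \<longleftrightarrow>
     C2 V \<and> filterlim V at_top at_infinity \<and>
     (\<exists>x. V x = vmin V) \<and> (\<forall>x. vmin V \<le> V x) \<and>
     (\<forall>a>0. integrable lborel (\<lambda>x. exp (- a * V x))) \<and>
     (\<lambda>s. level_density V s * indicator {vmin V<..} s) \<in> borel_measurable lebesgue \<and>
     (\<forall>t. (\<integral>\<^sup>+ s \<in> {vmin V<..t}. level_density V s \<partial>lebesgue) < \<infinity>) \<and>
     (\<forall>s t. vmin V < s \<and> s \<le> t \<and> {s..t} \<inter> critical_values V = {} \<longrightarrow>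
        (\<exists>c C. 0 < c \<and> (\<forall>u\<in>{s..t}. ennreal c \<le> level_density V u \<and> level_density V u \<le> ennreal C))) \<and>
     (\<forall>\<phi> :: real \<Rightarrow> ennreal. \<phi> \<in> borel_measurable borel \<longrightarrow>
        (\<integral>\<^sup>+ x. \<phi> (V x) \<partial>lborel) = (\<integral>\<^sup>+ s \<in> {vmin V<..}. \<phi> s * level_density V s \<partial>lebesgue))"

definition cond_G :: "(real ^ 'd \<Rightarrow> real) \<Rightarrow> bool" where
  "cond_G V \<longleftrightarrow> (\<exists>C_V \<alpha> v_V. 0 \<le> \<alpha> \<and> vmin V < v_V \<and>
     (\<forall>s\<ge>v_V. level_density V s \<le> ennreal (C_V * (1 + s - vmin V) powr \<alpha>)))"

section \<open>Coefficients and stationary densities\<close>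

definition cond_C :: "real \<Rightarrow> real \<Rightarrow> real \<Rightarrow> (real \<Rightarrow> real) \<Rightarrow> bool" where
  "cond_C \<kappa> K L \<xi> \<longleftrightarrow> (\<forall>r\<ge>0. \<kappa> \<le> \<xi> r \<and> \<xi> r \<le> K) \<and> L-lipschitz_on {0..} \<xi>"

definition gfun :: "(real \<Rightarrow> real) \<Rightarrow> real \<Rightarrow> real" where
  "gfun \<xi> r = (LBINT u = ereal 1..ereal r. 1 / (u * \<xi> u))"

definition ginv :: "(real \<Rightarrow> real) \<Rightarrow> real \<Rightarrow> real" where
  "ginv \<xi> = the_inv_into {0<..} (gfun \<xi>)"

definition mu :: "(real ^ 'd \<Rightarrow> real) \<Rightarrow> (real \<Rightarrow> real) \<Rightarrow> real" where
  "mu V \<xi> = (THE \<mu>.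
     (\<integral>\<^sup>+ s \<in> {vmin V<..}. ennreal (ginv \<xi> (\<mu> - s)) * level_density V s \<partial>lebesgue) = 1)"

definition qfun :: "(real ^ 'd \<Rightarrow> real) \<Rightarrow> (real \<Rightarrow> real) \<Rightarrow> real \<Rightarrow> real" where
  "qfun V \<xi> s = ginv \<xi> (mu V \<xi> - s)"

definition sdens :: "(real ^ 'd \<Rightarrow> real) \<Rightarrow> (real \<Rightarrow> real) \<Rightarrow> real ^ 'd \<Rightarrow> real" where
  "sdens V \<xi> x = qfun V \<xi> (V x)"

definition amax :: "(real ^ 'd \<Rightarrow> real) \<Rightarrow> (real \<Rightarrow> real) \<Rightarrow> real" where
  "amax V \<xi> = qfun V \<xi> (vmin V)"

definition sfun :: "(real ^ 'd \<Rightarrow> real) \<Rightarrow> (real \<Rightarrow> real) \<Rightarrow> real \<Rightarrow> real" where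
  "sfun V \<xi> r = mu V \<xi> - gfun \<xi> r"

definition Zconst :: "(real ^ 'd \<Rightarrow> real) \<Rightarrow> real \<Rightarrow> real" where
  "Zconst V c = (\<integral>x. exp (- c * (V x - vmin V)) \<partial>lborel)"

text \<open>\<open>KL V \<xi> \<zeta>\<close> is the divergence of \<open>\<pi>\<^sub>\<xi>\<close> from \<open>\<pi>\<^sub>\<zeta>\<close>, i.e. \<open>KL(\<pi>\<^sub>\<xi> || \<pi>\<^sub>\<zeta>)\<close>: the library function
  \<^const>\<open>KL_divergence\<close> takes the reference measure first.\<close>

definition KL :: "(real ^ 'd \<Rightarrow> real) \<Rightarrow> (real \<Rightarrow> real) \<Rightarrow> (real \<Rightarrow> real) \<Rightarrow> real" where
  "KL V \<xi> \<zeta> = KL_divergence (exp 1)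
     (density lborel (\<lambda>x. ennreal (sdens V \<zeta> x))) (density lborel (\<lambda>x. ennreal (sdens V \<xi> x)))"

section \<open>Hoelder balls, ReQU networks and the sieve\<close>

text \<open>\<open>D j\<close> is the \<open>j\<close>-th derivative on \<open>[0, U]\<close> (one-sided at the end points).\<close>

definition holder_ball :: "real \<Rightarrow> real \<Rightarrow> real \<Rightarrow> (real \<Rightarrow> real) set" where
  "holder_ball \<beta> U H = {f. \<exists>D :: nat \<Rightarrow> real \<Rightarrow> real. let k = nat (\<lceil>\<beta>\<rceil> - 1) in
     (\<forall>x\<in>{0..U}. D 0 x = f x) \<and>
     (\<forall>j<k. \<forall>x\<in>{0..U}. (D j has_real_derivative D (Suc j) x) (at x within {0..U})) \<and>
     continuous_on {0..U} (D k) \<and>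
     (\<Sum>j\<le>k. SUP x\<in>{0..U}. ennreal \<bar>D j x\<bar>) +
       (SUP (x, y)\<in>{(x, y). x \<in> {0..U} \<and> y \<in> {0..U} \<and> x \<noteq> y}.
          ennreal (\<bar>D k x - D k y\<bar> / \<bar>x - y\<bar> powr (\<beta> - real k))) \<le> ennreal H}"

text \<open>
  A network with \<open>L\<close> hidden layers and widths \<open>p 0, \<dots>, p (L + 1)\<close> has weights \<open>W j i k\<close> and biases
  \<open>c j i\<close> for \<open>j \<le> L\<close>, \<open>i < p (j + 1)\<close>, \<open>k < p j\<close>; the output layer is affine.
\<close>

primrec hidden :: "(nat \<Rightarrow> nat \<Rightarrow> nat \<Rightarrow> real) \<Rightarrow> (nat \<Rightarrow> nat \<Rightarrow> real) \<Rightarrow> (nat \<Rightarrow> nat) \<Rightarrow> real \<Rightarrow> nat \<Rightarrow> nat \<Rightarrow> real"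
where
  "hidden W c p x 0 = (\<lambda>i. x)"
| "hidden W c p x (Suc j) = (\<lambda>i. (max 0 ((\<Sum>k<p j. W j i k * hidden W c p x j k) + c j i))\<^sup>2)"

definition realize ::
  "(nat \<Rightarrow> nat \<Rightarrow> nat \<Rightarrow> real) \<Rightarrow> (nat \<Rightarrow> nat \<Rightarrow> real) \<Rightarrow> (nat \<Rightarrow> nat) \<Rightarrow> nat \<Rightarrow> real \<Rightarrow> real" where
  "realize W c p L x = (\<Sum>k<p L. W L 0 k * hidden W c p x L k) + c L 0"

definition NN :: "nat \<Rightarrow> (nat \<Rightarrow> nat) \<Rightarrow> nat \<Rightarrow> real \<Rightarrow> (real \<Rightarrow> real) set" where
  "NN L p s B = {realize W c p L | W c.
     p 0 = 1 \<and> p (Suc L) = 1 \<and>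
     (\<forall>j\<le>L. \<forall>i<p (Suc j). \<bar>c j i\<bar> \<le> B \<and> (\<forall>k<p j. \<bar>W j i k\<bar> \<le> B)) \<and>
     card {(j, i, k). j \<le> L \<and> i < p (Suc j) \<and> k < p j \<and> W j i k \<noteq> 0} +
       card {(j, i). j \<le> L \<and> i < p (Suc j) \<and> c j i \<noteq> 0} \<le> s}"

text \<open>Functions on \<open>[0, U]\<close> are extended by their value at \<open>U\<close>; the (irrelevant) values on the
  negative axis are fixed by extending with the value at \<open>0\<close>.\<close>

definition sieve_class :: "real \<Rightarrow> real \<Rightarrow> real \<Rightarrow> real \<Rightarrow> real \<Rightarrow> (real \<Rightarrow> real) \<Rightarrow>
    nat \<Rightarrow> (nat \<Rightarrow> nat) \<Rightarrow> nat \<Rightarrow> real \<Rightarrow> (real \<Rightarrow> real) set" where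
  "sieve_class \<kappa> K \<beta> U H\<^sub>1 S L p s B =
     {\<lambda>r. \<kappa> + (K - \<kappa>) * S (N (max 0 (min r U))) | N. N \<in> NN L p s B} \<inter> holder_ball \<beta> U H\<^sub>1"

definition covering_number :: "real \<Rightarrow> real \<Rightarrow> (real \<Rightarrow> real) set \<Rightarrow> enat" where
  "covering_number U e F =
     (INF T \<in> {T. finite T \<and> (\<forall>f\<in>F. \<exists>t\<in>T. \<forall>x\<in>{0..U}. \<bar>f x - t x\<bar> \<le> e)}. enat (card T))"

text \<open>The ReQU sieve together with the approximation and entropy bounds that its constants are
  chosen to guarantee.\<close>

definition requ_sieve ::
  "(real ^ 'd \<Rightarrow> real) \<Rightarrow> real \<Rightarrow> real \<Rightarrow> real \<Rightarrow> real \<Rightarrow> real \<Rightarrow> (real \<Rightarrow> real) \<Rightarrow> real \<Rightarrow>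
   nat \<Rightarrow> real \<Rightarrow> real \<Rightarrow> (nat \<Rightarrow> (real \<Rightarrow> real) set) \<Rightarrow> bool" where
  "requ_sieve V \<kappa> K \<beta> U H\<^sub>1 \<Xi>\<^sub>0 \<eta>\<^sub>0 m\<^sub>0 C_KL C_ent \<X> \<longleftrightarrow>
     1 \<le> m\<^sub>0 \<and> 0 < C_KL \<and> 0 < C_ent \<and>
     (\<exists>L_net C_p C_s C_B \<tau> S p B.
        0 < C_p \<and> 0 < C_s \<and> 0 < C_B \<and>
        0 < \<tau> \<and> \<tau> < \<eta>\<^sub>0 / (4 * (K - \<kappa>)) \<and>
        range S \<subseteq> {0..1} \<and> (\<exists>l. l-lipschitz_on UNIV S) \<and> (\<forall>z\<in>{\<tau>..1 - \<tau>}. S z = z) \<and>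
        (\<forall>m\<ge>m\<^sub>0. p m 0 = 1 \<and> p m (Suc L_net) = 1 \<and> (\<forall>j\<le>Suc L_net. real (p m j) \<le> C_p * real m) \<and>
            B m \<le> real m powr C_B \<and>
            \<X> m = sieve_class \<kappa> K \<beta> U H\<^sub>1 S L_net (p m) (nat \<lceil>C_s * real m\<rceil>) (B m))) \<and>
     (\<forall>m\<ge>m\<^sub>0. \<exists>\<xi>\<in>\<X> m. KL V \<Xi>\<^sub>0 \<xi> \<le> C_KL * real m powr (- 2 * (\<beta> + 1))) \<and>
     (\<forall>m\<ge>m\<^sub>0. \<forall>e\<in>{0<..1}. \<exists>N. covering_number U e (\<X> m) = enat N \<and>
        ln (real N) \<le> C_ent * real m * ln (C_ent * real m / e))"

section \<open>Truncation\<close>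

definition sublevel :: "(real ^ 'd \<Rightarrow> real) \<Rightarrow> real \<Rightarrow> (real ^ 'd) set" where
  "sublevel V M = {x. V x \<le> M}"

definition tail :: "(real ^ 'd \<Rightarrow> real) \<Rightarrow> (real \<Rightarrow> real) \<Rightarrow> real \<Rightarrow> real" where
  "tail V \<xi> M = (LINT x:- sublevel V M|lborel. sdens V \<xi> x)"

definition sdens_trunc :: "(real ^ 'd \<Rightarrow> real) \<Rightarrow> (real \<Rightarrow> real) \<Rightarrow> real \<Rightarrow> real ^ 'd \<Rightarrow> real" where
  "sdens_trunc V \<xi> M x = sdens V \<xi> x * indicator (sublevel V M) x / (1 - tail V \<xi> M)"

definition tail_sup ::
  "(real ^ 'd \<Rightarrow> real) \<Rightarrow> (real \<Rightarrow> real) set \<Rightarrow> (real \<Rightarrow> real) \<Rightarrow> real \<Rightarrow> real" where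
  "tail_sup V F \<Xi>\<^sub>0 M = (SUP \<xi>\<in>F \<union> {\<Xi>\<^sub>0}. tail V \<xi> M)"

definition dtrunc ::
  "(real ^ 'd \<Rightarrow> real) \<Rightarrow> (real \<Rightarrow> real) set \<Rightarrow> (real \<Rightarrow> real) \<Rightarrow> real \<Rightarrow> real" where
  "dtrunc V F \<Xi>\<^sub>0 M = - ln (1 - tail_sup V F \<Xi>\<^sub>0 M)"

definition Rtrunc ::
  "(real ^ 'd \<Rightarrow> real) \<Rightarrow> (real \<Rightarrow> real) set \<Rightarrow> (real \<Rightarrow> real) \<Rightarrow> real \<Rightarrow> real" where
  "Rtrunc V F \<Xi>\<^sub>0 M =
     (SUP \<xi>\<in>F. LINT x:- sublevel V M|lborel. sdens V \<Xi>\<^sub>0 x * \<bar>ln (sdens V \<Xi>\<^sub>0 x / sdens V \<xi> x)\<bar>)"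

definition Mtrunc :: "(real ^ 'd \<Rightarrow> real) \<Rightarrow> real \<Rightarrow> nat \<Rightarrow> real" where
  "Mtrunc V C_tr n = vmin V + C_tr * ln (real n)"

definition Bgamma :: "real \<Rightarrow> real" where
  "Bgamma \<gamma> = (ln (1 / \<gamma>))\<^sup>2 / (ln (1 / \<gamma>) - 1 + \<gamma>)"

text \<open>\<open>b n\<close> has the order of \<open>Bgamma\<close> at a two-sided bound \<open>\<gamma>\<close> for the truncated density
  ratios at level \<open>Mtrunc V C_tr n\<close>, uniformly over the sieve; the state space is all of
  \<open>\<real>\<^sup>d\<close>, so the applicable growth condition is the noncompact one.\<close>

definition ratio_order ::
  "(real ^ 'd \<Rightarrow> real) \<Rightarrow> (real \<Rightarrow> real) \<Rightarrow> nat \<Rightarrow> (nat \<Rightarrow> (real \<Rightarrow> real) set) \<Rightarrow> real \<Rightarrow> (nat \<Rightarrow> real) \<Rightarrow> bool"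
where
  "ratio_order V \<Xi>\<^sub>0 m\<^sub>0 \<X> C_tr b \<longleftrightarrow>
     (\<exists>\<gamma> :: real \<Rightarrow> real.
        (\<forall>n\<ge>2. let M = Mtrunc V C_tr n in 0 < \<gamma> M \<and> \<gamma> M < 1 \<and>
           (\<forall>m\<ge>m\<^sub>0. \<forall>\<xi>\<in>\<X> m. \<forall>x\<in>sublevel V M.
              \<gamma> M \<le> sdens_trunc V \<Xi>\<^sub>0 M x / sdens_trunc V \<xi> M x \<and>
              sdens_trunc V \<Xi>\<^sub>0 M x / sdens_trunc V \<xi> M x \<le> inverse (\<gamma> M))) \<and>
        b \<in> \<Theta>(\<lambda>n. Bgamma (\<gamma> (Mtrunc V C_tr n)))) \<and>
     (\<forall>n\<ge>2. 0 < b n) \<and> b \<in> O(\<lambda>n. ln (real n))"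

section \<open>Sampling, estimation and the oracle bound\<close>

text \<open>With probability at least \<open>p\<close>, in the inner sense: no measurability of the estimator (hence
  of the events built from it) is presupposed. For measurable events this is the usual notion.\<close>

definition with_prob_ge :: "'w measure \<Rightarrow> real \<Rightarrow> ('w \<Rightarrow> bool) \<Rightarrow> bool" where
  "with_prob_ge P p E \<longleftrightarrow> (\<exists>A\<in>sets P. (\<forall>\<omega>\<in>A. E \<omega>) \<and> p \<le> measure P A)"

definition bigO_P :: "(nat \<Rightarrow> 'w measure) \<Rightarrow> (nat \<Rightarrow> 'w \<Rightarrow> real) \<Rightarrow> (nat \<Rightarrow> real) \<Rightarrow> bool" where
  "bigO_P P Y \<rho> \<longleftrightarrow>
     (\<forall>e>0. \<exists>C. \<forall>\<^sub>F n in sequentially. with_prob_ge (P n) (1 - e) (\<lambda>\<omega>. \<bar>Y n \<omega>\<bar> \<le> C * \<rho> n))"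

definition iid_sample :: "'w measure \<Rightarrow> nat \<Rightarrow> (nat \<Rightarrow> 'w \<Rightarrow> real ^ 'd) \<Rightarrow> (real ^ 'd \<Rightarrow> real) \<Rightarrow> bool" where
  "iid_sample P n X f \<longleftrightarrow> prob_space P \<and> prob_space.indep_vars P (\<lambda>_. borel) X {1..n} \<and>
     (\<forall>i\<in>{1..n}. distributed P lborel (X i) (\<lambda>x. ennreal (f x)))"

definition neg_loglik :: "(real ^ 'd \<Rightarrow> real) \<Rightarrow> nat \<Rightarrow> (nat \<Rightarrow> real ^ 'd) \<Rightarrow> (real \<Rightarrow> real) \<Rightarrow> real" where
  "neg_loglik V n x \<xi> = 1 / real n * (\<Sum>i=1..n. - ln (sdens V \<xi> (x i)))"

definition Rbound ::
  "(real ^ 'd \<Rightarrow> real) \<Rightarrow> (real \<Rightarrow> real) \<Rightarrow> real \<Rightarrow> (nat \<Rightarrow> (real \<Rightarrow> real) set) \<Rightarrow> (nat \<Rightarrow> real) \<Rightarrow>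
   real \<Rightarrow> real \<Rightarrow> nat \<Rightarrow> nat \<Rightarrow> real \<Rightarrow> real" where
  "Rbound V \<Xi>\<^sub>0 \<beta> \<X> b C_tr C_or n m \<delta> = C_or *
     (real m powr (- 2 * (\<beta> + 1)) + b n * (real m * ln (real n) + ln (1 / \<delta>)) / real n
      + dtrunc V (\<X> m) \<Xi>\<^sub>0 (Mtrunc V C_tr n) + Rtrunc V (\<X> m) \<Xi>\<^sub>0 (Mtrunc V C_tr n))"

definition conf_level :: "(real ^ 'd \<Rightarrow> real) \<Rightarrow> (real \<Rightarrow> real) \<Rightarrow> real \<Rightarrow> nat \<Rightarrow> real \<Rightarrow> real" where
  "conf_level V \<Xi>\<^sub>0 C_tr n \<delta> = (1 - \<delta>) * (1 - tail V \<Xi>\<^sub>0 (Mtrunc V C_tr n)) ^ n"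

definition L2_dist :: "real \<Rightarrow> real \<Rightarrow> (real \<Rightarrow> real) \<Rightarrow> (real \<Rightarrow> real) \<Rightarrow> real" where
  "L2_dist a b f h = sqrt (LINT r:{a..b}|lborel. (f r - h r)\<^sup>2)"

end

theory Submission
  imports Defs "HOL-Computational_Algebra.Polynomial" "HOL-Real_Asymp.Real_Asymp"
begin

text \<open>
  Write \<open>F = s\<^sub>\<Xi>\<^sub>0 - s\<^sub>\<xi>\<close>. Since \<open>s\<^sub>\<xi>' (r) = - 1 / (r \<xi> (r))\<close>, on \<open>I\<close> the error \<open>\<xi> - \<Xi>\<^sub>0\<close> is comparable to \<open>F'\<close>.

  The relative entropy controls \<open>F\<close> itself: evaluated at \<open>\<pi>\<^sub>0 (x)\<close>, \<open>F\<close> is at most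
  \<open>\<kappa>\<^sup>-\<^sup>1 \<bar>log (\<pi>\<^sub>0 (x) / \<pi>\<^sub>\<xi> (x))\<bar>\<close>, the log-ratio is bounded on sublevel sets, so its square is dominated by the
  integrand of the entropy, and the law of \<open>\<pi>\<^sub>0\<close> under Lebesgue measure has density bounded below on compact
  subsets of \<open>(0, a\<^sub>0)\<close>. Hence \<open>\<parallel>F\<parallel>\<^sub>2\<^sup>2 \<le> C KL\<close> on an interval slightly larger than \<open>I\<close>.

  As \<open>F\<close> is Hoelder of order \<open>\<beta> + 1\<close>, finite differences with step \<open>t\<close> give
  \<open>\<parallel>F'\<parallel>\<^sub>2\<^sup>2 \<le> C (t\<^sup>-\<^sup>2 \<parallel>F\<parallel>\<^sub>2\<^sup>2 + t\<^sup>2\<^sup>\<beta>)\<close>, and \<open>t = KL\<^sup>1\<^sup>/\<^sup>(\<^sup>2\<^sup>\<beta>\<^sup>+\<^sup>2\<^sup>)\<close> yields the exponent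
  \<open>\<beta> / (2 (\<beta> + 1))\<close>. Large values of the entropy are harmless because \<open>\<bar>\<xi> - \<Xi>\<^sub>0\<bar> \<le> K\<close>, so \<open>C_mode = 1\<close>
  suffices.

  For the rate, exponential tails of the densities make the truncation terms \<open>O(n\<^sup>-\<^sup>p)\<close> with \<open>p = C_tr c_a > 1\<close>,
  which is negligible since \<open>b n\<close> is bounded away from \<open>0\<close>.
\<close>

section \<open>Inverse functions and stationary densities\<close>

text \<open>Every constant has to hold for all candidate estimators at once, so it may depend on the
  coefficients only through \<kappa>, K, the Hoelder radii and the common maximum
  \<open>a\<^sub>0\<close>. The logarithmic scale makes this possible: as \<kappa> \<le> \<xi> \<le>
  K, both \<open>gfun \<xi>\<close> in the variable ln r and the logarithm of the total mass in the
  normalising constant are bi-Lipschitz, with slopes given by \<kappa> and K alone. The remaining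
  obstacle is localisation. The difference quotients reach to the right of I, where the
  corresponding levels of V may be critical; the law of the density is therefore bounded from below
  through volumes of strips between two levels, not through pointwise values of the level density.
  Moreover the entropy integrand changes sign, so before restriction to a sublevel set it is
  replaced by a nonnegative function with the same integral.\<close>

lemma bilipschitz_unique_root:
  fixes f :: "real \<Rightarrow> real"
  assumes "0 < c" and f: "\<And>x y. x \<le> y \<Longrightarrow> c * (y - x) \<le> f y - f x \<and> f y - f x \<le> C * (y - x)"
  shows "\<exists>!x. f x = z"
proof -
  have "\<bar>f y - f x\<bar> \<le> C * \<bar>y - x\<bar>" for x y
  proof -
    have "0 \<le> c * \<bar>y - x\<bar>" using \<open>0 < c\<close> by simp
    then show ?thesis
      using f[of x y] f[of y x] by (cases "x \<le> y") auto
  qed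
  moreover have "0 \<le> C"
    using f[of 0 1] \<open>0 < c\<close> by auto
  ultimately have "C-lipschitz_on UNIV f"
    by (auto simp: lipschitz_on_def dist_real_def)
  then have cont: "continuous_on UNIV f"
    by (rule lipschitz_on_continuous_on)
  \<comment> \<open>At distance \<open>t\<close> from 0 the lower slope bound has moved
    \<open>f\<close> by at least \<open>\<bar>z - f 0\<bar>\<close>, so \<open>z\<close> lies
    between \<open>f (- t)\<close> and \<open>f t\<close>.\<close>
  define t where "t = \<bar>z - f 0\<bar> / c"
  have t: "0 \<le> t" "c * t = \<bar>z - f 0\<bar>"
    using \<open>0 < c\<close> by (auto simp: t_def)
  have "f (- t) \<le> z" "z \<le> f t"
    using f[of 0 t] f[of "- t" 0] t by (auto simp: abs_if split: if_splits)
  then obtain x where x: "f x = z"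
    using IVT'[of f "- t" z t] t continuous_on_subset[OF cont] by auto
  show ?thesis
  proof (rule ex1I[of _ x])
    show "y = x" if y: "f y = z" for y
    proof (rule linorder_cases)
      assume "x < y"
      then have "0 < c * (y - x)" using \<open>0 < c\<close> by simp
      then show ?thesis using f[of x y] x y \<open>x < y\<close> by linarith
    next
      assume "y < x"
      then have "0 < c * (x - y)" using \<open>0 < c\<close> by simp
      then show ?thesis using f[of y x] x y \<open>y < x\<close> by linarith
    qed simp
  qed (rule x)
qed

section \<open>The antiderivative \<open>gfun\<close> and its inverse on the logarithmic
  scale\<close>

locale coefficient =
  fixes \<kappa> K L :: real and \<xi> :: "real \<Rightarrow> real"
  assumes kappa_pos: "0 < \<kappa>" and cond_C: "cond_C \<kappa> K L \<xi>"
begin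

lemma bounds: "0 \<le> r \<Longrightarrow> \<kappa> \<le> \<xi> r" "0 \<le> r \<Longrightarrow> \<xi> r \<le> K"
  using cond_C by (auto simp: cond_C_def)

lemma pos: "0 \<le> r \<Longrightarrow> 0 < \<xi> r"
  using bounds kappa_pos by force

lemma kappa_le_K: "\<kappa> \<le> K"
  using bounds[of 0] by linarith

lemma K_pos: "0 < K"
  using kappa_le_K kappa_pos by linarith

lemma continuous: "continuous_on {0..} \<xi>"
  using cond_C by (auto simp: cond_C_def intro: lipschitz_on_continuous_on)

lemma gfun_deriv:
  assumes "0 < r"
  shows "(gfun \<xi> has_real_derivative 1 / (r * \<xi> r)) (at r)"
proof -
  \<comment> \<open>The interval must contain the base point 1 of the integral and have
    \<open>r\<close> in its interior, yet stay away from 0, where the integrand is singular.\<close>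
  define a b where "a = min 1 r / 2" and "b = max 1 r + 1"
  have ab: "0 < a" "a < r" "r < b" "a < 1" "1 < b"
    using assms by (auto simp: a_def b_def)
  have "continuous_on {a..b} (\<lambda>u. 1 / (u * \<xi> u))"
    using ab pos by (auto intro!: continuous_intros continuous_on_subset[OF continuous] simp: less_imp_neq[symmetric])
  then have "((\<lambda>u. LBINT y=1..u. 1 / (y * \<xi> y)) has_vector_derivative 1 / (r * \<xi> r)) (at r within {a..b})"
    using ab interval_integral_FTC2[of a 1 b "\<lambda>u. 1 / (u * \<xi> u)" r] by (simp add: one_ereal_def)
  moreover have "at r within {a..b} = at r"
    using ab by (auto intro: at_within_interior)
  ultimately show ?thesis
    by (simp add: gfun_def[abs_def] has_real_derivative_iff_has_vector_derivative one_ereal_def)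
qed

text \<open>Since 1 / (r K) \<le> 1 / (r \<xi> r) \<le> 1 / (r \<kappa>), the functions
  \<open>gfun \<xi>\<close> - ln / K and ln / \<kappa> - \<open>gfun \<xi>\<close> are
  nondecreasing. The uniform envelopes of the densities and of their inverses all go back to these
  two inequalities.\<close>

lemma gfun_bounds:
  assumes "0 < x" "x \<le> y"
  shows "(ln y - ln x) / K \<le> gfun \<xi> y - gfun \<xi> x" "gfun \<xi> y - gfun \<xi> x \<le> (ln y - ln x) / \<kappa>"
proof -
  have "gfun \<xi> x - ln x / K \<le> gfun \<xi> y - ln y / K"
  proof (rule DERIV_nonneg_imp_nondecreasing[OF assms(2)])
    fix r assume "x \<le> r" "r \<le> y"
    then have r: "0 < r" using assms by linarith
    have "1 / (r * \<xi> r) - 1 / r / K \<ge> 0"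
      using r pos[of r] bounds[of r] K_pos by (auto simp: field_simps)
    moreover have "((\<lambda>r. gfun \<xi> r - ln r / K) has_real_derivative 1 / (r * \<xi> r) - 1 / r / K) (at r)"
      using r K_pos by (auto intro!: derivative_eq_intros gfun_deriv)
    ultimately show "\<exists>y. ((\<lambda>r. gfun \<xi> r - ln r / K) has_real_derivative y) (at r) \<and> 0 \<le> y"
      by blast
  qed
  then show "(ln y - ln x) / K \<le> gfun \<xi> y - gfun \<xi> x"
    by (simp add: diff_divide_distrib)
  have "ln x / \<kappa> - gfun \<xi> x \<le> ln y / \<kappa> - gfun \<xi> y"
  proof (rule DERIV_nonneg_imp_nondecreasing[OF assms(2)])
    fix r assume "x \<le> r" "r \<le> y"
    then have r: "0 < r" using assms by linarith
    have "1 / r / \<kappa> - 1 / (r * \<xi> r) \<ge> 0"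
      using r pos[of r] bounds[of r] kappa_pos by (auto simp: field_simps)
    moreover have "((\<lambda>r. ln r / \<kappa> - gfun \<xi> r) has_real_derivative 1 / r / \<kappa> - 1 / (r * \<xi> r)) (at r)"
      using r kappa_pos by (auto intro!: derivative_eq_intros gfun_deriv)
    ultimately show "\<exists>y. ((\<lambda>r. ln r / \<kappa> - gfun \<xi> r) has_real_derivative y) (at r) \<and> 0 \<le> y"
      by blast
  qed
  then show "gfun \<xi> y - gfun \<xi> x \<le> (ln y - ln x) / \<kappa>"
    by (simp add: diff_divide_distrib)
qed

lemma gfun_less: "0 < x \<Longrightarrow> x < y \<Longrightarrow> gfun \<xi> x < gfun \<xi> y"
  using gfun_bounds(1)[of x y] K_pos
  by (smt (verit) divide_pos_pos ln_less_cancel_iff)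

lemma bij_gfun: "bij_betw (gfun \<xi>) {0<..} UNIV"
proof -
  \<comment> \<open>In the variable ln r the map is bi-Lipschitz on the whole line with slopes
    between 1 / K and 1 / \<kappa>, which yields surjectivity.\<close>
  have "\<exists>!t. gfun \<xi> (exp t) = y" for y
    using gfun_bounds[of "exp x" "exp y" for x y] K_pos
    by (intro bilipschitz_unique_root[of "1 / K" _ "1 / \<kappa>"]) auto
  then have "\<exists>r>0. gfun \<xi> r = y" for y
    by (metis exp_gt_zero)
  moreover have "inj_on (gfun \<xi>) {0<..}"
    by (auto intro!: linorder_inj_onI' dest: gfun_less)
  moreover have "y \<in> gfun \<xi> ` {0<..}" for y
    using calculation(1)[of y] by force
  ultimately show ?thesis
    unfolding bij_betw_def by blast
qed

lemma ginv_pos [simp]: "0 < ginv \<xi> y"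
  and gfun_ginv [simp]: "gfun \<xi> (ginv \<xi> y) = y"
  using bij_gfun the_inv_into_into[of "gfun \<xi>" "{0<..}" y "{0<..}"] f_the_inv_into_f[of "gfun \<xi>" "{0<..}" y]
  by (auto simp: ginv_def bij_betw_def)

lemma ginv_gfun [simp]: "0 < r \<Longrightarrow> ginv \<xi> (gfun \<xi> r) = r"
  using bij_gfun by (auto simp: ginv_def bij_betw_def the_inv_into_f_f)

lemma ginv_le_iff: "ginv \<xi> y \<le> ginv \<xi> z \<longleftrightarrow> y \<le> z"
  by (metis gfun_ginv gfun_less ginv_pos linorder_not_less order_le_less)

text \<open>Inverting \<open>gfun_bounds\<close> turns the slopes 1 / K and 1 / \<kappa> into K and
  \<kappa>. Exponentiated, this squeezes the stationary densities between two exponentials of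
  V.\<close>

lemma ginv_growth:
  assumes "y \<le> z"
  shows "\<kappa> * (z - y) \<le> ln (ginv \<xi> z) - ln (ginv \<xi> y)"
    and "ln (ginv \<xi> z) - ln (ginv \<xi> y) \<le> K * (z - y)"
  using gfun_bounds[of "ginv \<xi> y" "ginv \<xi> z"] assms kappa_pos K_pos
  by (auto simp: ginv_le_iff field_simps)

lemma ginv_exp_bounds:
  assumes "y \<le> z"
  shows "exp (\<kappa> * (z - y)) * ginv \<xi> y \<le> ginv \<xi> z" "ginv \<xi> z \<le> exp (K * (z - y)) * ginv \<xi> y"
proof -
  have "exp (\<kappa> * (z - y)) * exp (ln (ginv \<xi> y)) \<le> exp (ln (ginv \<xi> z))"
    using ginv_growth(1)[OF assms] by (simp flip: exp_add del: exp_ln)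
  then show "exp (\<kappa> * (z - y)) * ginv \<xi> y \<le> ginv \<xi> z" by simp
  have "exp (ln (ginv \<xi> z)) \<le> exp (K * (z - y)) * exp (ln (ginv \<xi> y))"
    using ginv_growth(2)[OF assms] by (simp flip: exp_add del: exp_ln)
  then show "ginv \<xi> z \<le> exp (K * (z - y)) * ginv \<xi> y" by simp
qed

lemma ginv_measurable [measurable]: "ginv \<xi> \<in> borel_measurable borel"
  by (intro borel_measurable_mono monoI) (simp add: ginv_le_iff)

end

section \<open>Integrability and positivity for exponentials of the potential\<close>

lemma lborel_integral_pos:
  fixes f :: "'a::euclidean_space \<Rightarrow> real"
  assumes "integrable lborel f" and "\<And>x. 0 < f x"
  shows "0 < (\<integral>x. f x \<partial>lborel)"
proof -
  have "f x \<noteq> 0" for x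
    using assms(2)[of x] by simp
  then have "\<not> (AE x in lborel. f x = 0)"
    by (simp add: eventually_False ae_filter_eq_bot_iff)
  then have "(\<integral>x. f x \<partial>lborel) \<noteq> 0"
    using assms by (subst integral_nonneg_eq_0_iff_AE) (auto simp: less_imp_le)
  moreover have "0 \<le> (\<integral>x. f x \<partial>lborel)"
    using assms(2) by (intro integral_nonneg_AE) (simp add: less_imp_le)
  ultimately show ?thesis by linarith
qed

locale potential =
  fixes V :: "real ^ 'd \<Rightarrow> real"
  assumes cond_P: "cond_P V"
begin

abbreviation "v \<equiv> vmin V"

lemma vmin_le [simp]: "v \<le> V x"
  using cond_P by (auto simp: cond_P_def)

lemma coarea: "\<phi> \<in> borel_measurable borel \<Longrightarrow>
    (\<integral>\<^sup>+ s \<in> {v<..}. \<phi> s * level_density V s \<partial>lebesgue) = (\<integral>\<^sup>+ x. \<phi> (V x) \<partial>lborel)"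
  using cond_P unfolding cond_P_def by metis

lemma C1:
  obtains G where "\<And>x. GDERIV V x :> G x" "continuous_on UNIV G"
proof -
  obtain G D where "\<And>x. GDERIV V x :> G x" "\<And>x. (G has_derivative blinfun_apply (D x)) (at x)"
    using cond_P unfolding cond_P_def C2_def by metis
  moreover from this(2) have "continuous_on UNIV G"
    by (auto intro!: continuous_at_imp_continuous_on has_derivative_continuous)
  ultimately show ?thesis using that by blast
qed

lemma V_continuous: "continuous_on UNIV V"
proof -
  obtain G where "\<And>x. GDERIV V x :> G x" using C1 by blast
  then show ?thesis
    by (auto intro!: continuous_at_imp_continuous_on has_derivative_continuous simp: gderiv_def)
qed

lemma V_measurable [measurable]: "V \<in> borel_measurable borel"
  using V_continuous by (rule borel_measurable_continuous_onI)

lemma exp_integrable: "0 < a \<Longrightarrow> integrable lborel (\<lambda>x. exp (- a * (V x - v)))"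
proof -
  assume "0 < a"
  then have "integrable lborel (\<lambda>x. exp (a * v) * exp (- a * V x))"
    using cond_P by (auto simp: cond_P_def)
  then show ?thesis by (simp flip: exp_add add: algebra_simps)
qed

text \<open>Half of the exponential rate absorbs the linear factor, through t \<le> (2 / a) exp (a t
  / 2). Linear factors occur because logarithms of density ratios are bounded linearly in V.\<close>

lemma linear_exp_integrable:
  assumes "0 < a"
  shows "integrable lborel (\<lambda>x. (A + B * (V x - v)) * exp (- a * (V x - v)))"
proof (rule Bochner_Integration.integrable_bound)
  show "integrable lborel (\<lambda>x. (\<bar>A\<bar> + \<bar>B\<bar> * 2 / a) * exp (- (a / 2) * (V x - v)))"
    using assms by (intro integrable_mult_right exp_integrable) simp
  have "\<bar>(A + B * t) * exp (- a * t)\<bar> \<le> (\<bar>A\<bar> + \<bar>B\<bar> * 2 / a) * exp (- (a / 2) * t)" if "0 \<le> t" for t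
  proof -
    have "\<bar>A + B * t\<bar> \<le> \<bar>A\<bar> + \<bar>B\<bar> * t"
      using that abs_triangle_ineq[of A "B * t"] by (simp add: abs_mult)
    also have "t \<le> 2 / a * exp (a / 2 * t)"
      using exp_ge_add_one_self[of "a / 2 * t"] assms by (simp add: field_simps)
    then have "\<bar>B\<bar> * t \<le> \<bar>B\<bar> * (2 / a * exp (a / 2 * t))"
      by (intro mult_left_mono) auto
    then have "\<bar>A\<bar> + \<bar>B\<bar> * t \<le> \<bar>A\<bar> * exp (a / 2 * t) + \<bar>B\<bar> * (2 / a * exp (a / 2 * t))"
      using assms that mult_left_mono[of 1 "exp (a / 2 * t)" "\<bar>A\<bar>"] by auto
    finally have "\<bar>A + B * t\<bar> \<le> (\<bar>A\<bar> + \<bar>B\<bar> * 2 / a) * exp (a / 2 * t)"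
      by (simp add: algebra_simps)
    then have "\<bar>A + B * t\<bar> * exp (- a * t) \<le> (\<bar>A\<bar> + \<bar>B\<bar> * 2 / a) * exp (a / 2 * t) * exp (- a * t)"
      by (intro mult_right_mono) auto
    also have "\<dots> = (\<bar>A\<bar> + \<bar>B\<bar> * 2 / a) * exp (- (a / 2) * t)"
      by (simp add: mult.assoc flip: exp_add)
    finally show ?thesis by (simp add: abs_mult)
  qed
  from this[of "V x - v" for x]
  show "AE x in lborel. norm ((A + B * (V x - v)) * exp (- a * (V x - v)))
      \<le> norm ((\<bar>A\<bar> + \<bar>B\<bar> * 2 / a) * exp (- (a / 2) * (V x - v)))"
    by (intro AE_I2) (auto intro: order.trans[OF _ abs_ge_self])
qed simp

lemma Zconst_pos: "0 < a \<Longrightarrow> 0 < Zconst V a"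
  unfolding Zconst_def by (intro lborel_integral_pos exp_integrable) simp_all

end

section \<open>Normalisation and exponential envelopes of the stationary densities\<close>

locale potential_coefficient = potential V + coefficient \<kappa> K L \<xi>
  for V :: "real ^ 'd \<Rightarrow> real" and \<kappa> K L \<xi>
begin

lemma ginv_integrable: "integrable lborel (\<lambda>x. ginv \<xi> (\<mu> - V x))"
proof (rule Bochner_Integration.integrable_bound)
  show "integrable lborel (\<lambda>x. ginv \<xi> (\<mu> - v) * exp (- \<kappa> * (V x - v)))"
    using kappa_pos by (intro integrable_mult_right exp_integrable)
  show "AE x in lborel. norm (ginv \<xi> (\<mu> - V x)) \<le> norm (ginv \<xi> (\<mu> - v) * exp (- \<kappa> * (V x - v)))"
  proof (intro AE_I2)
    fix x
    have "exp (\<kappa> * (V x - v)) * ginv \<xi> (\<mu> - V x) \<le> ginv \<xi> (\<mu> - v)"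
      using ginv_exp_bounds(1)[of "\<mu> - V x" "\<mu> - v"] by simp
    then have "ginv \<xi> (\<mu> - V x) \<le> ginv \<xi> (\<mu> - v) * exp (- \<kappa> * (V x - v))"
      by (simp add: exp_minus divide_simps mult.commute del: right_diff_distrib_numeral)
    then show "norm (ginv \<xi> (\<mu> - V x)) \<le> norm (ginv \<xi> (\<mu> - v) * exp (- \<kappa> * (V x - v)))"
      using ginv_pos[of "\<mu> - V x"] ginv_pos[of "\<mu> - v"] by (simp add: abs_mult abs_of_pos del: ginv_pos)
  qed
qed measurable

text \<open>The total mass of the unnormalised density as a function of the free constant. The
  coarea identity equates it with the one-dimensional integral that defines
  \<open>mu\<close>.\<close>

definition mass :: "real \<Rightarrow> real" where
  "mass \<mu> = (\<integral>x. ginv \<xi> (\<mu> - V x) \<partial>lborel)"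

lemma mass_pos: "0 < mass \<mu>"
  unfolding mass_def by (intro lborel_integral_pos ginv_integrable ginv_pos)

text \<open>The factors exp (\<kappa> (z - y)) and exp (K (z - y)) in the pointwise comparison do
  not depend on the point of space and pass through the integral.\<close>

lemma ln_mass_bounds:
  assumes "y \<le> z"
  shows "\<kappa> * (z - y) \<le> ln (mass z) - ln (mass y)" "ln (mass z) - ln (mass y) \<le> K * (z - y)"
proof -
  have "exp (\<kappa> * (z - y)) * mass y \<le> mass z"
    unfolding mass_def Bochner_Integration.integral_mult_right_zero[symmetric]
    using ginv_exp_bounds(1)[of "y - t" "z - t" for t] assms
    by (intro integral_mono integrable_mult_right ginv_integrable) auto
  then have "ln (exp (\<kappa> * (z - y)) * mass y) \<le> ln (mass z)"
    using mass_pos by (subst ln_le_cancel_iff) auto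
  then show "\<kappa> * (z - y) \<le> ln (mass z) - ln (mass y)"
    using mass_pos[of y] by (simp add: ln_mult_pos)
  have "mass z \<le> exp (K * (z - y)) * mass y"
    unfolding mass_def Bochner_Integration.integral_mult_right_zero[symmetric]
    using ginv_exp_bounds(2)[of "y - t" "z - t" for t] assms
    by (intro integral_mono integrable_mult_right ginv_integrable) auto
  then have "ln (mass z) \<le> ln (exp (K * (z - y)) * mass y)"
    using mass_pos by (subst ln_le_cancel_iff) auto
  then show "ln (mass z) - ln (mass y) \<le> K * (z - y)"
    using mass_pos[of y] by (simp add: ln_mult_pos)
qed

lemma mass_mu: "mass (mu V \<xi>) = 1"
proof -
  have "(\<integral>\<^sup>+ s \<in> {v<..}. ennreal (ginv \<xi> (\<mu> - s)) * level_density V s \<partial>lebesgue) = ennreal (mass \<mu>)" for \<mu>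
    unfolding mass_def by (subst coarea, measurable)
      (auto intro!: nn_integral_eq_integral ginv_integrable simp: less_imp_le)
  \<comment> \<open>After taking logarithms the normalisation is a root problem for a bi-Lipschitz
    function, so the definite description in \<open>mu\<close> denotes a unique number.\<close>
  moreover have "\<exists>!\<mu>. ln (mass \<mu>) = 0"
    using ln_mass_bounds kappa_pos by (intro bilipschitz_unique_root[of \<kappa> _ K]) auto
  then have "\<exists>!\<mu>. ennreal (mass \<mu>) = 1"
    using mass_pos by (simp add: ln_eq_zero_iff less_imp_le flip: ennreal_1)
  ultimately show ?thesis
    unfolding mu_def using theI'[of "\<lambda>\<mu>. ennreal (mass \<mu>) = 1"] mass_pos
    by (simp add: less_imp_le flip: ennreal_1)
qed

lemma qfun_pos [simp]: "0 < qfun V \<xi> s"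
  by (simp add: qfun_def)

lemma qfun_le_iff: "qfun V \<xi> s \<le> qfun V \<xi> t \<longleftrightarrow> t \<le> s"
  by (simp add: qfun_def ginv_le_iff)

lemma sfun_qfun [simp]: "sfun V \<xi> (qfun V \<xi> s) = s"
  by (simp add: sfun_def qfun_def)

lemma qfun_sfun [simp]: "0 < r \<Longrightarrow> qfun V \<xi> (sfun V \<xi> r) = r"
  by (simp add: sfun_def qfun_def)

lemma ln_qfun_bounds:
  assumes "s \<le> t"
  shows "\<kappa> * (t - s) \<le> ln (qfun V \<xi> s) - ln (qfun V \<xi> t)" "ln (qfun V \<xi> s) - ln (qfun V \<xi> t) \<le> K * (t - s)"
  using ginv_growth[of "mu V \<xi> - t" "mu V \<xi> - s"] assms by (auto simp: qfun_def)

lemma sdens_pos [simp]: "0 < sdens V \<xi> x"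
  by (simp add: sdens_def)

lemma sdens_nonneg [simp]: "0 \<le> sdens V \<xi> x"
  and sdens_nonzero [simp]: "sdens V \<xi> x \<noteq> 0"
  using sdens_pos[of x] by linarith+

lemma sdens_measurable [measurable]: "sdens V \<xi> \<in> borel_measurable borel"
  unfolding sdens_def[abs_def] qfun_def by measurable

lemma sdens_integrable: "integrable lborel (sdens V \<xi>)"
  and sdens_integral: "(\<integral>x. sdens V \<xi> x \<partial>lborel) = 1"
  using ginv_integrable[of "mu V \<xi>"] mass_mu by (auto simp: sdens_def[abs_def] qfun_def mass_def)

lemma amax_pos [simp]: "0 < amax V \<xi>"
  by (simp add: amax_def)

lemma amax_nonneg [simp]: "0 \<le> amax V \<xi>"
  by (simp add: less_imp_le)

lemma ln_sdens_bounds: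
  "ln (sdens V \<xi> x) \<le> ln (amax V \<xi>) - \<kappa> * (V x - v)"
  "ln (amax V \<xi>) - K * (V x - v) \<le> ln (sdens V \<xi> x)"
  using ln_qfun_bounds[of v "V x"] by (auto simp: sdens_def amax_def)

lemma sdens_bounds:
  "sdens V \<xi> x \<le> amax V \<xi> * exp (- \<kappa> * (V x - v))"
  "amax V \<xi> * exp (- K * (V x - v)) \<le> sdens V \<xi> x"
proof -
  have "exp (ln (sdens V \<xi> x)) \<le> exp (ln (amax V \<xi>) + - \<kappa> * (V x - v))"
    "exp (ln (amax V \<xi>) + - K * (V x - v)) \<le> exp (ln (sdens V \<xi> x))"
    unfolding exp_le_cancel_iff using ln_sdens_bounds[of x] by linarith+
  then show "sdens V \<xi> x \<le> amax V \<xi> * exp (- \<kappa> * (V x - v))"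
  "amax V \<xi> * exp (- K * (V x - v)) \<le> sdens V \<xi> x"
    unfolding exp_add by simp_all
qed

text \<open>Both bounds come from integrating the exponential envelopes against total mass 1. The
  upper one places all density values inside \<open>[0, U]\<close> as soon as \<open>U\<close> is at
  least \<open>1 / Zconst V K\<close>.\<close>

lemma amax_bounds: "1 / Zconst V \<kappa> \<le> amax V \<xi>" "amax V \<xi> \<le> 1 / Zconst V K"
proof -
  have "(\<integral>x. sdens V \<xi> x \<partial>lborel) \<le> (\<integral>x. amax V \<xi> * exp (- \<kappa> * (V x - v)) \<partial>lborel)"
    by (intro integral_mono sdens_integrable sdens_bounds integrable_mult_right exp_integrable kappa_pos)
  then have "1 \<le> amax V \<xi> * Zconst V \<kappa>"
    unfolding sdens_integral Zconst_def by simp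
  then show "1 / Zconst V \<kappa> \<le> amax V \<xi>"
    using Zconst_pos[OF kappa_pos] by (simp add: field_simps)
  have "(\<integral>x. amax V \<xi> * exp (- K * (V x - v)) \<partial>lborel) \<le> (\<integral>x. sdens V \<xi> x \<partial>lborel)"
    by (intro integral_mono sdens_integrable sdens_bounds integrable_mult_right exp_integrable K_pos)
  then have "amax V \<xi> * Zconst V K \<le> 1"
    unfolding sdens_integral Zconst_def by simp
  then show "amax V \<xi> \<le> 1 / Zconst V K"
    using Zconst_pos[OF K_pos] by (simp add: field_simps)
qed

end

section \<open>Lebesgue measure of level strips\<close>

text \<open>A defect quadratic in the step disappears in the limit: over N + 1 equal steps the
  defects add up to \<open>C * (b - a)\<^sup>2 / (N + 1)\<close>.\<close>

lemma superadditive_limit: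
  fixes G :: "real \<Rightarrow> real"
  assumes "a \<le> b" and G: "\<And>s t. a \<le> s \<Longrightarrow> s \<le> t \<Longrightarrow> t \<le> b \<Longrightarrow> G s - C * (t - s)\<^sup>2 \<le> G t"
  shows "G a \<le> G b"
proof -
  have "G a - C * (b - a)\<^sup>2 / real (Suc N) \<le> G b" for N
  proof -
    define h where "h = (b - a) / real (Suc N)"
    have h: "0 \<le> h" "real (Suc N) * h = b - a"
      using assms(1) by (auto simp: h_def)
    have "G a - real i * (C * h\<^sup>2) \<le> G (a + real i * h)" if "i \<le> Suc N" for i
      using that
    proof (induction i)
      case (Suc i)
      have "real (Suc i) * h \<le> real (Suc N) * h"
        using Suc.prems h by (intro mult_right_mono) auto
      then have "G (a + real i * h) - C * h\<^sup>2 \<le> G (a + real (Suc i) * h)"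
        using G[of "a + real i * h" "a + real (Suc i) * h"] h by (simp add: algebra_simps)
      then show ?case using Suc by (simp add: algebra_simps)
    qed simp
    from this[of "Suc N"] have "G a - real (Suc N) * (C * h\<^sup>2) \<le> G b"
      using h by simp
    moreover have "real (Suc N) * (C * h\<^sup>2) = C * (b - a)\<^sup>2 / real (Suc N)"
      by (simp add: h_def power2_eq_square)
    ultimately show ?thesis by simp
  qed
  moreover have "(\<lambda>N. G a - C * (b - a)\<^sup>2 / real (Suc N)) \<longlonglongrightarrow> G a - 0"
    by (intro tendsto_diff tendsto_const LIMSEQ_Suc[OF lim_const_over_n])
  ultimately show ?thesis
    by (intro LIMSEQ_le_const2) auto
qed

text \<open>A pushforward that charges every short interval at least proportionally dominates Lebesgue
  measure; testing against Lipschitz functions needs only Riemann sums.\<close>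

lemma pushforward_lower_bound:
  fixes p :: "'a \<Rightarrow> real" and \<phi> :: "real \<Rightarrow> real"
  assumes [measurable]: "p \<in> borel_measurable M"
    and ab: "a \<le> b" and fin: "emeasure M {x\<in>space M. a \<le> p x \<and> p x < b} < \<infinity>"
    and low: "\<And>s t. a \<le> s \<Longrightarrow> s \<le> t \<Longrightarrow> t \<le> b \<Longrightarrow> c * (t - s) \<le> measure M {x\<in>space M. s \<le> p x \<and> p x < t}"
    and "0 \<le> c" and lip: "\<Lambda>-lipschitz_on {a..b} \<phi>" and nonneg: "\<And>r. r \<in> {a..b} \<Longrightarrow> 0 \<le> \<phi> r"
  shows "c * (LINT r:{a..b}|lborel. \<phi> r) \<le> (LINT x:{x\<in>space M. a \<le> p x \<and> p x < b}|M. \<phi> (p x))"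
proof -
  define E where "E s t = {x\<in>space M. s \<le> p x \<and> p x < t}" for s t
  have [measurable]: "E s t \<in> sets M" for s t unfolding E_def by measurable
  have cont: "continuous_on {a..b} \<phi>" using lip by (rule lipschitz_on_continuous_on)
  have L0: "0 \<le> \<Lambda>" using lip by (rule lipschitz_on_nonneg)
  obtain B where B: "\<And>r. r \<in> {a..b} \<Longrightarrow> \<bar>\<phi> r\<bar> \<le> B"
    using compact_imp_bounded[OF compact_continuous_image[OF cont compact_Icc]]
    unfolding bounded_iff by (metis image_eqI real_norm_def)
  have finE: "emeasure M (E s t) < \<infinity>" if "a \<le> s" "t \<le> b" for s t
    using that by (intro le_less_trans[OF emeasure_mono fin]) (auto simp: E_def)
  have [measurable]: "(\<lambda>r. indicator {a..b} r *\<^sub>R \<phi> r) \<in> borel_measurable borel"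
    using borel_measurable_continuous_on_indicator[OF _ cont] by simp
  have meas: "set_borel_measurable M (E s t) (\<lambda>x. \<phi> (p x))" if "a \<le> s" "t \<le> b" for s t
  proof -
    have "(\<lambda>x. indicator (E s t) x *\<^sub>R (indicator {a..b} (p x) *\<^sub>R \<phi> (p x))) \<in> borel_measurable M"
      by measurable
    also have "(\<lambda>x. indicator (E s t) x *\<^sub>R (indicator {a..b} (p x) *\<^sub>R \<phi> (p x))) = (\<lambda>x. indicator (E s t) x *\<^sub>R \<phi> (p x))"
      using that by (auto simp: E_def indicator_def fun_eq_iff)
    finally show ?thesis unfolding set_borel_measurable_def .
  qed
  have int: "set_integrable M (E s t) (\<lambda>x. \<phi> (p x))" if "a \<le> s" "t \<le> b" for s t
    unfolding set_integrable_def
  proof (rule Bochner_Integration.integrable_bound)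
    show "integrable M (\<lambda>x. B * indicator (E s t) x)"
      using finE[OF that] by (intro integrable_mult_right integrable_real_indicator) auto
    show "(\<lambda>x. indicator (E s t) x *\<^sub>R \<phi> (p x)) \<in> borel_measurable M"
      using meas[OF that] by (simp add: set_borel_measurable_def)
    show "AE x in M. norm (indicator (E s t) x *\<^sub>R \<phi> (p x)) \<le> norm (B * indicator (E s t) x)"
      using B that by (intro AE_I2) (auto simp: E_def indicator_def intro: order.trans[OF _ abs_ge_self])
  qed
  have intphi: "set_integrable lborel {s..t} \<phi>" if "a \<le> s" "t \<le> b" for s t
    using that by (intro borel_integrable_atLeastAtMost' continuous_on_subset[OF cont]) auto
  \<comment> \<open>\<open>G\<close> is the right side minus the left side with the interval cut at
    \<open>t\<close>. It vanishes at \<open>a\<close>, so the claim is \<open>G a \<le> G b\<close>,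
    and a defect of order \<open>(t - s)\<^sup>2\<close> per step is permitted.\<close>
  define G where "G t = (LINT x:E a t|M. \<phi> (p x)) - c * (LINT r:{a..t}|lborel. \<phi> r)" for t
  have "G a \<le> G b"
  proof (rule superadditive_limit[OF ab])
    fix s t assume st: "a \<le> s" "s \<le> t" "t \<le> b"
    have "(LINT x:E a t|M. \<phi> (p x)) = (LINT x:E a s|M. \<phi> (p x)) + (LINT x:E s t|M. \<phi> (p x))"
    proof -
      have "E a t = E a s \<union> E s t" using st by (auto simp: E_def)
      then show ?thesis
        using st by (simp, intro set_integral_Un int) (auto simp: E_def)
    qed
    moreover have "(LINT r:{a..t}|lborel. \<phi> r) = (LINT r:{a..s}|lborel. \<phi> r) + (LINT r:{s..t}|lborel. \<phi> r)"
    proof -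
      have *: "{a..t} = {a..s} \<union> {s..t}" using st by auto
      have "AE x in lborel. \<not> (x \<in> {a..s} \<and> x \<in> {s..t})"
        using AE_lborel_singleton[of s] by eventually_elim auto
      then show ?thesis
        unfolding * using st by (intro set_integral_Un_AE intphi) auto
    qed
    moreover have "c * (LINT r:{s..t}|lborel. \<phi> r) - 2 * c * \<Lambda> * (t - s)\<^sup>2 \<le> (LINT x:E s t|M. \<phi> (p x))"
    proof -
      have near: "\<bar>\<phi> r - \<phi> s\<bar> \<le> \<Lambda> * (t - s)" if "r \<in> {s..t}" for r
      proof -
        have "\<bar>\<phi> r - \<phi> s\<bar> \<le> \<Lambda> * \<bar>r - s\<bar>"
          using lipschitz_onD[OF lip, of r s] that st by (auto simp: dist_real_def)
        also have "\<dots> \<le> \<Lambda> * (t - s)" using that L0 by (intro mult_left_mono) auto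
        finally show ?thesis .
      qed
      have "(LINT r:{s..t}|lborel. \<phi> r) \<le> (LINT r:{s..t}|lborel. \<phi> s + \<Lambda> * (t - s))"
      proof (rule set_integral_mono)
        show "set_integrable lborel {s..t} (\<lambda>r. \<phi> s + \<Lambda> * (t - s))"
          by (intro borel_integrable_atLeastAtMost' continuous_intros)
        show "\<phi> r \<le> \<phi> s + \<Lambda> * (t - s)" if "r \<in> {s..t}" for r
          using near[OF that] by linarith
      qed (use intphi st in auto)
      also have "\<dots> = (t - s) * (\<phi> s + \<Lambda> * (t - s))"
        using st by (simp add: set_lebesgue_integral_def)
      finally have 1: "c * (LINT r:{s..t}|lborel. \<phi> r) \<le> c * ((t - s) * (\<phi> s + \<Lambda> * (t - s)))"
        using \<open>0 \<le> c\<close> by (rule mult_left_mono)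
      \<comment> \<open>The measure of \<open>E s t\<close> is known from below only, so it may be
        multiplied only by a nonnegative number; nonnegativity of \<phi> allows its lower value to
        be cut off at 0.\<close>
      define l where "l = max 0 (\<phi> s - \<Lambda> * (t - s))"
      have "l * measure M (E s t) = (LINT x:E s t|M. l)"
        using finE[of s t] st by (simp add: set_lebesgue_integral_def measure_def)
      also have "\<dots> \<le> (LINT x:E s t|M. \<phi> (p x))"
      proof (rule set_integral_mono)
        show "set_integrable M (E s t) (\<lambda>x. l)"
          using finE[of s t] st unfolding set_integrable_def by (simp add: mult.commute)
        show "l \<le> \<phi> (p x)" if "x \<in> E s t" for x
        proof -
          have "p x \<in> {s..t}" "p x \<in> {a..b}" using that st by (auto simp: E_def)
          with near[of "p x"] nonneg[of "p x"] show ?thesis unfolding l_def by linarith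
        qed
      qed (use int st in auto)
      finally have "l * measure M (E s t) \<le> (LINT x:E s t|M. \<phi> (p x))" .
      moreover have "l * (c * (t - s)) \<le> l * measure M (E s t)"
        using low[of s t] st by (intro mult_left_mono) (auto simp: E_def l_def)
      moreover have "(\<phi> s - \<Lambda> * (t - s)) * (c * (t - s)) \<le> l * (c * (t - s))"
        using \<open>0 \<le> c\<close> st by (intro mult_right_mono) (auto simp: l_def)
      ultimately have "(\<phi> s - \<Lambda> * (t - s)) * (c * (t - s)) \<le> (LINT x:E s t|M. \<phi> (p x))" by linarith
      with 1 show ?thesis by (simp add: algebra_simps power2_eq_square)
    qed
    ultimately show "G s - 2 * c * \<Lambda> * (t - s)\<^sup>2 \<le> G t"
      by (simp add: G_def algebra_simps)
  qed
  moreover have "G a = 0"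
  proof -
    have "E a a = {}" by (auto simp: E_def)
    moreover have "(LINT r:{a..a}|lborel. \<phi> r) = 0"
      unfolding set_lebesgue_integral_def
    proof (rule integral_eq_zero_AE)
      show "AE r in lborel. indicator {a..a} r *\<^sub>R \<phi> r = 0"
        using AE_lborel_singleton[of a] by eventually_elim (simp add: indicator_def)
    qed
    ultimately show ?thesis by (simp add: G_def set_lebesgue_integral_def)
  qed
  ultimately show ?thesis by (simp add: G_def E_def)
qed

section \<open>Volumes of the strips between two levels\<close>

context potential
begin

lemma compact_sublevel: "compact {x. V x \<le> M}"
proof (rule compact_eq_bounded_closed[THEN iffD2], safe)
  have "eventually (\<lambda>x. M < V x) at_infinity"
    using cond_P by (auto simp: cond_P_def filterlim_at_top_dense)
  then obtain b where "\<And>x. b \<le> norm x \<Longrightarrow> M < V x"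
    by (auto simp: eventually_at_infinity)
  then show "bounded {x. V x \<le> M}"
    by (intro boundedI[of _ b]) (metis linorder_le_cases linorder_not_less mem_Collect_eq)
  show "closed {x. V x \<le> M}"
    using V_continuous by (intro closed_Collect_le) auto
qed

text \<open>Dilating \<open>{V \<le> s}\<close> by a factor \<open>1 + c (t - s)\<close> stays inside \<open>{V \<le> t}\<close> because \<open>V\<close> is
  Lipschitz on bounded sets. This bounds the level density from below even near critical values.\<close>

lemma level_measure_lower_bound:
  assumes "v < A"
  obtains c where "0 < c"
    and "\<And>s t. A \<le> s \<Longrightarrow> s \<le> t \<Longrightarrow> t \<le> B \<Longrightarrow> c * (t - s) \<le> measure lborel {x. s < V x \<and> V x \<le> t}"
proof -
  \<comment> \<open>\<open>R\<close> bounds the sublevel set, and a dilation by a factor of at most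
    2 stays in the ball of radius \<open>2 * R\<close>; on that ball the continuous gradient is
    bounded by \<Gamma>.\<close>
  obtain R where R: "0 < R" "\<And>x. V x \<le> B \<Longrightarrow> norm x \<le> R"
    using compact_imp_bounded[OF compact_sublevel[of B]] by (auto simp: bounded_pos)
  obtain G where G: "\<And>x. GDERIV V x :> G x" "continuous_on UNIV G" using C1 by blast
  obtain \<Gamma> where \<Gamma>: "0 < \<Gamma>" "\<And>x. norm x \<le> 2 * R \<Longrightarrow> norm (G x) \<le> \<Gamma>"
    using compact_imp_bounded[OF compact_continuous_image[OF continuous_on_subset[OF G(2)] compact_cball[of 0 "2 * R"]]]
    by (auto simp: bounded_pos)
  have lip: "\<bar>V y - V x\<bar> \<le> \<Gamma> * norm (y - x)" if "norm x \<le> 2 * R" "norm y \<le> 2 * R" for x y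
  proof -
    have "norm (V y - V x) \<le> \<Gamma> * norm (y - x)"
    proof (rule differentiable_bound[of "cball 0 (2 * R)" V "\<lambda>x h. h \<bullet> G x"])
      show "(V has_derivative (\<lambda>h. h \<bullet> G x)) (at x within cball 0 (2 * R))" for x
        using G(1)[of x] by (auto simp: gderiv_def intro: has_derivative_at_withinI)
      show "onorm (\<lambda>h. h \<bullet> G x) \<le> \<Gamma>" if "x \<in> cball 0 (2 * R)" for x
      proof (rule onorm_le)
        fix h
        have "norm (h \<bullet> G x) \<le> norm h * norm (G x)" by (simp add: Cauchy_Schwarz_ineq2)
        also have "\<dots> \<le> norm h * \<Gamma>" using \<Gamma>(2)[of x] that by (intro mult_left_mono) auto
        finally show "norm (h \<bullet> G x) \<le> \<Gamma> * norm h" by (simp add: mult.commute)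
      qed
    qed (use that in auto)
    then show ?thesis by simp
  qed
  \<comment> \<open>The two summands serve the two demands on \<open>l = (t - s) / D\<close>: a
    dilation by \<open>1 + l\<close> may raise V by at most \<open>t - s\<close>, and
    \<open>l \<le> 1\<close>. The absolute value keeps \<open>D\<close> positive even when
    \<open>B\<close> lies below the minimum.\<close>
  define D where "D = \<Gamma> * R + \<bar>B - v\<bar>"
  have D: "0 < D" "\<Gamma> * R \<le> D" "B - v \<le> D"
    using mult_pos_pos[OF \<open>0 < \<Gamma>\<close> \<open>0 < R\<close>] unfolding D_def by linarith+
  have fin: "emeasure lborel {x. V x \<le> M} < \<infinity>" for M
    using emeasure_bounded_finite[OF compact_imp_bounded[OF compact_sublevel]] .
  have pos: "0 < measure lborel {x. V x \<le> A}"
  proof -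
    obtain x0 where "V x0 = v" using cond_P by (auto simp: cond_P_def)
    then have "{x. V x < A} \<noteq> {}" "open {x. V x < A}"
      using assms V_continuous by (auto intro!: open_Collect_less exI[of _ x0])
    then have "emeasure lebesgue {x. V x < A} \<noteq> 0"
      using open_not_negligible negligible_iff_emeasure0 by (metis borel_open sets_completionI_sets sets_lborel)
    then have "0 < emeasure lborel {x. V x < A}"
      by (simp add: zero_less_iff_neq_zero)
    also have "\<dots> \<le> emeasure lborel {x. V x \<le> A}"
      by (intro emeasure_mono) auto
    finally show ?thesis using fin[of A] by (simp add: measure_def enn2real_positive_iff)
  qed
  show ?thesis
  proof (rule that[of "measure lborel {x. V x \<le> A} / D"])
    show "0 < measure lborel {x. V x \<le> A} / D" using pos D by simp
    fix s t assume st: "A \<le> s" "s \<le> t" "t \<le> B"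
    define l where "l = (t - s) / D"
    have l: "0 \<le> l" "l \<le> 1" "l * D = t - s"
      using st D assms by (auto simp: l_def)
    have "(\<lambda>x. (1 + l) *\<^sub>R x) ` {x. V x \<le> s} \<subseteq> {x. V x \<le> t}"
    proof safe
      fix x assume x: "V x \<le> s"
      then have nx: "norm x \<le> R" using R st by auto
      have "norm ((1 + l) *\<^sub>R x) = (1 + l) * norm x" using l by simp
      also have "\<dots> \<le> 2 * R" using l nx by (intro mult_mono) auto
      finally have "\<bar>V ((1 + l) *\<^sub>R x) - V x\<bar> \<le> \<Gamma> * norm ((1 + l) *\<^sub>R x - x)"
        using nx R by (intro lip) auto
      also have "(1 + l) *\<^sub>R x - x = l *\<^sub>R x" by (simp add: algebra_simps)
      also have "\<Gamma> * norm (l *\<^sub>R x) \<le> \<Gamma> * (l * R)"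
        using l nx \<Gamma> by (simp add: mult_left_mono)
      also have "\<dots> \<le> l * D" using mult_left_mono[OF D(2) l(1)] by (simp only: mult.left_commute)
      finally show "V ((1 + l) *\<^sub>R x) \<le> t" using x l by linarith
    qed
    then have "emeasure lebesgue ((\<lambda>x. (1 + l) *\<^sub>R x) ` {x. V x \<le> s}) \<le> emeasure lebesgue {x. V x \<le> t}"
      by (intro emeasure_mono) auto
    then have "ennreal (\<bar>1 + l\<bar> ^ DIM(real ^ 'd)) * emeasure lebesgue {x. V x \<le> s} \<le> emeasure lebesgue {x. V x \<le> t}"
      using emeasure_lebesgue_affine[of "1 + l" 0 "{x. V x \<le> s}"] by simp
    then have "(1 + l) ^ DIM(real ^ 'd) * measure lborel {x. V x \<le> s} \<le> measure lborel {x. V x \<le> t}"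
      using fin[of s] fin[of t] l
      by (simp add: emeasure_eq_ennreal_measure less_top[symmetric] ennreal_mult[symmetric])
    \<comment> \<open>In dimension at least 1 the volume grows by at least the factor
      \<open>1 + l\<close>, so the strip has at least \<open>l\<close> times the volume of the lower
      sublevel set.\<close>
    moreover have "(1 + l) ^ 1 \<le> (1 + l) ^ DIM(real ^ 'd)"
      using l DIM_positive[where 'a="real ^ 'd"] by (intro power_increasing) auto
    then have "(1 + l) * measure lborel {x. V x \<le> s} \<le> (1 + l) ^ DIM(real ^ 'd) * measure lborel {x. V x \<le> s}"
      by (intro mult_right_mono) auto
    ultimately have "l * measure lborel {x. V x \<le> s} \<le> measure lborel {x. V x \<le> t} - measure lborel {x. V x \<le> s}"
      by (simp add: algebra_simps)
    also have "\<dots> = measure lborel ({x. V x \<le> t} - {x. V x \<le> s})"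
      using fin[of t] st by (intro measure_Diff[symmetric]) auto
    also have "{x. V x \<le> t} - {x. V x \<le> s} = {x. s < V x \<and> V x \<le> t}" by auto
    finally have "l * measure lborel {x. V x \<le> s} \<le> measure lborel {x. s < V x \<and> V x \<le> t}" .
    moreover have "l * measure lborel {x. V x \<le> A} \<le> l * measure lborel {x. V x \<le> s}"
      using l st fin[of s] by (intro mult_left_mono measure_mono_fmeasurable) (auto simp: fmeasurable_def)
    ultimately show "measure lborel {x. V x \<le> A} / D * (t - s) \<le> measure lborel {x. s < V x \<and> V x \<le> t}"
      by (simp add: l_def mult.commute)
  qed
qed

end

section \<open>Relative entropy controls the inverse densities\<close>

text \<open>The second-order Taylor remainder is \<open>exp u / 2 * t\<^sup>2\<close> with
  \<open>\<bar>u\<bar> \<le> D\<close>, and then \<open>exp u\<close> is at least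
  \<open>exp (- D)\<close>.\<close>

lemma exp_minus_quadratic_lower_bound:
  fixes t :: real
  assumes "\<bar>t\<bar> \<le> D"
  shows "exp (- D) / 2 * t\<^sup>2 \<le> t - 1 + exp (- t)"
proof -
  obtain u where u: "\<bar>u\<bar> \<le> \<bar>- t\<bar>" "exp (- t) = (\<Sum>m<2. (- t) ^ m / fact m) + exp u / fact 2 * (- t)\<^sup>2"
    using Maclaurin_exp_le[of "- t" 2] by blast
  have "exp (- D) / 2 * t\<^sup>2 \<le> exp u / 2 * t\<^sup>2"
    using u(1) assms by (intro mult_right_mono divide_right_mono) auto
  then show ?thesis using u(2) by (simp add: numeral_2_eq_2)
qed

context potential_coefficient
begin

text \<open>The decreasing map \<open>qfun\<close> has inverse \<open>sfun\<close>, so a half-open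
  density interval becomes a strip of levels open below and closed above. This is the form of the
  strips measured in \<open>level_measure_lower_bound\<close>.\<close>

lemma sdens_in_density_interval_iff:
  assumes "0 < s" "0 < t"
  shows "s \<le> sdens V \<xi> x \<and> sdens V \<xi> x < t \<longleftrightarrow> sfun V \<xi> t < V x \<and> V x \<le> sfun V \<xi> s"
  using qfun_le_iff[of "sfun V \<xi> s" "V x"] qfun_le_iff[of "sfun V \<xi> t" "V x"] assms
  unfolding sdens_def by (simp add: not_le[symmetric] conj_commute)

lemma sfun_diff_bounds:
  assumes "0 < x" "x \<le> y"
  shows "(ln y - ln x) / K \<le> sfun V \<xi> x - sfun V \<xi> y" "sfun V \<xi> x - sfun V \<xi> y \<le> (ln y - ln x) / \<kappa>"
  using gfun_bounds[OF assms] by (auto simp: sfun_def)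

lemma sfun_ln_lipschitz:
  assumes "0 < x" "0 < y"
  shows "\<bar>sfun V \<xi> x - sfun V \<xi> y\<bar> \<le> \<bar>ln x - ln y\<bar> / \<kappa>"
proof (cases "x \<le> y")
  case True
  then have "ln x \<le> ln y" using assms by simp
  moreover have "0 \<le> (ln y - ln x) / K" using \<open>ln x \<le> ln y\<close> K_pos by simp
  ultimately show ?thesis using sfun_diff_bounds[of x y] True assms by simp
next
  case False
  then have "ln y \<le> ln x" using assms by simp
  moreover have "0 \<le> (ln x - ln y) / K" using \<open>ln y \<le> ln x\<close> K_pos by simp
  ultimately show ?thesis using sfun_diff_bounds[of y x] False assms by simp
qed

lemma sfun_amax: "sfun V \<xi> (amax V \<xi>) = v"
  by (simp add: amax_def)

lemma sfun_lipschitz: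
  assumes "0 < r"
  shows "(1 / (\<kappa> * r))-lipschitz_on {r..} (sfun V \<xi>)"
proof (rule lipschitz_onI)
  fix x y assume xy: "x \<in> {r..}" "y \<in> {r..}"
  have ln: "\<bar>ln b - ln a\<bar> \<le> \<bar>b - a\<bar> / r" if "r \<le> a" "a \<le> b" for a b
  proof -
    have "ln (b / a) \<le> b / a - 1" using that assms by (intro ln_le_minus_one) auto
    then have "ln b - ln a \<le> (b - a) / a" using that assms by (simp add: ln_div diff_divide_distrib)
    also have "\<dots> \<le> (b - a) / r" using that assms by (intro divide_left_mono) auto
    finally show ?thesis using that assms by simp
  qed
  have "\<bar>ln x - ln y\<bar> \<le> \<bar>x - y\<bar> / r"
    using ln[of x y] ln[of y x] xy by (cases "x \<le> y") (auto simp: abs_minus_commute)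
  then have "\<bar>ln x - ln y\<bar> / \<kappa> \<le> \<bar>x - y\<bar> / r / \<kappa>"
    using kappa_pos by (intro divide_right_mono) auto
  then show "dist (sfun V \<xi> x) (sfun V \<xi> y) \<le> 1 / (\<kappa> * r) * dist x y"
    using sfun_ln_lipschitz[of x y] xy assms by (simp add: dist_real_def field_simps)
qed (use assms kappa_pos in auto)

end

section \<open>Relative entropy between two stationary densities\<close>

locale coefficient_pair =
  a: potential_coefficient V \<kappa> K L \<xi> + b: potential_coefficient V \<kappa> K L \<zeta>
  for V :: "real ^ 'd \<Rightarrow> real" and \<kappa> K L \<xi> \<zeta>
begin

text \<open>Both maxima lie between \<open>1 / Zconst V \<kappa>\<close> and
  \<open>1 / Zconst V K\<close>, and both log-densities fall at rates between \<kappa> and K per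
  unit of V. The bound involves neither coefficient, so it is uniform over the sieve.\<close>

lemma log_ratio_bound:
  "\<bar>ln (sdens V \<xi> x) - ln (sdens V \<zeta> x)\<bar> \<le> ln (Zconst V \<kappa>) - ln (Zconst V K) + K * (V x - a.v)"
proof -
  have Z: "0 < Zconst V \<kappa>" "0 < Zconst V K"
    using a.Zconst_pos a.kappa_pos a.K_pos by auto
  have 1: "- ln (Zconst V \<kappa>) \<le> ln (amax V \<xi>)" "ln (amax V \<xi>) \<le> - ln (Zconst V K)"
    "- ln (Zconst V \<kappa>) \<le> ln (amax V \<zeta>)" "ln (amax V \<zeta>) \<le> - ln (Zconst V K)"
    using a.amax_bounds b.amax_bounds Z
    by (auto simp flip: ln_inverse simp: inverse_eq_divide)
  have "0 \<le> \<kappa> * (V x - a.v)" using a.kappa_pos by simp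
  then show ?thesis
    using 1 a.ln_sdens_bounds[of x] b.ln_sdens_bounds[of x] by linarith
qed

lemma log_ratio_integrable:
  "integrable lborel (\<lambda>x. sdens V \<xi> x * (ln (sdens V \<xi> x) - ln (sdens V \<zeta> x)))"
proof (rule Bochner_Integration.integrable_bound)
  define D where "D = ln (Zconst V \<kappa>) - ln (Zconst V K)"
  show "integrable lborel (\<lambda>x. amax V \<xi> * ((D + K * (V x - a.v)) * exp (- \<kappa> * (V x - a.v))))"
    using a.kappa_pos by (intro integrable_mult_right a.linear_exp_integrable)
  show "AE x in lborel. norm (sdens V \<xi> x * (ln (sdens V \<xi> x) - ln (sdens V \<zeta> x)))
      \<le> norm (amax V \<xi> * ((D + K * (V x - a.v)) * exp (- \<kappa> * (V x - a.v))))"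
  proof (intro AE_I2)
    fix x
    have "\<bar>sdens V \<xi> x\<bar> * \<bar>ln (sdens V \<xi> x) - ln (sdens V \<zeta> x)\<bar>
        \<le> (amax V \<xi> * exp (- \<kappa> * (V x - a.v))) * (D + K * (V x - a.v))"
      using log_ratio_bound[of x] a.sdens_bounds[of x]
      by (intro mult_mono) (auto simp: D_def)
    then have "norm (sdens V \<xi> x * (ln (sdens V \<xi> x) - ln (sdens V \<zeta> x)))
      \<le> amax V \<xi> * ((D + K * (V x - a.v)) * exp (- \<kappa> * (V x - a.v)))"
      unfolding real_norm_def abs_mult by (simp only: mult_ac)
    then show "norm (sdens V \<xi> x * (ln (sdens V \<xi> x) - ln (sdens V \<zeta> x)))
      \<le> norm (amax V \<xi> * ((D + K * (V x - a.v)) * exp (- \<kappa> * (V x - a.v))))"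
      unfolding real_norm_def by linarith
  qed
qed measurable

lemma KL_eq: "KL V \<xi> \<zeta> = (\<integral>x. sdens V \<xi> x * (ln (sdens V \<xi> x) - ln (sdens V \<zeta> x)) \<partial>lborel)"
proof -
  have "KL V \<xi> \<zeta> = (\<integral>x. sdens V \<xi> x * log (exp 1) (sdens V \<xi> x / sdens V \<zeta> x) \<partial>lborel)"
    unfolding KL_def
    by (intro lborel.KL_density_density) auto
  then show ?thesis by (simp add: log_def ln_div)
qed

text \<open>The terms added to the entropy integrand have total integral 0 because both densities
  have mass 1. They make it pointwise nonnegative: it becomes the density times t - 1 + exp (- t),
  where t is the log-ratio. The entropy therefore dominates the integral of \<open>gap\<close> over
  any measurable set.\<close>

definition gap :: "real ^ 'd \<Rightarrow> real" where
  "gap x = sdens V \<xi> x * (ln (sdens V \<xi> x) - ln (sdens V \<zeta> x)) - sdens V \<xi> x + sdens V \<zeta> x"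

lemma gap_integrable: "integrable lborel gap"
  and gap_integral: "(\<integral>x. gap x \<partial>lborel) = KL V \<xi> \<zeta>"
  unfolding gap_def[abs_def] KL_eq
  using log_ratio_integrable a.sdens_integrable b.sdens_integrable
  by (auto simp: a.sdens_integral b.sdens_integral)

lemma gap_eq:
  "gap x = sdens V \<xi> x * ((ln (sdens V \<xi> x) - ln (sdens V \<zeta> x)) - 1 + exp (- (ln (sdens V \<xi> x) - ln (sdens V \<zeta> x))))"
  by (simp add: gap_def exp_diff algebra_simps)

lemma gap_lower_bound:
  assumes "\<bar>ln (sdens V \<xi> x) - ln (sdens V \<zeta> x)\<bar> \<le> D"
  shows "sdens V \<xi> x * (exp (- D) / 2 * (ln (sdens V \<xi> x) - ln (sdens V \<zeta> x))\<^sup>2) \<le> gap x"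
  unfolding gap_eq using exp_minus_quadratic_lower_bound[OF assms]
  by (intro mult_left_mono) auto

lemma gap_nonneg: "0 \<le> gap x"
  by (rule order.trans[OF _ gap_lower_bound[OF order_refl]]) simp

lemma KL_nonneg: "0 \<le> KL V \<xi> \<zeta>"
  unfolding gap_integral[symmetric] by (simp add: gap_nonneg)

text \<open>Both \<open>sfun V \<xi> (sdens V \<xi> x)\<close> and
  \<open>sfun V \<zeta> (sdens V \<zeta> x)\<close> equal \<open>V x\<close>. The difference at one
  density value is thus an increment of \<open>sfun V \<zeta>\<close> between the two density
  values, and this function is Lipschitz in the logarithm.\<close>

lemma sfun_diff_le_log_ratio:
  "\<bar>sfun V \<xi> (sdens V \<xi> x) - sfun V \<zeta> (sdens V \<xi> x)\<bar> \<le> \<bar>ln (sdens V \<xi> x) - ln (sdens V \<zeta> x)\<bar> / \<kappa>"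
proof -
  have "sfun V \<xi> (sdens V \<xi> x) = sfun V \<zeta> (sdens V \<zeta> x)"
    by (simp add: sdens_def)
  then show ?thesis
    using b.sfun_ln_lipschitz[of "sdens V \<zeta> x" "sdens V \<xi> x"] by (simp add: abs_minus_commute)
qed

end

lemma (in potential) KL_controls_sfun:
  assumes "0 < \<kappa>" "\<kappa> \<le> K" "0 < r\<^sub>1" "r\<^sub>1 \<le> r\<^sub>2" "r\<^sub>2 < a\<^sub>0"
  obtains C where "0 < C"
    and "\<And>L \<xi> \<zeta>. cond_C \<kappa> K L \<xi> \<Longrightarrow> cond_C \<kappa> K L \<zeta> \<Longrightarrow> amax V \<xi> = a\<^sub>0 \<Longrightarrow>
      (LINT r:{r\<^sub>1..r\<^sub>2}|lborel. (sfun V \<xi> r - sfun V \<zeta> r)\<^sup>2) \<le> C * KL V \<xi> \<zeta>"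
proof -
  have K: "0 < K" using assms by simp
  \<comment> \<open>Since \<open>sfun V \<xi>\<close> sends \<open>a\<^sub>0\<close> to
    \<open>v\<close>, the logarithmic bounds place the levels of all density values in
    \<open>{r\<^sub>1..r\<^sub>2}\<close> between \<open>A\<close> and \<open>B\<close>, whatever
    \<xi> is. The strict inequality \<open>r\<^sub>2 < a\<^sub>0\<close> gives
    \<open>v < A\<close>.\<close>
  define A B where "A = v + (ln a\<^sub>0 - ln r\<^sub>2) / K" and "B = v + (ln a\<^sub>0 - ln r\<^sub>1) / \<kappa>"
  have "v < A" using assms K by (simp add: A_def)
  obtain c where c: "0 < c" "\<And>s t. A \<le> s \<Longrightarrow> s \<le> t \<Longrightarrow> t \<le> B \<Longrightarrow> c * (t - s) \<le> measure lborel {x. s < V x \<and> V x \<le> t}"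
    using level_measure_lower_bound[OF \<open>v < A\<close>] by blast
  \<comment> \<open>The bound of \<open>log_ratio_bound\<close> at level \<open>B\<close>.\<close>
  define D where "D = ln (Zconst V \<kappa>) - ln (Zconst V K) + K * (B - v)"
  \<comment> \<open>Up to \<open>r\<^sub>2\<close> the function \<open>sfun V \<xi>\<close>
    decreases with slope at least \<open>1 / (K * r\<^sub>2)\<close> in absolute value, which
    converts lengths of density intervals into lengths of level intervals.\<close>
  define c' where "c' = c / (K * r\<^sub>2)"
  have c': "0 < c'" using c K assms by (simp add: c'_def)
  \<comment> \<open>Chosen so that \<open>C * (r\<^sub>1 * exp (- D) / 2)\<close> equals
    \<open>1 / \<kappa>\<^sup>2\<close>, the factor in the square of
    \<open>sfun_diff_le_log_ratio\<close>.\<close>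
  define C where "C = 2 / (\<kappa>\<^sup>2 * r\<^sub>1 * exp (- D))"
  have C: "0 < C" using assms by (simp add: C_def)
  show ?thesis
  proof (rule that[of "C / c'"])
    show "0 < C / c'" using C c' by simp
    fix L \<xi> \<zeta> assume "cond_C \<kappa> K L \<xi>" "cond_C \<kappa> K L \<zeta>" and a0: "amax V \<xi> = a\<^sub>0"
    then interpret coefficient_pair V \<kappa> K L \<xi> \<zeta>
      using assms by unfold_locales auto
    define \<phi> where "\<phi> r = (sfun V \<xi> r - sfun V \<zeta> r)\<^sup>2" for r
    define E where "E = {x. r\<^sub>1 \<le> sdens V \<xi> x \<and> sdens V \<xi> x < r\<^sub>2}"
    have E: "E \<in> sets lborel" unfolding E_def by measurable
    have EB: "V x \<le> B" if "x \<in> E" for x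
    proof -
      have "V x \<le> sfun V \<xi> r\<^sub>1"
        using that assms a.sdens_in_density_interval_iff[of r\<^sub>1 r\<^sub>2 x] by (auto simp: E_def)
      also have "\<dots> \<le> B"
        using a.sfun_diff_bounds(2)[of r\<^sub>1 a\<^sub>0] assms a.sfun_amax a0 by (simp add: B_def)
      finally show ?thesis .
    qed
    have pointwise: "\<phi> (sdens V \<xi> x) \<le> C * gap x" if "x \<in> E" for x
    proof -
      define \<Delta> where "\<Delta> = ln (sdens V \<xi> x) - ln (sdens V \<zeta> x)"
      have "K * (V x - v) \<le> K * (B - v)" using EB[OF that] K by simp
      then have "\<bar>\<Delta>\<bar> \<le> D" using log_ratio_bound[of x] by (simp add: \<Delta>_def D_def)
      then have "sdens V \<xi> x * (exp (- D) / 2 * \<Delta>\<^sup>2) \<le> gap x"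
        unfolding \<Delta>_def by (rule gap_lower_bound)
      moreover have "r\<^sub>1 * (exp (- D) / 2 * \<Delta>\<^sup>2) \<le> sdens V \<xi> x * (exp (- D) / 2 * \<Delta>\<^sup>2)"
        using that by (intro mult_right_mono) (auto simp: E_def)
      ultimately have "r\<^sub>1 * (exp (- D) / 2 * \<Delta>\<^sup>2) \<le> gap x" by linarith
      then have "C * (r\<^sub>1 * (exp (- D) / 2 * \<Delta>\<^sup>2)) \<le> C * gap x"
        using C by (intro mult_left_mono) auto
      moreover have "C * (r\<^sub>1 * (exp (- D) / 2 * \<Delta>\<^sup>2)) = (\<bar>\<Delta>\<bar> / \<kappa>)\<^sup>2"
        using assms by (simp add: C_def power_divide field_simps)
      moreover have "\<phi> (sdens V \<xi> x) \<le> (\<bar>\<Delta>\<bar> / \<kappa>)\<^sup>2"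
        unfolding \<phi>_def \<Delta>_def by (rule abs_le_square_iff[THEN iffD1])
          (use sfun_diff_le_log_ratio[of x] assms in auto)
      ultimately show ?thesis by linarith
    qed
    define \<Lambda> where "\<Lambda> = 2 / (\<kappa> * r\<^sub>1)"
    have lip: "\<Lambda>-lipschitz_on {r\<^sub>1..r\<^sub>2} (\<lambda>r. sfun V \<xi> r - sfun V \<zeta> r)"
    proof (rule lipschitz_on_subset)
      show "\<Lambda>-lipschitz_on {r\<^sub>1..} (\<lambda>r. sfun V \<xi> r - sfun V \<zeta> r)"
        using lipschitz_on_diff[OF a.sfun_lipschitz b.sfun_lipschitz, of r\<^sub>1] assms
        by (simp add: \<Lambda>_def)
    qed auto
    have "bounded ((\<lambda>r. sfun V \<xi> r - sfun V \<zeta> r) ` {r\<^sub>1..r\<^sub>2})"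
      by (intro compact_imp_bounded compact_continuous_image lipschitz_on_continuous_on[OF lip]) simp
    then obtain M where M: "0 < M" "\<And>r. r \<in> {r\<^sub>1..r\<^sub>2} \<Longrightarrow> \<bar>sfun V \<xi> r - sfun V \<zeta> r\<bar> \<le> M"
      unfolding bounded_pos real_norm_def by blast
    have "c' * (LINT r:{r\<^sub>1..r\<^sub>2}|lborel. \<phi> r) \<le> (LINT x:{x\<in>space lborel. r\<^sub>1 \<le> sdens V \<xi> x \<and> sdens V \<xi> x < r\<^sub>2}|lborel. \<phi> (sdens V \<xi> x))"
    proof (rule pushforward_lower_bound)
      show "emeasure lborel {x\<in>space lborel. r\<^sub>1 \<le> sdens V \<xi> x \<and> sdens V \<xi> x < r\<^sub>2} < \<infinity>"
      proof (rule emeasure_bounded_finite, rule bounded_subset)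
        show "bounded {x. V x \<le> B}" by (rule compact_imp_bounded[OF compact_sublevel])
        show "{x\<in>space lborel. r\<^sub>1 \<le> sdens V \<xi> x \<and> sdens V \<xi> x < r\<^sub>2} \<subseteq> {x. V x \<le> B}"
          using EB by (auto simp: E_def)
      qed
      fix s t assume st: "r\<^sub>1 \<le> s" "s \<le> t" "t \<le> r\<^sub>2"
      have "A \<le> sfun V \<xi> t"
      proof -
        have "(ln a\<^sub>0 - ln r\<^sub>2) / K \<le> (ln a\<^sub>0 - ln t) / K"
          using st assms K by (intro divide_right_mono) auto
        then show ?thesis
          using a.sfun_diff_bounds(1)[of t a\<^sub>0] st assms a.sfun_amax a0 by (simp add: A_def)
      qed
      moreover have "sfun V \<xi> s \<le> B"
      proof -
        have "(ln a\<^sub>0 - ln s) / \<kappa> \<le> (ln a\<^sub>0 - ln r\<^sub>1) / \<kappa>"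
          using st assms by (intro divide_right_mono) auto
        then show ?thesis
          using a.sfun_diff_bounds(2)[of s a\<^sub>0] st assms a.sfun_amax a0 by (simp add: B_def)
      qed
      moreover have diff: "(t - s) / (K * r\<^sub>2) \<le> sfun V \<xi> s - sfun V \<xi> t"
      proof -
        have "ln (s / t) \<le> s / t - 1" using st assms by (intro ln_le_minus_one) auto
        then have "(t - s) / t \<le> ln t - ln s"
          using st assms by (simp add: ln_div diff_divide_distrib)
        moreover have "(t - s) / r\<^sub>2 \<le> (t - s) / t"
          using st assms by (intro divide_left_mono) auto
        ultimately have "(t - s) / r\<^sub>2 / K \<le> (ln t - ln s) / K"
          using K by (intro divide_right_mono) auto
        then show ?thesis
          using a.sfun_diff_bounds(1)[of s t] st assms by (simp add: mult.commute)
      qed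
      moreover have "0 \<le> (t - s) / (K * r\<^sub>2)" using st K assms by simp
      ultimately have "c * (sfun V \<xi> s - sfun V \<xi> t) \<le> measure lborel {x. sfun V \<xi> t < V x \<and> V x \<le> sfun V \<xi> s}"
        by (intro c(2)) auto
      moreover have "c * ((t - s) / (K * r\<^sub>2)) \<le> c * (sfun V \<xi> s - sfun V \<xi> t)"
        using diff c(1) by (intro mult_left_mono) auto
      moreover have "{x. sfun V \<xi> t < V x \<and> V x \<le> sfun V \<xi> s} = {x\<in>space lborel. s \<le> sdens V \<xi> x \<and> sdens V \<xi> x < t}"
        using a.sdens_in_density_interval_iff[of s t] st assms by auto
      ultimately show "c' * (t - s) \<le> measure lborel {x\<in>space lborel. s \<le> sdens V \<xi> x \<and> sdens V \<xi> x < t}"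
        by (simp add: c'_def)
    next
      \<comment> \<open>\<open>M\<close> may depend on the pair of coefficients: the Lipschitz
        constant does not occur in the conclusion of \<open>pushforward_lower_bound\<close>, so the
        final constant stays uniform.\<close>
      show "(\<Lambda> * (2 * M))-lipschitz_on {r\<^sub>1..r\<^sub>2} \<phi>"
      proof (rule lipschitz_onI)
        fix x y assume xy: "x \<in> {r\<^sub>1..r\<^sub>2}" "y \<in> {r\<^sub>1..r\<^sub>2}"
        define p q where "p = sfun V \<xi> x - sfun V \<zeta> x" and "q = sfun V \<xi> y - sfun V \<zeta> y"
        have "\<bar>p - q\<bar> \<le> \<Lambda> * \<bar>x - y\<bar>"
          using lipschitz_onD[OF lip xy] by (simp add: dist_real_def p_def q_def)
        moreover have "\<bar>p + q\<bar> \<le> 2 * M"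
          using M(2)[OF xy(1)] M(2)[OF xy(2)] unfolding p_def q_def by linarith
        ultimately have "\<bar>p - q\<bar> * \<bar>p + q\<bar> \<le> (\<Lambda> * \<bar>x - y\<bar>) * (2 * M)"
          by (intro mult_mono) (auto simp: \<Lambda>_def assms less_imp_le)
        moreover have "\<phi> x - \<phi> y = (p - q) * (p + q)"
          by (simp add: \<phi>_def p_def q_def power2_eq_square algebra_simps)
        ultimately show "dist (\<phi> x) (\<phi> y) \<le> \<Lambda> * (2 * M) * dist x y"
          by (simp add: dist_real_def abs_mult mult_ac)
      qed (use M assms in \<open>auto simp: \<Lambda>_def\<close>)
    qed (use assms c' in \<open>auto simp: \<phi>_def\<close>)
    also have "\<dots> = (LINT x:E|lborel. \<phi> (sdens V \<xi> x))"
      by (simp add: E_def)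
    also have "\<dots> \<le> (\<integral>x. C * gap x \<partial>lborel)"
      unfolding set_lebesgue_integral_def
    proof (rule integral_mono')
      show "integrable lborel (\<lambda>x. C * gap x)" using gap_integrable by simp
      show "indicat_real E x *\<^sub>R \<phi> (sdens V \<xi> x) \<le> C * gap x" for x
        using pointwise[of x] C gap_nonneg[of x] by (auto simp: indicator_def)
      show "0 \<le> C * gap x" for x using C gap_nonneg[of x] by simp
    qed
    also have "\<dots> = C * KL V \<xi> \<zeta>" by (simp add: gap_integral)
    finally show "(LINT r:{r\<^sub>1..r\<^sub>2}|lborel. (sfun V \<xi> r - sfun V \<zeta> r)\<^sup>2) \<le> C / c' * KL V \<xi> \<zeta>"
      using c' by (simp add: \<phi>_def field_simps)
  qed
qed

section \<open>Hoelder classes\<close>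

text \<open>Derivatives are peeled off one at a time instead of being given as a family, so that
  products and reciprocals can be treated by induction on the order. One bound \<open>A\<close>
  serves every derivative and the final Hoelder seminorm.\<close>

primrec holder_class :: "nat \<Rightarrow> real \<Rightarrow> real set \<Rightarrow> real \<Rightarrow> (real \<Rightarrow> real) \<Rightarrow> bool" where
  "holder_class 0 \<gamma> J A f \<longleftrightarrow>
     (\<forall>x\<in>J. \<bar>f x\<bar> \<le> A) \<and> (\<forall>x\<in>J. \<forall>y\<in>J. \<bar>f x - f y\<bar> \<le> A * \<bar>x - y\<bar> powr \<gamma>)"
| "holder_class (Suc k) \<gamma> J A f \<longleftrightarrow>
     (\<forall>x\<in>J. \<bar>f x\<bar> \<le> A) \<and>
     (\<exists>f'. (\<forall>x\<in>J. (f has_real_derivative f' x) (at x within J)) \<and> holder_class k \<gamma> J A f')"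

lemma holder_class_bound: "holder_class k \<gamma> J A f \<Longrightarrow> x \<in> J \<Longrightarrow> \<bar>f x\<bar> \<le> A"
  by (cases k) auto

lemma holder_class_mono: "holder_class k \<gamma> J A f \<Longrightarrow> A \<le> B \<Longrightarrow> holder_class k \<gamma> J B f"
proof (induction k arbitrary: f)
  case 0
  show ?case unfolding holder_class.simps
  proof (intro conjI ballI)
    fix x y assume xy: "x \<in> J" "y \<in> J"
    show "\<bar>f x\<bar> \<le> B" using 0 xy by (auto intro: order.trans)
    have "\<bar>f x - f y\<bar> \<le> A * \<bar>x - y\<bar> powr \<gamma>" using 0 xy by auto
    also have "\<dots> \<le> B * \<bar>x - y\<bar> powr \<gamma>" using 0 by (intro mult_right_mono) auto
    finally show "\<bar>f x - f y\<bar> \<le> B * \<bar>x - y\<bar> powr \<gamma>" .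
  qed
next
  case (Suc k)
  then obtain f' where f': "\<And>x. x \<in> J \<Longrightarrow> (f has_real_derivative f' x) (at x within J)" "holder_class k \<gamma> J A f'"
    unfolding holder_class.simps by blast
  then have "holder_class k \<gamma> J B f'" using Suc by blast
  moreover have "\<bar>f x\<bar> \<le> B" if "x \<in> J" for x
    using holder_class_bound[OF Suc.prems(1) that] Suc.prems(2) by linarith
  ultimately show ?case using f'(1) unfolding holder_class.simps by blast
qed

lemma holder_class_cong:
  assumes "holder_class k \<gamma> J A f" "\<And>x. x \<in> J \<Longrightarrow> f x = g x"
  shows "holder_class k \<gamma> J A g"
proof (cases k)
  case (Suc l)
  then obtain f' where f': "\<And>x. x \<in> J \<Longrightarrow> (f has_real_derivative f' x) (at x within J)" "holder_class l \<gamma> J A f'"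
    using assms(1) unfolding Suc holder_class.simps by blast
  have "(g has_real_derivative f' x) (at x within J)" if "x \<in> J" for x
    using has_field_derivative_transform_within[OF f'(1)[OF that] zero_less_one that] assms(2) by simp
  then show ?thesis using Suc f'(2) assms by auto
qed (use assms in auto)

lemma holder_class_add:
  "holder_class k \<gamma> J A f \<Longrightarrow> holder_class k \<gamma> J B g \<Longrightarrow> holder_class k \<gamma> J (A + B) (\<lambda>x. f x + g x)"
proof (induction k arbitrary: f g)
  case 0
  show ?case unfolding holder_class.simps
  proof (intro conjI ballI)
    fix x y assume xy: "x \<in> J" "y \<in> J"
    show "\<bar>f x + g x\<bar> \<le> A + B" using 0 xy by (intro order.trans[OF abs_triangle_ineq] add_mono) auto
    have "\<bar>f x - f y\<bar> \<le> A * \<bar>x - y\<bar> powr \<gamma>" "\<bar>g x - g y\<bar> \<le> B * \<bar>x - y\<bar> powr \<gamma>" using 0 xy by auto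
    then show "\<bar>f x + g x - (f y + g y)\<bar> \<le> (A + B) * \<bar>x - y\<bar> powr \<gamma>"
      unfolding distrib_right by linarith
  qed
next
  case (Suc k)
  obtain f' g' where
    f': "\<And>x. x \<in> J \<Longrightarrow> (f has_real_derivative f' x) (at x within J)" "holder_class k \<gamma> J A f'" and
    g': "\<And>x. x \<in> J \<Longrightarrow> (g has_real_derivative g' x) (at x within J)" "holder_class k \<gamma> J B g'"
    using Suc.prems unfolding holder_class.simps by blast
  have "\<bar>f x + g x\<bar> \<le> A + B" if "x \<in> J" for x
    using Suc.prems that by (intro order.trans[OF abs_triangle_ineq] add_mono) auto
  moreover have "((\<lambda>x. f x + g x) has_real_derivative f' x + g' x) (at x within J)" if "x \<in> J" for x
    using f'(1) g'(1) that by (intro DERIV_add) auto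
  ultimately show ?case using Suc.IH[OF f'(2) g'(2)] by (auto intro!: exI[of _ "\<lambda>x. f' x + g' x"])
qed

lemma holder_class_minus: "holder_class k \<gamma> J A f \<Longrightarrow> holder_class k \<gamma> J A (\<lambda>x. - f x)"
proof (induction k arbitrary: f)
  case 0
  then show ?case by (auto simp: abs_minus_commute)
next
  case (Suc k)
  then obtain f' where f': "\<And>x. x \<in> J \<Longrightarrow> (f has_real_derivative f' x) (at x within J)" "holder_class k \<gamma> J A f'"
    unfolding holder_class.simps by blast
  then show ?case using Suc.IH[OF f'(2)] Suc.prems
    by (auto intro!: exI[of _ "\<lambda>x. - f' x"] DERIV_minus)
qed

lemma holder_class_const: "\<bar>c\<bar> \<le> A \<Longrightarrow> holder_class k \<gamma> J A (\<lambda>_. c)"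
proof (induction k arbitrary: c)
  case (Suc k)
  then have "holder_class k \<gamma> J A (\<lambda>_. 0)" by (intro Suc.IH) auto
  then show ?case using Suc.prems by (auto intro!: exI[of _ "\<lambda>_. 0"])
qed auto

section \<open>Products and reciprocals in Hoelder classes, with uniform constants\<close>

context
  fixes \<gamma> p q :: real
  assumes \<gamma>: "0 < \<gamma>" "\<gamma> \<le> 1" and pq: "p \<le> q"
begin

text \<open>The cost of replacing \<bar>x - y\<bar> by its \<gamma>-th power on
  \<open>{p..q}\<close>: what is left over is \<bar>x - y\<bar> to the power 1 - \<gamma>. The
  maximum with 1 ensures that lowering the order never shrinks a constant.\<close>

definition step_const :: real where
  "step_const = max 1 ((q - p) powr (1 - \<gamma>))"

lemma holder_class_nonneg: "holder_class k \<gamma> {p..q} A f \<Longrightarrow> 0 \<le> A"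
  using holder_class_bound[of k \<gamma> "{p..q}" A f p] pq by auto

text \<open>Only the highest derivative kept needs an argument: it is Lipschitz by the mean value
  inequality, hence \<gamma>-Hoelder on a bounded interval. Leibniz' rule multiplies a derivative by
  an undifferentiated factor, and this lemma puts both into the same class.\<close>

lemma holder_class_lower:
  "holder_class (Suc k) \<gamma> {p..q} A f \<Longrightarrow> holder_class k \<gamma> {p..q} (A * step_const) f"
proof (induction k arbitrary: f)
  case 0
  then have A: "0 \<le> A" by (rule holder_class_nonneg)
  obtain f' where f': "\<And>x. x \<in> {p..q} \<Longrightarrow> (f has_real_derivative f' x) (at x within {p..q})"
    "\<And>x. x \<in> {p..q} \<Longrightarrow> \<bar>f' x\<bar> \<le> A" "\<And>x. x \<in> {p..q} \<Longrightarrow> \<bar>f x\<bar> \<le> A"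
    using 0 unfolding holder_class.simps by blast
  have "\<bar>f x\<bar> \<le> A * step_const" if "x \<in> {p..q}" for x
    using f'(3)[OF that] A mult_left_mono[of 1 step_const A] by (simp add: step_const_def)
  moreover have "\<bar>f x - f y\<bar> \<le> A * step_const * \<bar>x - y\<bar> powr \<gamma>" if "x \<in> {p..q}" "y \<in> {p..q}" for x y
  proof (cases "x = y")
    case False
    have "\<bar>f x - f y\<bar> \<le> A * \<bar>x - y\<bar>"
      using field_differentiable_bound[of "{p..q}" f f' A x y] f' that by auto
    also have "\<bar>x - y\<bar> = \<bar>x - y\<bar> powr (1 - \<gamma>) * \<bar>x - y\<bar> powr \<gamma>"
      using False by (simp flip: powr_add)
    also have "\<dots> \<le> step_const * \<bar>x - y\<bar> powr \<gamma>"
    proof (rule mult_right_mono)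
      have "\<bar>x - y\<bar> powr (1 - \<gamma>) \<le> (q - p) powr (1 - \<gamma>)"
        using that \<gamma> by (intro powr_mono2) auto
      then show "\<bar>x - y\<bar> powr (1 - \<gamma>) \<le> step_const" by (simp add: step_const_def)
    qed simp
    finally show ?thesis using A by (simp add: mult_left_mono mult.assoc)
  qed simp
  ultimately show ?case by auto
next
  case (Suc k)
  then have A: "0 \<le> A" by (intro holder_class_nonneg)
  obtain f' where f': "\<And>x. x \<in> {p..q} \<Longrightarrow> (f has_real_derivative f' x) (at x within {p..q})"
    "holder_class (Suc k) \<gamma> {p..q} A f'" "\<And>x. x \<in> {p..q} \<Longrightarrow> \<bar>f x\<bar> \<le> A"
    using Suc.prems by (metis holder_class.simps(2))
  have "\<bar>f x\<bar> \<le> A * step_const" if "x \<in> {p..q}" for x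
    using f'(3)[OF that] A mult_left_mono[of 1 step_const A] by (simp add: step_const_def)
  then show ?case
    using f'(1) Suc.IH[OF f'(2)] unfolding holder_class.simps(2)[of k] by blast
qed

lemma holder_class_lower':
  assumes "holder_class (Suc k) \<gamma> {p..q} A f"
  obtains f' where "\<And>x. x \<in> {p..q} \<Longrightarrow> (f has_real_derivative f' x) (at x within {p..q})"
    "holder_class k \<gamma> {p..q} (A * step_const) f'" "holder_class k \<gamma> {p..q} (A * step_const) f"
proof -
  obtain f' where "\<And>x. x \<in> {p..q} \<Longrightarrow> (f has_real_derivative f' x) (at x within {p..q})"
    "holder_class k \<gamma> {p..q} A f'"
    using assms unfolding holder_class.simps by blast
  moreover have "A \<le> A * step_const"
    using holder_class_nonneg[OF assms] mult_left_mono[of 1 step_const A] by (simp add: step_const_def)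
  ultimately show ?thesis
    using that holder_class_lower[OF assms] holder_class_mono by blast
qed

text \<open>The constant is quantified before the functions, since it must serve a whole class.
  Leibniz' rule reduces order k + 1 to a sum of two products of order k.\<close>

lemma holder_class_mult:
  "\<exists>C. \<forall>f g. holder_class k \<gamma> {p..q} A f \<longrightarrow> holder_class k \<gamma> {p..q} A g \<longrightarrow>
    holder_class k \<gamma> {p..q} C (\<lambda>x. f x * g x)"
proof (induction k arbitrary: A)
  case 0
  show ?case
  proof (intro exI[of _ "2 * A\<^sup>2"] allI impI)
    fix f g assume fg: "holder_class 0 \<gamma> {p..q} A f" "holder_class 0 \<gamma> {p..q} A g"
    then have A: "0 \<le> A" by (intro holder_class_nonneg)
    show "holder_class 0 \<gamma> {p..q} (2 * A\<^sup>2) (\<lambda>x. f x * g x)"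
      unfolding holder_class.simps
    proof (intro conjI ballI)
      fix x y assume xy: "x \<in> {p..q}" "y \<in> {p..q}"
      have "\<bar>f x\<bar> * \<bar>g x\<bar> \<le> A * A"
        using fg xy by (intro mult_mono) auto
      also have "\<dots> \<le> 2 * A\<^sup>2" by (simp add: power2_eq_square)
      finally show "\<bar>f x * g x\<bar> \<le> 2 * A\<^sup>2" by (simp add: abs_mult)
      have "\<bar>f x * g x - f y * g y\<bar> = \<bar>f x * (g x - g y) + (f x - f y) * g y\<bar>"
        by (simp add: algebra_simps)
      also have "\<dots> \<le> \<bar>f x\<bar> * \<bar>g x - g y\<bar> + \<bar>f x - f y\<bar> * \<bar>g y\<bar>"
        by (intro order.trans[OF abs_triangle_ineq]) (simp add: abs_mult)
      also have "\<dots> \<le> A * (A * \<bar>x - y\<bar> powr \<gamma>) + (A * \<bar>x - y\<bar> powr \<gamma>) * A"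
        using fg xy A by (intro add_mono mult_mono) auto
      finally show "\<bar>f x * g x - f y * g y\<bar> \<le> 2 * A\<^sup>2 * \<bar>x - y\<bar> powr \<gamma>"
        by (simp add: power2_eq_square algebra_simps)
    qed
  qed
next
  case (Suc k)
  obtain C where C: "\<And>f g. holder_class k \<gamma> {p..q} (A * step_const) f \<Longrightarrow> holder_class k \<gamma> {p..q} (A * step_const) g \<Longrightarrow>
    holder_class k \<gamma> {p..q} C (\<lambda>x. f x * g x)"
    using Suc.IH[of "A * step_const"] by blast
  show ?case
  proof (intro exI[of _ "max (A * A) (C + C)"] allI impI)
    fix f g assume fg: "holder_class (Suc k) \<gamma> {p..q} A f" "holder_class (Suc k) \<gamma> {p..q} A g"
    obtain f' where f': "\<And>x. x \<in> {p..q} \<Longrightarrow> (f has_real_derivative f' x) (at x within {p..q})"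
      "holder_class k \<gamma> {p..q} (A * step_const) f'" "holder_class k \<gamma> {p..q} (A * step_const) f"
      using holder_class_lower'[OF fg(1)] by blast
    obtain g' where g': "\<And>x. x \<in> {p..q} \<Longrightarrow> (g has_real_derivative g' x) (at x within {p..q})"
      "holder_class k \<gamma> {p..q} (A * step_const) g'" "holder_class k \<gamma> {p..q} (A * step_const) g"
      using holder_class_lower'[OF fg(2)] by blast
    have "holder_class k \<gamma> {p..q} (C + C) (\<lambda>x. f' x * g x + g' x * f x)"
      using C f' g' by (intro holder_class_add) auto
    then have "holder_class k \<gamma> {p..q} (max (A * A) (C + C)) (\<lambda>x. f' x * g x + g' x * f x)"
      by (rule holder_class_mono) simp
    moreover have "\<bar>f x * g x\<bar> \<le> max (A * A) (C + C)" if "x \<in> {p..q}" for x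
    proof -
      have "\<bar>f x\<bar> * \<bar>g x\<bar> \<le> A * A"
        using holder_class_bound[OF fg(1) that] holder_class_bound[OF fg(2) that] by (intro mult_mono) auto
      then show ?thesis by (simp add: abs_mult)
    qed
    moreover have "((\<lambda>x. f x * g x) has_real_derivative f' x * g x + g' x * f x) (at x within {p..q})" if "x \<in> {p..q}" for x
      using f'(1) g'(1) that by (intro DERIV_mult) auto
    ultimately show "holder_class (Suc k) \<gamma> {p..q} (max (A * A) (C + C)) (\<lambda>x. f x * g x)"
      by (auto intro!: exI[of _ "\<lambda>x. f' x * g x + g' x * f x"])
  qed
qed

text \<open>The derivative of the reciprocal is - f' times the squared reciprocal. The induction
  hypothesis covers the reciprocal at order k, and two applications of
  \<open>holder_class_mult\<close> give the product.\<close>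

lemma holder_class_inverse:
  assumes "0 < c"
  shows "\<exists>C. \<forall>f. holder_class k \<gamma> {p..q} A f \<longrightarrow> (\<forall>x\<in>{p..q}. c \<le> f x) \<longrightarrow>
    holder_class k \<gamma> {p..q} C (\<lambda>x. inverse (f x))"
proof (induction k arbitrary: A)
  case 0
  show ?case
  proof (intro exI[of _ "max (inverse c) (A / (c * c))"] allI impI)
    fix f assume f: "holder_class 0 \<gamma> {p..q} A f" "\<forall>x\<in>{p..q}. c \<le> f x"
    show "holder_class 0 \<gamma> {p..q} (max (inverse c) (A / (c * c))) (\<lambda>x. inverse (f x))"
      unfolding holder_class.simps
    proof (intro conjI ballI)
      fix x y assume xy: "x \<in> {p..q}" "y \<in> {p..q}"
      then have c: "c \<le> f x" "c \<le> f y" using f by auto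
      have "\<bar>inverse (f x)\<bar> \<le> inverse c" using c assms by (simp add: le_imp_inverse_le)
      then show "\<bar>inverse (f x)\<bar> \<le> max (inverse c) (A / (c * c))" by simp
      have "\<bar>inverse (f x) - inverse (f y)\<bar> = \<bar>f x - f y\<bar> / (f x * f y)"
        using c assms by (simp add: inverse_diff_inverse abs_mult divide_simps abs_minus_commute)
      also have "\<dots> \<le> (A * \<bar>x - y\<bar> powr \<gamma>) / (c * c)"
      proof (rule frac_le)
        show "\<bar>f x - f y\<bar> \<le> A * \<bar>x - y\<bar> powr \<gamma>" using f(1) xy by auto
        then show "0 \<le> A * \<bar>x - y\<bar> powr \<gamma>" by linarith
      qed (use c assms in \<open>auto intro!: mult_mono\<close>)
      also have "\<dots> = A / (c * c) * \<bar>x - y\<bar> powr \<gamma>" by simp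
      also have "\<dots> \<le> max (inverse c) (A / (c * c)) * \<bar>x - y\<bar> powr \<gamma>"
        by (intro mult_right_mono) auto
      finally show "\<bar>inverse (f x) - inverse (f y)\<bar> \<le> max (inverse c) (A / (c * c)) * \<bar>x - y\<bar> powr \<gamma>" .
    qed
  qed
next
  case (Suc k)
  obtain C where C: "\<And>f. holder_class k \<gamma> {p..q} (A * step_const) f \<Longrightarrow> \<forall>x\<in>{p..q}. c \<le> f x \<Longrightarrow>
    holder_class k \<gamma> {p..q} C (\<lambda>x. inverse (f x))"
    using Suc.IH[of "A * step_const"] by blast
  obtain C2 where C2: "\<And>f g. holder_class k \<gamma> {p..q} C f \<Longrightarrow> holder_class k \<gamma> {p..q} C g \<Longrightarrow>
    holder_class k \<gamma> {p..q} C2 (\<lambda>x. f x * g x)"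
    using holder_class_mult[of k C] by blast
  \<comment> \<open>\<open>holder_class_mult\<close> takes one constant for both factors, here the
    derivative of \<open>f\<close> and the squared reciprocal.\<close>
  define C3 where "C3 = max C2 (A * step_const)"
  obtain C4 where C4: "\<And>f g. holder_class k \<gamma> {p..q} C3 f \<Longrightarrow> holder_class k \<gamma> {p..q} C3 g \<Longrightarrow>
    holder_class k \<gamma> {p..q} C4 (\<lambda>x. f x * g x)"
    using holder_class_mult[of k C3] by blast
  show ?case
  proof (intro exI[of _ "max (inverse c) C4"] allI impI)
    fix f assume f: "holder_class (Suc k) \<gamma> {p..q} A f" "\<forall>x\<in>{p..q}. c \<le> f x"
    obtain f' where f': "\<And>x. x \<in> {p..q} \<Longrightarrow> (f has_real_derivative f' x) (at x within {p..q})"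
      "holder_class k \<gamma> {p..q} (A * step_const) f'" "holder_class k \<gamma> {p..q} (A * step_const) f"
      using holder_class_lower'[OF f(1)] by blast
    have "holder_class k \<gamma> {p..q} C2 (\<lambda>x. inverse (f x) * inverse (f x))"
      using C[OF f'(3) f(2)] by (intro C2)
    then have "holder_class k \<gamma> {p..q} C4 (\<lambda>x. f' x * (inverse (f x) * inverse (f x)))"
      using f'(2) by (intro C4) (auto intro: holder_class_mono simp: C3_def)
    then have "holder_class k \<gamma> {p..q} (max (inverse c) C4) (\<lambda>x. - (f' x * (inverse (f x) * inverse (f x))))"
      by (intro holder_class_mono[OF holder_class_minus]) auto
    moreover have "((\<lambda>x. inverse (f x)) has_real_derivative - (f' x * (inverse (f x) * inverse (f x)))) (at x within {p..q})"
      if "x \<in> {p..q}" for x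
    proof -
      have "f x \<noteq> 0" using f(2) that assms by force
      then show ?thesis
        using f'(1)[OF that] by (auto intro!: derivative_eq_intros)
    qed
    moreover have "\<bar>inverse (f x)\<bar> \<le> max (inverse c) C4" if "x \<in> {p..q}" for x
    proof -
      have "c \<le> f x" using f(2) that by blast
      then have "\<bar>inverse (f x)\<bar> \<le> inverse c" using assms by (simp add: le_imp_inverse_le)
      then show ?thesis by simp
    qed
    ultimately show "holder_class (Suc k) \<gamma> {p..q} (max (inverse c) C4) (\<lambda>x. inverse (f x))"
      by (auto intro!: exI[of _ "\<lambda>x. - (f' x * (inverse (f x) * inverse (f x)))"])
  qed
qed

text \<open>One order higher the identity has the constant derivative 1, which treats all orders
  alike; lowering returns to order k.\<close>

lemma holder_class_ident: "\<exists>C. holder_class k \<gamma> {p..q} C (\<lambda>x. x)"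
proof
  define B where "B = max 1 (max \<bar>p\<bar> \<bar>q\<bar>)"
  have "holder_class (Suc k) \<gamma> {p..q} B (\<lambda>x. x)"
    using holder_class_const[of 1 B k \<gamma> "{p..q}"]
    by (auto simp: B_def intro!: exI[of _ "\<lambda>_. 1"])
  then show "holder_class k \<gamma> {p..q} (B * step_const) (\<lambda>x. x)"
    by (rule holder_class_lower)
qed

text \<open>The function is the derivative of \<open>gfun f\<close>, and up to sign that of
  \<open>sfun V f\<close>. The condition \<open>0 < p\<close> keeps the interval away from the
  singularity at 0.\<close>

lemma holder_class_inverse_ident_mult:
  assumes "0 < \<kappa>" "0 < p"
  shows "\<exists>C. \<forall>f. holder_class k \<gamma> {p..q} A f \<longrightarrow> (\<forall>x\<in>{p..q}. \<kappa> \<le> f x) \<longrightarrow>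
    holder_class k \<gamma> {p..q} C (\<lambda>x. 1 / (x * f x))"
proof -
  obtain C1 where C1: "holder_class k \<gamma> {p..q} C1 (\<lambda>x. x)"
    using holder_class_ident by blast
  obtain C2 where C2: "\<And>f g. holder_class k \<gamma> {p..q} (max A C1) f \<Longrightarrow> holder_class k \<gamma> {p..q} (max A C1) g \<Longrightarrow>
    holder_class k \<gamma> {p..q} C2 (\<lambda>x. f x * g x)"
    using holder_class_mult[of k "max A C1"] by blast
  obtain C3 where C3: "\<And>f. holder_class k \<gamma> {p..q} C2 f \<Longrightarrow> (\<forall>x\<in>{p..q}. p * \<kappa> \<le> f x) \<Longrightarrow>
    holder_class k \<gamma> {p..q} C3 (\<lambda>x. inverse (f x))"
    using holder_class_inverse[of "p * \<kappa>" k C2] assms by auto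
  have "holder_class k \<gamma> {p..q} C3 (\<lambda>x. 1 / (x * f x))"
    if "holder_class k \<gamma> {p..q} A f" "\<forall>x\<in>{p..q}. \<kappa> \<le> f x" for f
    unfolding divide_inverse mult_1_left
  proof (rule C3)
    show "holder_class k \<gamma> {p..q} C2 (\<lambda>x. x * f x)"
      using that C1 by (intro C2) (auto intro: holder_class_mono)
    show "\<forall>x\<in>{p..q}. p * \<kappa> \<le> x * f x"
      using that assms by (auto intro!: mult_mono)
  qed
  then show ?thesis by blast
qed

end

lemma holder_ball_imp_holder_class:
  assumes "f \<in> holder_ball \<beta> U H" and J: "J \<subseteq> {0..U}"
  shows "holder_class (nat (\<lceil>\<beta>\<rceil> - 1)) (\<beta> - real (nat (\<lceil>\<beta>\<rceil> - 1))) J (max 0 H) f"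
proof -
  define k where "k = nat (\<lceil>\<beta>\<rceil> - 1)"
  define \<gamma> where "\<gamma> = \<beta> - real k"
  obtain D where D0: "\<And>x. x \<in> {0..U} \<Longrightarrow> D 0 x = f x"
    and D: "\<And>j x. j < k \<Longrightarrow> x \<in> {0..U} \<Longrightarrow> (D j has_real_derivative D (Suc j) x) (at x within {0..U})"
    and le: "(\<Sum>j\<le>k. SUP x\<in>{0..U}. ennreal \<bar>D j x\<bar>) +
       (SUP (x, y)\<in>{(x, y). x \<in> {0..U} \<and> y \<in> {0..U} \<and> x \<noteq> y}.
          ennreal (\<bar>D k x - D k y\<bar> / \<bar>x - y\<bar> powr \<gamma>)) \<le> ennreal H"
    using assms(1) unfolding holder_ball_def k_def \<gamma>_def Let_def by blast
  have "(\<Sum>j\<le>k. SUP x\<in>{0..U}. ennreal \<bar>D j x\<bar>) \<le> ennreal H"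
    and "(SUP (x, y)\<in>{(x, y). x \<in> {0..U} \<and> y \<in> {0..U} \<and> x \<noteq> y}.
          ennreal (\<bar>D k x - D k y\<bar> / \<bar>x - y\<bar> powr \<gamma>)) \<le> ennreal H"
    by (rule order.trans[OF _ le], simp)+
  note le = this
  \<comment> \<open>A negative \<open>H\<close> becomes 0 under \<open>ennreal\<close>, hence the
    bound \<open>max 0 H\<close>.\<close>
  have real_le: "a \<le> max 0 H" if "ennreal a \<le> ennreal H" for a
    using that by (cases "0 \<le> a") (auto simp: ennreal_le_iff2)
  have bound: "\<bar>D j x\<bar> \<le> max 0 H" if "j \<le> k" "x \<in> {0..U}" for j x
  proof (rule real_le)
    have "ennreal \<bar>D j x\<bar> \<le> (SUP x\<in>{0..U}. ennreal \<bar>D j x\<bar>)" using that by (intro SUP_upper)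
    also have "\<dots> \<le> (\<Sum>j\<le>k. SUP x\<in>{0..U}. ennreal \<bar>D j x\<bar>)"
      using that by (intro member_le_sum) auto
    also note le(1)
    finally show "ennreal \<bar>D j x\<bar> \<le> ennreal H" .
  qed
  have hold: "\<bar>D k x - D k y\<bar> \<le> max 0 H * \<bar>x - y\<bar> powr \<gamma>" if "x \<in> {0..U}" "y \<in> {0..U}" for x y
  proof (cases "x = y")
    case False
    have "ennreal (\<bar>D k x - D k y\<bar> / \<bar>x - y\<bar> powr \<gamma>) \<le> (SUP (x, y)\<in>{(x, y). x \<in> {0..U} \<and> y \<in> {0..U} \<and> x \<noteq> y}.
          ennreal (\<bar>D k x - D k y\<bar> / \<bar>x - y\<bar> powr \<gamma>))"
      by (rule SUP_upper2[of "(x, y)"]) (use that False in auto)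
    also note le(2)
    finally have "\<bar>D k x - D k y\<bar> / \<bar>x - y\<bar> powr \<gamma> \<le> max 0 H" by (rule real_le)
    then show ?thesis using False by (simp add: pos_divide_le_eq)
  qed simp
  \<comment> \<open>Induction from the highest derivative \<open>D k\<close>, which carries the
    seminorm, down to \<open>D 0\<close>.\<close>
  have "holder_class (k - j) \<gamma> J (max 0 H) (D j)" if "j \<le> k" for j
    using that
  proof (induction "k - j" arbitrary: j)
    case 0
    then have "k = j" by simp
    have "\<bar>D k x\<bar> \<le> max 0 H" "\<bar>D k x - D k y\<bar> \<le> max 0 H * \<bar>x - y\<bar> powr \<gamma>" if "x \<in> J" "y \<in> J" for x y
      using bound[of k x] hold[of x y] that J by (auto simp: subset_eq)
    then show ?case using \<open>k = j\<close> by auto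
  next
    case (Suc l)
    then have "l = k - Suc j" "Suc j \<le> k" by linarith+
    then have "holder_class l \<gamma> J (max 0 H) (D (Suc j))"
      using Suc.hyps(1)[of "Suc j"] by simp
    moreover have "(D j has_real_derivative D (Suc j) x) (at x within J)" if "x \<in> J" for x
      using D[of j x] \<open>Suc j \<le> k\<close> J that by (intro DERIV_subset[OF D J]) auto
    moreover have "\<bar>D j x\<bar> \<le> max 0 H" if "x \<in> J" for x
      using bound[of j x] Suc that J by auto
    ultimately show ?case
      unfolding Suc.hyps(2)[symmetric] holder_class.simps by blast
  qed
  from this[of 0] have "holder_class k \<gamma> J (max 0 H) (D 0)" by simp
  then show ?thesis
    using D0 J unfolding k_def[symmetric] \<gamma>_def[symmetric] by (auto elim!: holder_class_cong)
qed

section \<open>Interpolation of derivatives\<close>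

text \<open>The derivative of the new remainder is the old one, which is at most
  \<open>A * t powr s\<close> on \<open>{0..t}\<close>; the mean value inequality supplies one more
  factor \<open>t\<close>.\<close>

lemma taylor_integrate:
  fixes F f :: "real \<Rightarrow> real"
  assumes F: "\<And>y. y \<in> {p..q} \<Longrightarrow> (F has_real_derivative f y) (at y within {p..q})"
    and f: "\<And>t. 0 \<le> t \<Longrightarrow> x + t \<le> q \<Longrightarrow> \<bar>f (x + t) - (\<Sum>j\<le>k. c j * t ^ j)\<bar> \<le> A * t powr s"
    and "p \<le> x" "0 \<le> A" "0 < s" "0 \<le> t" "x + t \<le> q"
  shows "\<bar>F (x + t) - (F x + (\<Sum>j\<le>k. c j / real (Suc j) * t ^ Suc j))\<bar> \<le> A * t powr (s + 1)"
proof -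
  define e where "e u = F (x + u) - (F x + (\<Sum>j\<le>k. c j / real (Suc j) * u ^ Suc j))" for u
  define e' where "e' u = f (x + u) - (\<Sum>j\<le>k. c j * u ^ j)" for u
  have "norm (e t - e 0) \<le> A * t powr s * norm (t - 0)"
  proof (rule field_differentiable_bound[of "{0..t}"])
    fix u assume u: "u \<in> {0..t}"
    have "((\<lambda>u. F (x + u)) has_real_derivative f (x + u) * 1) (at u within {0..t})"
    proof (rule DERIV_image_chain[of F _ "\<lambda>u. x + u", unfolded comp_def])
      show "(F has_real_derivative f (x + u)) (at (x + u) within (+) x ` {0..t})"
        using u assms by (intro DERIV_subset[OF F]) auto
    qed (auto intro!: derivative_eq_intros)
    then show "(e has_real_derivative e' u) (at u within {0..t})"
      unfolding e_def e'_def
      by (auto intro!: derivative_eq_intros sum.cong simp del: of_nat_Suc power_Suc)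
    have "\<bar>e' u\<bar> \<le> A * u powr s" using f[of u] u assms unfolding e'_def by auto
    also have "\<dots> \<le> A * t powr s" using u assms by (intro mult_left_mono powr_mono2) auto
    finally show "norm (e' u) \<le> A * t powr s" by simp
  qed (use assms in auto)
  moreover have "e 0 = 0" by (simp add: e_def)
  moreover have "t powr (s + 1) = t powr s * t"
    using assms by (cases "t = 0") (auto simp: powr_add)
  ultimately show ?thesis using assms by (simp add: e_def)
qed

text \<open>The expansion of the derivative is integrated term by term. Coefficients beyond
  \<open>c 0\<close> stay unspecified because the differences taken later annihilate them.\<close>

lemma holder_class_taylor:
  assumes "holder_class k \<gamma> {p..q} A f" "0 < \<gamma>" "x \<in> {p..q}"
  shows "\<exists>c. c 0 = f x \<and> (\<forall>t\<ge>0. x + t \<le> q \<longrightarrow> \<bar>f (x + t) - (\<Sum>j\<le>k. c j * t ^ j)\<bar> \<le> A * t powr (real k + \<gamma>))"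
  using assms(1)
proof (induction k arbitrary: f)
  case 0
  have "\<bar>f (x + t) - f x\<bar> \<le> A * t powr \<gamma>" if "0 \<le> t" "x + t \<le> q" for t
  proof -
    have "\<bar>f (x + t) - f x\<bar> \<le> A * \<bar>x + t - x\<bar> powr \<gamma>"
      using 0 that assms(3) unfolding holder_class.simps by (metis add_increasing2 atLeastAtMost_iff)
    then show ?thesis using that by simp
  qed
  then show ?case by (intro exI[of _ "\<lambda>_. f x"]) auto
next
  case (Suc k)
  have A: "0 \<le> A" using holder_class_bound[OF Suc.prems assms(3)] by simp
  obtain f' where f': "\<And>x. x \<in> {p..q} \<Longrightarrow> (f has_real_derivative f' x) (at x within {p..q})"
    "holder_class k \<gamma> {p..q} A f'"
    using Suc.prems unfolding holder_class.simps by blast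
  obtain c where c: "\<And>t. 0 \<le> t \<Longrightarrow> x + t \<le> q \<Longrightarrow> \<bar>f' (x + t) - (\<Sum>j\<le>k. c j * t ^ j)\<bar> \<le> A * t powr (real k + \<gamma>)"
    using Suc.IH[OF f'(2)] by blast
  define d where "d j = (case j of 0 \<Rightarrow> f x | Suc i \<Rightarrow> c i / real (Suc i))" for j
  have "(\<Sum>j\<le>Suc k. d j * t ^ j) = f x + (\<Sum>j\<le>k. c j / real (Suc j) * t ^ Suc j)" for t
    unfolding sum.atMost_Suc_shift by (simp add: d_def)
  moreover have "real (Suc k) + \<gamma> = real k + \<gamma> + 1" by simp
  ultimately have "\<bar>f (x + t) - (\<Sum>j\<le>Suc k. d j * t ^ j)\<bar> \<le> A * t powr (real (Suc k) + \<gamma>)"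
    if "0 \<le> t" "x + t \<le> q" for t
    using taylor_integrate[OF f'(1) c, where t = t] assms A that by (simp add: add_ac)
  then show ?case by (intro exI[of _ d]) (auto simp: d_def)
qed

text \<open>The weights are the coefficients of the Lagrange polynomial at the nodes \<open>2 ^ j\<close> that singles out
  \<open>j = 1\<close>.\<close>

lemma dyadic_difference_weights:
  "\<exists>n (w :: nat \<Rightarrow> real). \<forall>j\<le>N. (\<Sum>i\<le>n. w i * (2 ^ i) ^ j) = (if j = 1 then 1 else 0)"
proof -
  define S where "S = {..N} - {1}"
  define Q :: "real poly" where "Q = (\<Prod>j\<in>S. [:- (2 ^ j), 1:])"
  have Q: "poly Q x = (\<Prod>j\<in>S. x - 2 ^ j)" for x
    by (simp add: Q_def poly_prod)
  have "finite S" by (simp add: S_def)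
  have "2 - 2 ^ j \<noteq> (0::real)" if "j \<in> S" for j
    using that power_inject_exp[of "2::real" 1 j] by (auto simp: S_def)
  then have Q2: "poly Q 2 \<noteq> 0" using \<open>finite S\<close> by (simp add: Q)
  show ?thesis
  proof (intro exI allI impI)
    fix j assume "j \<le> N"
    have "(\<Sum>i\<le>degree Q. coeff Q i / poly Q 2 * (2 ^ i) ^ j) = poly Q (2 ^ j) / poly Q 2"
      by (simp add: poly_altdef sum_divide_distrib mult.commute flip: power_mult)
    also have "\<dots> = (if j = 1 then 1 else 0)"
      using Q2 \<open>finite S\<close> \<open>j \<le> N\<close> by (auto simp: Q S_def prod_zero_iff)
    finally show "(\<Sum>i\<le>degree Q. coeff Q i / poly Q 2 * (2 ^ i) ^ j) = (if j = 1 then 1 else 0)" .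
  qed
qed

text \<open>The weighted sum of the values F (x + 2^i t) annihilates every Taylor term of F up to
  degree k + 1 except the linear one, whose coefficient is f x. What remains is f x times t, up to a
  remainder of order \<beta> + 1 in t. All nodes lie to the right of x, so only room on that side is
  used.\<close>

lemma derivative_interpolation_pointwise:
  fixes \<gamma> \<beta> :: real
  assumes "0 < \<gamma>" and \<beta>: "\<beta> = real k + \<gamma>"
  obtains W :: real and n :: nat and w :: "nat \<Rightarrow> real" where "0 \<le> W"
    "\<And>p q A F f x t. holder_class k \<gamma> {p..q} A f \<Longrightarrow>
       (\<And>y. y \<in> {p..q} \<Longrightarrow> (F has_real_derivative f y) (at y within {p..q})) \<Longrightarrow>
       x \<in> {p..q} \<Longrightarrow> 0 < t \<Longrightarrow> x + 2 ^ n * t \<le> q \<Longrightarrow>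
       \<bar>f x\<bar> \<le> (\<Sum>i\<le>n. \<bar>w i\<bar> * \<bar>F (x + 2 ^ i * t)\<bar>) / t + A * W * t powr \<beta>"
proof -
  \<comment> \<open>Degree k + 1 and not k: the primitive F has one derivative more than f.\<close>
  obtain n w where w: "\<And>j. j \<le> Suc k \<Longrightarrow> (\<Sum>i\<le>n. w i * (2 ^ i) ^ j) = (if j = 1 then 1 else 0::real)"
    using dyadic_difference_weights[of "Suc k"] by blast
  define W where "W = (\<Sum>i\<le>n. \<bar>w i\<bar> * (2 ^ i) powr (\<beta> + 1))"
  show ?thesis
  proof (rule that[of W])
    show "0 \<le> W" unfolding W_def by (intro sum_nonneg) auto
    fix p q A F f x t
    assume f: "holder_class k \<gamma> {p..q} A f"
      and F: "\<And>y. y \<in> {p..q} \<Longrightarrow> (F has_real_derivative f y) (at y within {p..q})"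
      and x: "x \<in> {p..q}" and t: "0 < t" "x + 2 ^ n * t \<le> q"
    have A: "0 \<le> A" using holder_class_bound[OF f x] by simp
    obtain c where c0: "c 0 = f x" and c: "\<And>u. 0 \<le> u \<Longrightarrow> x + u \<le> q \<Longrightarrow> \<bar>f (x + u) - (\<Sum>j\<le>k. c j * u ^ j)\<bar> \<le> A * u powr \<beta>"
      using holder_class_taylor[OF f assms(1) x] \<beta> by blast
    define d where "d j = (case j of 0 \<Rightarrow> F x | Suc i \<Rightarrow> c i / real (Suc i))" for j
    have d_sum: "(\<Sum>j\<le>Suc k. d j * u ^ j) = F x + (\<Sum>j\<le>k. c j / real (Suc j) * u ^ Suc j)" for u
      unfolding sum.atMost_Suc_shift by (simp add: d_def)
    define R where "R u = F (x + u) - (\<Sum>j\<le>Suc k. d j * u ^ j)" for u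
    have R: "\<bar>R u\<bar> \<le> A * u powr (\<beta> + 1)" if "0 \<le> u" "x + u \<le> q" for u
      unfolding R_def d_sum using taylor_integrate[OF F c, where t = u] that x A assms by simp
    have "(\<Sum>i\<le>n. w i * (\<Sum>j\<le>Suc k. d j * (2 ^ i * t) ^ j)) = (\<Sum>j\<le>Suc k. d j * t ^ j * (\<Sum>i\<le>n. w i * (2 ^ i) ^ j))"
      unfolding sum_distrib_left by (subst sum.swap) (simp add: power_mult_distrib mult_ac)
    also have "\<dots> = (\<Sum>j\<le>Suc k. if j = 1 then f x * t else 0)"
      using w c0 by (intro sum.cong) (auto simp: d_def)
    also have "\<dots> = f x * t" by simp
    finally have "f x * t = (\<Sum>i\<le>n. w i * F (x + 2 ^ i * t)) - (\<Sum>i\<le>n. w i * R (2 ^ i * t))"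
      by (simp add: R_def right_diff_distrib sum_subtractf)
    moreover have "\<bar>\<Sum>i\<le>n. w i * F (x + 2 ^ i * t)\<bar> \<le> (\<Sum>i\<le>n. \<bar>w i\<bar> * \<bar>F (x + 2 ^ i * t)\<bar>)"
      by (rule order.trans[OF sum_abs]) (simp add: abs_mult)
    moreover have "\<bar>\<Sum>i\<le>n. w i * R (2 ^ i * t)\<bar> \<le> A * W * t powr (\<beta> + 1)"
    proof -
      have "\<bar>\<Sum>i\<le>n. w i * R (2 ^ i * t)\<bar> \<le> (\<Sum>i\<le>n. \<bar>w i\<bar> * \<bar>R (2 ^ i * t)\<bar>)"
        by (rule order.trans[OF sum_abs]) (simp add: abs_mult)
      also have "\<dots> \<le> (\<Sum>i\<le>n. \<bar>w i\<bar> * (A * (2 ^ i * t) powr (\<beta> + 1)))"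
      proof (intro sum_mono mult_left_mono R)
        fix i assume "i \<in> {..n}"
        then have "2 ^ i * t \<le> 2 ^ n * t" using t by (intro mult_right_mono power_increasing) auto
        then show "x + 2 ^ i * t \<le> q" using t by linarith
      qed (use t in auto)
      also have "\<dots> = A * W * t powr (\<beta> + 1)"
        using t by (simp add: W_def powr_mult sum_distrib_left sum_distrib_right mult_ac)
      finally show ?thesis .
    qed
    moreover have "\<bar>f x\<bar> * t = \<bar>f x * t\<bar>" using t by (simp add: abs_mult)
    ultimately have "\<bar>f x\<bar> * t \<le> (\<Sum>i\<le>n. \<bar>w i\<bar> * \<bar>F (x + 2 ^ i * t)\<bar>) + A * W * t powr (\<beta> + 1)"
      by linarith
    then have "\<bar>f x\<bar> \<le> ((\<Sum>i\<le>n. \<bar>w i\<bar> * \<bar>F (x + 2 ^ i * t)\<bar>) + A * W * (t powr \<beta> * t)) / t"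
      using t by (simp add: pos_le_divide_eq powr_add)
    then show "\<bar>f x\<bar> \<le> (\<Sum>i\<le>n. \<bar>w i\<bar> * \<bar>F (x + 2 ^ i * t)\<bar>) / t + A * W * t powr \<beta>"
      using t by (simp add: add_divide_distrib)
  qed
qed

text \<open>Squaring and integrating the pointwise estimate leaves integrals of translates of F,
  each at most the integral over the larger interval. The constants are fixed before F and f, so
  they hold for a whole Hoelder class.\<close>

lemma derivative_interpolation:
  fixes \<gamma> \<beta> A :: real
  assumes "0 < \<gamma>" "\<beta> = real k + \<gamma>" "r\<^sub>1 \<le> r\<^sub>2" "r\<^sub>2 < r\<^sub>3"
  obtains t\<^sub>0 C where "0 < t\<^sub>0" "0 < C"
    "\<And>F f t. holder_class k \<gamma> {r\<^sub>1..r\<^sub>3} A f \<Longrightarrow>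
       (\<And>y. y \<in> {r\<^sub>1..r\<^sub>3} \<Longrightarrow> (F has_real_derivative f y) (at y within {r\<^sub>1..r\<^sub>3})) \<Longrightarrow>
       continuous_on {r\<^sub>1..r\<^sub>3} f \<Longrightarrow> 0 < t \<Longrightarrow> t \<le> t\<^sub>0 \<Longrightarrow>
       (LINT r:{r\<^sub>1..r\<^sub>2}|lborel. (f r)\<^sup>2) \<le> C * ((LINT r:{r\<^sub>1..r\<^sub>3}|lborel. (F r)\<^sup>2) / t\<^sup>2 + t powr (2 * \<beta>))"
proof (rule derivative_interpolation_pointwise[OF assms(1,2)])
  fix W :: real and n :: nat and w :: "nat \<Rightarrow> real"
  assume W: "0 \<le> W" and pw: "\<And>p q A F f x t. holder_class k \<gamma> {p..q} A f \<Longrightarrow>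
       (\<And>y. y \<in> {p..q} \<Longrightarrow> (F has_real_derivative f y) (at y within {p..q})) \<Longrightarrow>
       x \<in> {p..q} \<Longrightarrow> 0 < t \<Longrightarrow> x + 2 ^ n * t \<le> q \<Longrightarrow>
       \<bar>f x\<bar> \<le> (\<Sum>i\<le>n. \<bar>w i\<bar> * \<bar>F (x + 2 ^ i * t)\<bar>) / t + A * W * t powr \<beta>"
  \<comment> \<open>The largest step for which the farthest node \<open>r + 2 ^ n * t\<close> does
    not pass \<open>r\<^sub>3\<close> for any \<open>r\<close> up to
    \<open>r\<^sub>2\<close>.\<close>
  define t\<^sub>0 where "t\<^sub>0 = (r\<^sub>3 - r\<^sub>2) / 2 ^ n"
  define S where "S = (\<Sum>i\<le>n. (w i)\<^sup>2)"
  have S: "0 \<le> S" unfolding S_def by (intro sum_nonneg) auto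
  \<comment> \<open>The first summand collects the 2 from (X + Y)^2 \<le> 2 X^2 + 2 Y^2, the
    \<open>S\<close> from Cauchy-Schwarz and the number of nodes; the second is the squared Taylor
    error integrated over the interval; the 1 gives positivity.\<close>
  define C where "C = 2 * S * real (Suc n) + 2 * (A * W)\<^sup>2 * (r\<^sub>2 - r\<^sub>1) + 1"
  have "0 \<le> 2 * S * real (Suc n)" "0 \<le> 2 * (A * W)\<^sup>2 * (r\<^sub>2 - r\<^sub>1)" using S assms by simp_all
  then have C: "0 < C" "2 * S * real (Suc n) \<le> C" "2 * (A * W)\<^sup>2 * (r\<^sub>2 - r\<^sub>1) \<le> C"
    unfolding C_def by linarith+
  show ?thesis
  proof (rule that[of t\<^sub>0 C])
    show "0 < t\<^sub>0" "0 < C" using assms C by (auto simp: t\<^sub>0_def)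
    fix F f t
    assume f: "holder_class k \<gamma> {r\<^sub>1..r\<^sub>3} A f"
      and F: "\<And>y. y \<in> {r\<^sub>1..r\<^sub>3} \<Longrightarrow> (F has_real_derivative f y) (at y within {r\<^sub>1..r\<^sub>3})"
      and fcont: "continuous_on {r\<^sub>1..r\<^sub>3} f" and t: "0 < t" "t \<le> t\<^sub>0"
    define E where "E = (LINT r:{r\<^sub>1..r\<^sub>3}|lborel. (F r)\<^sup>2)"
    have Fcont: "continuous_on {r\<^sub>1..r\<^sub>3} F"
      using F by (intro DERIV_continuous_on) auto
    have shift: "r + 2 ^ i * t \<in> {r\<^sub>1..r\<^sub>3}" if "r \<in> {r\<^sub>1..r\<^sub>2}" "i \<le> n" for r i
    proof -
      have "2 ^ i * t \<le> 2 ^ n * t\<^sub>0" using that t by (intro mult_mono power_increasing) auto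
      also have "\<dots> = r\<^sub>3 - r\<^sub>2" by (simp add: t\<^sub>0_def)
      finally have "2 ^ i * t \<le> r\<^sub>3 - r\<^sub>2" .
      moreover have "0 \<le> 2 ^ i * t" using t by simp
      ultimately show ?thesis using that by auto
    qed
    have shift_cont: "continuous_on {r\<^sub>1..r\<^sub>2} (\<lambda>r. F (r + 2 ^ i * t))" if "i \<le> n" for i
      using that shift t by (intro continuous_on_compose2[OF Fcont] continuous_intros) auto
    have shift_int: "(LINT r:{r\<^sub>1..r\<^sub>2}|lborel. (F (r + 2 ^ i * t))\<^sup>2) \<le> E" if "i \<le> n" for i
    proof -
      define h where "h = 2 ^ i * t"
      have "E = (\<integral>r. indicator {r\<^sub>1..r\<^sub>3} (h + 1 * r) *\<^sub>R (F (h + 1 * r))\<^sup>2 \<partial>lborel)"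
        unfolding E_def set_lebesgue_integral_def by (subst lborel_integral_real_affine[of 1 _ h]) auto
      moreover have "(LINT r:{r\<^sub>1..r\<^sub>2}|lborel. (F (r + h))\<^sup>2) \<le> \<dots>"
        unfolding set_lebesgue_integral_def
      proof (rule integral_mono')
        have "integrable lborel (\<lambda>r. indicator {r\<^sub>1..r\<^sub>3} r *\<^sub>R (F r)\<^sup>2)"
          using borel_integrable_atLeastAtMost'[of r\<^sub>1 r\<^sub>3 "\<lambda>r. (F r)\<^sup>2"] Fcont
          by (auto simp: set_integrable_def intro!: continuous_intros)
        then show "integrable lborel (\<lambda>r. indicator {r\<^sub>1..r\<^sub>3} (h + 1 * r) *\<^sub>R (F (h + 1 * r))\<^sup>2)"
          by (rule lborel_integrable_real_affine) simp
        show "indicator {r\<^sub>1..r\<^sub>2} r *\<^sub>R (F (r + h))\<^sup>2 \<le> indicator {r\<^sub>1..r\<^sub>3} (h + 1 * r) *\<^sub>R (F (h + 1 * r))\<^sup>2" for r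
          using shift[OF _ that, of r] by (auto simp: indicator_def h_def add.commute)
      qed (auto simp: indicator_def)
      ultimately show ?thesis by (simp add: h_def)
    qed
    have "(f r)\<^sup>2 \<le> 2 * S / t\<^sup>2 * (\<Sum>i\<le>n. (F (r + 2 ^ i * t))\<^sup>2) + 2 * (A * W)\<^sup>2 * t powr (2 * \<beta>)" if r: "r \<in> {r\<^sub>1..r\<^sub>2}" for r
    proof -
      define X where "X = (\<Sum>i\<le>n. \<bar>w i\<bar> * \<bar>F (r + 2 ^ i * t)\<bar>) / t"
      define Y where "Y = A * W * t powr \<beta>"
      have "\<bar>f r\<bar> \<le> X + Y"
        unfolding X_def Y_def using shift[OF r, of n] r assms t by (intro pw[OF f F]) auto
      then have "(f r)\<^sup>2 \<le> (X + Y)\<^sup>2" by (subst abs_le_square_iff[symmetric]) linarith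
      also have "\<dots> \<le> 2 * X\<^sup>2 + 2 * Y\<^sup>2"
        using sum_squares_bound[of X Y] by (simp add: power2_sum)
      also have "X\<^sup>2 \<le> S / t\<^sup>2 * (\<Sum>i\<le>n. (F (r + 2 ^ i * t))\<^sup>2)"
        using Cauchy_Schwarz_ineq_sum[of "\<lambda>i. \<bar>w i\<bar>" "\<lambda>i. \<bar>F (r + 2 ^ i * t)\<bar>" "{..n}"]
        by (simp add: X_def S_def power_divide divide_right_mono)
      also have "Y\<^sup>2 = (A * W)\<^sup>2 * t powr (2 * \<beta>)"
        using t by (simp add: Y_def power_mult_distrib power2_eq_square flip: powr_add)
      finally show ?thesis by simp
    qed
    then have "(LINT r:{r\<^sub>1..r\<^sub>2}|lborel. (f r)\<^sup>2) \<le> (LINT r:{r\<^sub>1..r\<^sub>2}|lborel. 2 * S / t\<^sup>2 * (\<Sum>i\<le>n. (F (r + 2 ^ i * t))\<^sup>2) + 2 * (A * W)\<^sup>2 * t powr (2 * \<beta>))"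
      using assms
      by (intro set_integral_mono borel_integrable_atLeastAtMost' continuous_intros continuous_on_subset[OF fcont] shift_cont) auto
    also have "\<dots> = 2 * S / t\<^sup>2 * (\<Sum>i\<le>n. (LINT r:{r\<^sub>1..r\<^sub>2}|lborel. (F (r + 2 ^ i * t))\<^sup>2)) + 2 * (A * W)\<^sup>2 * t powr (2 * \<beta>) * (r\<^sub>2 - r\<^sub>1)"
    proof -
      have i: "set_integrable lborel {r\<^sub>1..r\<^sub>2} (\<lambda>r. (F (r + 2 ^ i * t))\<^sup>2)" if "i \<le> n" for i
        using that by (intro borel_integrable_atLeastAtMost' continuous_intros shift_cont)
      have "(LINT r:{r\<^sub>1..r\<^sub>2}|lborel. (\<Sum>i\<le>n. (F (r + 2 ^ i * t))\<^sup>2)) = (\<Sum>i\<le>n. (LINT r:{r\<^sub>1..r\<^sub>2}|lborel. (F (r + 2 ^ i * t))\<^sup>2))"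
        unfolding set_lebesgue_integral_def scaleR_sum_right
        by (intro Bochner_Integration.integral_sum) (use i in \<open>auto simp: set_integrable_def\<close>)
      moreover have "set_integrable lborel {r\<^sub>1..r\<^sub>2} (\<lambda>r. 2 * S / t\<^sup>2 * (\<Sum>i\<le>n. (F (r + 2 ^ i * t))\<^sup>2))"
        by (intro borel_integrable_atLeastAtMost' continuous_intros shift_cont) auto
      moreover have "set_integrable lborel {r\<^sub>1..r\<^sub>2} (\<lambda>r. 2 * (A * W)\<^sup>2 * t powr (2 * \<beta>))"
        by (intro borel_integrable_atLeastAtMost' continuous_intros)
      ultimately show ?thesis
        using assms by (simp add: set_integral_add set_integral_mult_right) (simp add: set_lebesgue_integral_def)
    qed
    also have "\<dots> \<le> 2 * S / t\<^sup>2 * (real (Suc n) * E) + C * t powr (2 * \<beta>)"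
    proof (rule add_mono)
      have "(\<Sum>i\<le>n. (LINT r:{r\<^sub>1..r\<^sub>2}|lborel. (F (r + 2 ^ i * t))\<^sup>2)) \<le> real (Suc n) * E"
        using sum_bounded_above[of "{..n}" "\<lambda>i. LINT r:{r\<^sub>1..r\<^sub>2}|lborel. (F (r + 2 ^ i * t))\<^sup>2" E] shift_int by simp
      then show "2 * S / t\<^sup>2 * (\<Sum>i\<le>n. (LINT r:{r\<^sub>1..r\<^sub>2}|lborel. (F (r + 2 ^ i * t))\<^sup>2)) \<le> 2 * S / t\<^sup>2 * (real (Suc n) * E)"
        using S by (intro mult_left_mono) auto
      show "2 * (A * W)\<^sup>2 * t powr (2 * \<beta>) * (r\<^sub>2 - r\<^sub>1) \<le> C * t powr (2 * \<beta>)"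
        using mult_right_mono[OF C(3), of "t powr (2 * \<beta>)"] by (simp add: mult_ac)
    qed
    also have "2 * S / t\<^sup>2 * (real (Suc n) * E) = (2 * S * real (Suc n)) * (E / t\<^sup>2)" by simp
    also have "\<dots> \<le> C * (E / t\<^sup>2)"
    proof (rule mult_right_mono[OF C(2)])
      have "0 \<le> E" unfolding E_def set_lebesgue_integral_def by (intro integral_nonneg_AE) auto
      then show "0 \<le> E / t\<^sup>2" by simp
    qed
    finally show "(LINT r:{r\<^sub>1..r\<^sub>2}|lborel. (f r)\<^sup>2) \<le> C * ((LINT r:{r\<^sub>1..r\<^sub>3}|lborel. (F r)\<^sup>2) / t\<^sup>2 + t powr (2 * \<beta>))"
      by (simp add: E_def distrib_left)
  qed
qed

section \<open>Stability, truncation and rates\<close>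

lemma L2_dist_bounded:
  assumes "continuous_on {r\<^sub>1..r\<^sub>2} f" "continuous_on {r\<^sub>1..r\<^sub>2} h" "r\<^sub>1 \<le> r\<^sub>2"
    and "\<And>r. r \<in> {r\<^sub>1..r\<^sub>2} \<Longrightarrow> \<bar>f r - h r\<bar> \<le> K" and "0 \<le> K"
  shows "L2_dist r\<^sub>1 r\<^sub>2 f h \<le> K * sqrt (r\<^sub>2 - r\<^sub>1)"
proof -
  have "(LINT r:{r\<^sub>1..r\<^sub>2}|lborel. (f r - h r)\<^sup>2) \<le> (LINT r:{r\<^sub>1..r\<^sub>2}|lborel. K\<^sup>2)"
    using assms by (intro set_integral_mono borel_integrable_atLeastAtMost' continuous_intros)
      (auto simp: abs_le_square_iff[symmetric])
  also have "\<dots> = K\<^sup>2 * (r\<^sub>2 - r\<^sub>1)"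
    using assms by (simp add: set_lebesgue_integral_def)
  finally show ?thesis
    unfolding L2_dist_def using assms real_sqrt_le_mono by (fastforce simp: real_sqrt_mult)
qed

lemma (in potential) inverse_stability:
  fixes \<kappa> K \<beta> H H\<^sub>1 r\<^sub>1 r\<^sub>2 a\<^sub>0 :: real
  assumes "0 < \<kappa>" "\<kappa> \<le> K" "1 < \<beta>" "0 < r\<^sub>1" "r\<^sub>1 \<le> r\<^sub>2" "r\<^sub>2 < a\<^sub>0"
  shows "\<exists>C>0. \<forall>L U \<xi> \<zeta> R. cond_C \<kappa> K L \<xi> \<longrightarrow> cond_C \<kappa> K L \<zeta> \<longrightarrow> inverse (Zconst V K) \<le> U \<longrightarrow>
      \<xi> \<in> holder_ball \<beta> U H \<longrightarrow> \<zeta> \<in> holder_ball \<beta> U H\<^sub>1 \<longrightarrow> amax V \<xi> = a\<^sub>0 \<longrightarrow>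
      KL V \<xi> \<zeta> \<le> R \<longrightarrow> 0 < R \<longrightarrow> L2_dist r\<^sub>1 r\<^sub>2 \<zeta> \<xi> \<le> C * R powr (\<beta> / (2 * (\<beta> + 1)))"
proof -
  \<comment> \<open>With this rounding \<gamma> lies in (0, 1]; an integer \<beta> gives \<gamma> =
    1, a Lipschitz condition on the last derivative.\<close>
  define k where "k = nat (\<lceil>\<beta>\<rceil> - 1)"
  define \<gamma> where "\<gamma> = \<beta> - real k"
  have k: "real k = of_int \<lceil>\<beta>\<rceil> - 1" using assms(3) by (simp add: k_def)
  have \<gamma>: "0 < \<gamma>" "\<gamma> \<le> 1" "\<beta> = real k + \<gamma>"
    unfolding \<gamma>_def k by linarith+
  \<comment> \<open>Room to the right for the one-sided differences, still below
    \<open>a\<^sub>0\<close> so that the entropy controls \<open>sfun\<close> there.\<close>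
  define r\<^sub>3 where "r\<^sub>3 = (r\<^sub>2 + a\<^sub>0) / 2"
  have r: "r\<^sub>2 < r\<^sub>3" "r\<^sub>3 < a\<^sub>0" "r\<^sub>1 \<le> r\<^sub>3" using assms by (auto simp: r\<^sub>3_def)
  have K: "0 < K" using assms by linarith
  define A where "A = max (max 0 H) (max 0 H\<^sub>1)"
  obtain C\<^sub>1 where C1: "\<And>f. holder_class k \<gamma> {r\<^sub>1..r\<^sub>3} A f \<Longrightarrow> \<forall>x\<in>{r\<^sub>1..r\<^sub>3}. \<kappa> \<le> f x \<Longrightarrow>
      holder_class k \<gamma> {r\<^sub>1..r\<^sub>3} C\<^sub>1 (\<lambda>x. 1 / (x * f x))"
    using holder_class_inverse_ident_mult[OF \<gamma>(1,2) r(3) assms(1,4)] by blast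
  obtain t\<^sub>0 C\<^sub>2 where t0: "0 < t\<^sub>0" and C2: "0 < C\<^sub>2"
    and interp: "\<And>F f t. holder_class k \<gamma> {r\<^sub>1..r\<^sub>3} (C\<^sub>1 + C\<^sub>1) f \<Longrightarrow>
       (\<And>y. y \<in> {r\<^sub>1..r\<^sub>3} \<Longrightarrow> (F has_real_derivative f y) (at y within {r\<^sub>1..r\<^sub>3})) \<Longrightarrow>
       continuous_on {r\<^sub>1..r\<^sub>3} f \<Longrightarrow> 0 < t \<Longrightarrow> t \<le> t\<^sub>0 \<Longrightarrow>
       (LINT r:{r\<^sub>1..r\<^sub>2}|lborel. (f r)\<^sup>2) \<le> C\<^sub>2 * ((LINT r:{r\<^sub>1..r\<^sub>3}|lborel. (F r)\<^sup>2) / t\<^sup>2 + t powr (2 * \<beta>))"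
    by (rule derivative_interpolation[OF \<gamma>(1,3) assms(5) r(1)]) blast
  obtain C\<^sub>3 where C3: "0 < C\<^sub>3" and control: "\<And>L \<xi> \<zeta>. cond_C \<kappa> K L \<xi> \<Longrightarrow> cond_C \<kappa> K L \<zeta> \<Longrightarrow> amax V \<xi> = a\<^sub>0 \<Longrightarrow>
      (LINT r:{r\<^sub>1..r\<^sub>3}|lborel. (sfun V \<xi> r - sfun V \<zeta> r)\<^sup>2) \<le> C\<^sub>3 * KL V \<xi> \<zeta>"
    using KL_controls_sfun[OF assms(1,2,4) r(3,2)] by blast
  \<comment> \<open>Bounds the factor r \<xi> \<zeta> in \<zeta> - \<xi> = - r \<xi> \<zeta>
    F'.\<close>
  define B where "B = a\<^sub>0 * K\<^sup>2"
  define D where "D = B\<^sup>2 * C\<^sub>2 * (C\<^sub>3 + 1)"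
  have D: "0 \<le> D" using C2 C3 by (simp add: D_def)
  \<comment> \<open>The first term is for steps up to \<open>t\<^sub>0\<close>. The second pays for
    large \<open>R\<close>, where the trivial bound \<open>K\<close> on the error is compared with
    the rate at \<open>t\<^sub>0\<close>.\<close>
  define C where "C = sqrt D + K * sqrt (r\<^sub>2 - r\<^sub>1) / t\<^sub>0 powr \<beta> + 1"
  have CD: "sqrt D \<le> C" "K * sqrt (r\<^sub>2 - r\<^sub>1) / t\<^sub>0 powr \<beta> \<le> C" "0 < C"
    using D K assms t0 by (simp_all add: C_def add_nonneg_pos)
  have "L2_dist r\<^sub>1 r\<^sub>2 \<zeta> \<xi> \<le> C * R powr (\<beta> / (2 * (\<beta> + 1)))"
    if \<xi>C: "cond_C \<kappa> K L \<xi>" and \<zeta>C: "cond_C \<kappa> K L \<zeta>" and U: "inverse (Zconst V K) \<le> U"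
      and \<xi>H: "\<xi> \<in> holder_ball \<beta> U H" and \<zeta>H: "\<zeta> \<in> holder_ball \<beta> U H\<^sub>1" and a0: "amax V \<xi> = a\<^sub>0"
      and KL: "KL V \<xi> \<zeta> \<le> R" and R: "0 < R" for L U \<xi> \<zeta> R
  proof -
    interpret coefficient_pair V \<kappa> K L \<xi> \<zeta>
      using assms \<xi>C \<zeta>C by unfold_locales auto
    define t where "t = R powr (1 / (2 * (\<beta> + 1)))"
    have t: "0 < t" using R by (simp add: t_def)
    have t\<beta>: "t powr \<beta> = R powr (\<beta> / (2 * (\<beta> + 1)))"
      by (simp add: t_def powr_powr)
    have cont: "continuous_on {r\<^sub>1..r\<^sub>3} \<xi>" "continuous_on {r\<^sub>1..r\<^sub>3} \<zeta>"
      using assms by (auto intro!: continuous_on_subset[OF a.continuous] continuous_on_subset[OF b.continuous])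
    have cont2: "continuous_on {r\<^sub>1..r\<^sub>2} \<xi>" "continuous_on {r\<^sub>1..r\<^sub>2} \<zeta>"
      using r cont by (auto intro: continuous_on_subset)
    show ?thesis
    proof (cases "t \<le> t\<^sub>0")
      case False
      have "L2_dist r\<^sub>1 r\<^sub>2 \<zeta> \<xi> \<le> K * sqrt (r\<^sub>2 - r\<^sub>1)"
      proof (rule L2_dist_bounded)
        fix r assume "r \<in> {r\<^sub>1..r\<^sub>2}"
        then have "0 \<le> r" using assms by auto
        then show "\<bar>\<zeta> r - \<xi> r\<bar> \<le> K"
          using a.bounds[of r] b.bounds[of r] a.kappa_pos by linarith
      qed (use assms K cont2 in auto)
      also have "\<dots> = K * sqrt (r\<^sub>2 - r\<^sub>1) / t\<^sub>0 powr \<beta> * t\<^sub>0 powr \<beta>" using t0 by simp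
      also have "\<dots> \<le> C * t powr \<beta>"
        using CD t0 False assms K by (intro mult_mono powr_mono2) auto
      finally show ?thesis by (simp add: t\<beta>)
    next
      case True
      define F where "F r = sfun V \<xi> r - sfun V \<zeta> r" for r
      define f where "f r = 1 / (r * \<zeta> r) + - (1 / (r * \<xi> r))" for r
      \<comment> \<open>Hoelder bounds are available on \<open>{0..U}\<close> only;
        \<open>a\<^sub>0 \<le> 1 / Zconst V K \<le> U\<close> brings the whole interval
        inside.\<close>
      have "r\<^sub>3 \<le> U"
        using a.amax_bounds(2) U a0 r by (simp add: inverse_eq_divide)
      then have sub: "{r\<^sub>1..r\<^sub>3} \<subseteq> {0..U}" using assms by auto
      have hc: "holder_class k \<gamma> {r\<^sub>1..r\<^sub>3} A \<xi>" "holder_class k \<gamma> {r\<^sub>1..r\<^sub>3} A \<zeta>"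
        using holder_ball_imp_holder_class[OF \<xi>H sub] holder_ball_imp_holder_class[OF \<zeta>H sub]
        by (auto simp: k_def \<gamma>_def A_def elim!: holder_class_mono)
      have ge: "\<forall>x\<in>{r\<^sub>1..r\<^sub>3}. \<kappa> \<le> \<xi> x" "\<forall>x\<in>{r\<^sub>1..r\<^sub>3}. \<kappa> \<le> \<zeta> x"
        using assms a.bounds b.bounds by auto
      have nz: "x * \<xi> x \<noteq> 0" "x * \<zeta> x \<noteq> 0" if "x \<in> {r\<^sub>1..r\<^sub>3}" for x
        using a.pos[of x] b.pos[of x] that assms by auto
      have "holder_class k \<gamma> {r\<^sub>1..r\<^sub>3} (C\<^sub>1 + C\<^sub>1) f"
        unfolding f_def by (intro holder_class_add holder_class_minus C1 hc ge)
      moreover have "(F has_real_derivative f x) (at x within {r\<^sub>1..r\<^sub>3})" if "x \<in> {r\<^sub>1..r\<^sub>3}" for x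
      proof -
        have "0 < x" using that assms by auto
        then have "(F has_real_derivative f x) (at x)"
          unfolding F_def f_def sfun_def by (auto intro!: derivative_eq_intros a.gfun_deriv b.gfun_deriv)
        then show ?thesis by (rule has_field_derivative_at_within)
      qed
      moreover have "continuous_on {r\<^sub>1..r\<^sub>3} f"
        unfolding f_def using cont nz by (intro continuous_intros) auto
      ultimately have 1: "(LINT r:{r\<^sub>1..r\<^sub>2}|lborel. (f r)\<^sup>2) \<le> C\<^sub>2 * ((LINT r:{r\<^sub>1..r\<^sub>3}|lborel. (F r)\<^sup>2) / t\<^sup>2 + t powr (2 * \<beta>))"
        using True t by (intro interp)
      have "(LINT r:{r\<^sub>1..r\<^sub>3}|lborel. (F r)\<^sup>2) \<le> C\<^sub>3 * R"
        unfolding F_def using control[OF \<xi>C \<zeta>C a0] mult_left_mono[OF KL, of C\<^sub>3] C3 by linarith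
      then have "(LINT r:{r\<^sub>1..r\<^sub>3}|lborel. (F r)\<^sup>2) / t\<^sup>2 \<le> C\<^sub>3 * R / t\<^sup>2"
        by (intro divide_right_mono) auto
      \<comment> \<open>The choice of \<open>t\<close> means
        \<open>R = t powr (2 * (\<beta> + 1))\<close>, so the entropy term and the Taylor term have
        the same order.\<close>
      also have "C\<^sub>3 * R / t\<^sup>2 = C\<^sub>3 * t powr (2 * \<beta>)"
      proof -
        have "R = t powr (2 * (\<beta> + 1))" using R assms by (simp add: t_def powr_powr)
        also have "\<dots> = t powr (2 * \<beta>) * t powr 2" by (simp add: powr_add[symmetric] algebra_simps)
        also have "t powr 2 = t\<^sup>2" using t by simp
        finally show ?thesis using t by simp
      qed
      finally have "C\<^sub>2 * ((LINT r:{r\<^sub>1..r\<^sub>3}|lborel. (F r)\<^sup>2) / t\<^sup>2 + t powr (2 * \<beta>)) \<le> C\<^sub>2 * (C\<^sub>3 * t powr (2 * \<beta>) + t powr (2 * \<beta>))"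
        using C2 by (intro mult_left_mono add_right_mono) auto
      with 1 have 2: "(LINT r:{r\<^sub>1..r\<^sub>2}|lborel. (f r)\<^sup>2) \<le> C\<^sub>2 * (C\<^sub>3 + 1) * t powr (2 * \<beta>)"
        by (simp add: algebra_simps)
      have "(LINT r:{r\<^sub>1..r\<^sub>2}|lborel. (\<zeta> r - \<xi> r)\<^sup>2) \<le> (LINT r:{r\<^sub>1..r\<^sub>2}|lborel. B\<^sup>2 * (f r)\<^sup>2)"
      proof (rule set_integral_mono)
        fix x assume "x \<in> {r\<^sub>1..r\<^sub>2}"
        then have x: "x \<in> {r\<^sub>1..r\<^sub>3}" "0 < x" "x \<le> a\<^sub>0" using r assms by auto
        have "\<zeta> x - \<xi> x = - (x * \<xi> x * \<zeta> x * f x)"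
          using nz[OF x(1)] unfolding f_def by (simp add: field_simps)
        then have "\<bar>\<zeta> x - \<xi> x\<bar> = x * \<xi> x * \<zeta> x * \<bar>f x\<bar>"
          using x(2) a.pos[of x] b.pos[of x] by (simp add: abs_mult)
        also have "\<dots> \<le> a\<^sub>0 * K * K * \<bar>f x\<bar>"
          using x a.pos[of x] b.pos[of x] a.bounds[of x] b.bounds[of x] K assms by (intro mult_mono) auto
        also have "\<dots> = \<bar>B * f x\<bar>"
          using assms K by (simp add: B_def abs_mult power2_eq_square)
        finally show "(\<zeta> x - \<xi> x)\<^sup>2 \<le> B\<^sup>2 * (f x)\<^sup>2"
          by (simp add: abs_le_square_iff power_mult_distrib)
      next
        have "continuous_on {r\<^sub>1..r\<^sub>2} f"
          using \<open>continuous_on {r\<^sub>1..r\<^sub>3} f\<close> r by (auto intro: continuous_on_subset)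
        then show "set_integrable lborel {r\<^sub>1..r\<^sub>2} (\<lambda>r. B\<^sup>2 * (f r)\<^sup>2)"
          by (intro borel_integrable_atLeastAtMost' continuous_intros)
        show "set_integrable lborel {r\<^sub>1..r\<^sub>2} (\<lambda>r. (\<zeta> r - \<xi> r)\<^sup>2)"
          using cont2 by (intro borel_integrable_atLeastAtMost' continuous_intros)
      qed
      also have "\<dots> \<le> D * t powr (2 * \<beta>)"
        using mult_left_mono[OF 2, of "B\<^sup>2"] by (simp add: D_def mult_ac)
      also have "\<dots> = D * (t powr \<beta>)\<^sup>2" by (simp add: power2_eq_square flip: powr_add)
      finally have "L2_dist r\<^sub>1 r\<^sub>2 \<zeta> \<xi> \<le> sqrt (D * (t powr \<beta>)\<^sup>2)"
        unfolding L2_dist_def by (rule real_sqrt_le_mono)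
      also have "\<dots> = sqrt D * t powr \<beta>" by (simp add: real_sqrt_mult)
      also have "\<dots> \<le> C * t powr \<beta>" using CD by (intro mult_right_mono) auto
      finally show ?thesis by (simp add: t\<beta>)
    qed
  qed
  then show ?thesis using CD(3) by blast
qed

text \<open>The case \<open>R = 0\<close> is the limit of the previous bound as \<open>R \<rightarrow> 0\<close>.\<close>

lemma (in potential) inverse_stability_nonneg:
  fixes \<kappa> K \<beta> H H\<^sub>1 r\<^sub>1 r\<^sub>2 a\<^sub>0 :: real
  assumes "0 < \<kappa>" "\<kappa> \<le> K" "1 < \<beta>" "0 < r\<^sub>1" "r\<^sub>1 \<le> r\<^sub>2" "r\<^sub>2 < a\<^sub>0"
  shows "\<exists>C>0. \<forall>L U \<xi> \<zeta> R. cond_C \<kappa> K L \<xi> \<longrightarrow> cond_C \<kappa> K L \<zeta> \<longrightarrow> inverse (Zconst V K) \<le> U \<longrightarrow>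
      \<xi> \<in> holder_ball \<beta> U H \<longrightarrow> \<zeta> \<in> holder_ball \<beta> U H\<^sub>1 \<longrightarrow> amax V \<xi> = a\<^sub>0 \<longrightarrow>
      KL V \<xi> \<zeta> \<le> R \<longrightarrow> 0 \<le> R \<and> L2_dist r\<^sub>1 r\<^sub>2 \<zeta> \<xi> \<le> C * R powr (\<beta> / (2 * (\<beta> + 1)))"
proof -
  define e where "e = \<beta> / (2 * (\<beta> + 1))"
  have e: "0 < e" using assms by (simp add: e_def)
  obtain C where C: "0 < C" and st: "\<And>L U \<xi> \<zeta> R. cond_C \<kappa> K L \<xi> \<Longrightarrow> cond_C \<kappa> K L \<zeta> \<Longrightarrow> inverse (Zconst V K) \<le> U \<Longrightarrow>
      \<xi> \<in> holder_ball \<beta> U H \<Longrightarrow> \<zeta> \<in> holder_ball \<beta> U H\<^sub>1 \<Longrightarrow> amax V \<xi> = a\<^sub>0 \<Longrightarrow>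
      KL V \<xi> \<zeta> \<le> R \<Longrightarrow> 0 < R \<Longrightarrow> L2_dist r\<^sub>1 r\<^sub>2 \<zeta> \<xi> \<le> C * R powr e"
    using inverse_stability[OF assms, of H H\<^sub>1] unfolding e_def by blast
  have "0 \<le> R \<and> L2_dist r\<^sub>1 r\<^sub>2 \<zeta> \<xi> \<le> C * R powr e"
    if hyps: "cond_C \<kappa> K L \<xi>" "cond_C \<kappa> K L \<zeta>" "inverse (Zconst V K) \<le> U"
      "\<xi> \<in> holder_ball \<beta> U H" "\<zeta> \<in> holder_ball \<beta> U H\<^sub>1" "amax V \<xi> = a\<^sub>0" and KL: "KL V \<xi> \<zeta> \<le> R" for L U \<xi> \<zeta> R
  proof -
    interpret coefficient_pair V \<kappa> K L \<xi> \<zeta>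
      using assms hyps by unfold_locales auto
    have "0 \<le> R" using KL KL_nonneg by linarith
    moreover have "L2_dist r\<^sub>1 r\<^sub>2 \<zeta> \<xi> \<le> 0" if "R = 0"
    proof (rule ccontr)
      define l where "l = L2_dist r\<^sub>1 r\<^sub>2 \<zeta> \<xi>"
      assume "\<not> L2_dist r\<^sub>1 r\<^sub>2 \<zeta> \<xi> \<le> 0"
      then have l: "0 < l" by (simp add: l_def)
      \<comment> \<open>The value at which the bound equals \<open>l / 2\<close>; since the entropy
        is at most 0 here, the bound may be applied with \<open>R'\<close> and contradicts
        \<open>0 < l\<close>.\<close>
      define R' where "R' = (l / (2 * C)) powr (1 / e)"
      have "0 < R'" using l C by (simp add: R'_def)
      then have "l \<le> C * R' powr e" unfolding l_def using hyps KL that by (intro st) auto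
      also have "R' powr e = l / (2 * C)" using e l C by (simp add: R'_def powr_powr)
      finally show False using l C by simp
    qed
    ultimately show ?thesis using st[OF hyps KL] by (cases "R = 0") auto
  qed
  then show ?thesis using C unfolding e_def by blast
qed

section \<open>Exponentially small truncation terms\<close>

context potential
begin

text \<open>Outside the sublevel set the part c of the rate \<kappa> already contributes exp (- c (M
  - v)), and the rest \<kappa> - c > 0 keeps the integral finite. This is where the strict
  inequality \<open>c < \<kappa>\<close> enters.\<close>

lemma sublevel_tail_integral:
  assumes "0 < c" "c < \<kappa>" and f: "\<And>x. 0 \<le> f x" "\<And>x. f x \<le> (A + B * (V x - v)) * exp (- \<kappa> * (V x - v))"
    and "0 \<le> A" "0 \<le> B"
  shows "(LINT x:- sublevel V M|lborel. f x)
    \<le> (\<integral>x. (A + B * (V x - v)) * exp (- (\<kappa> - c) * (V x - v)) \<partial>lborel) * exp (- c * (M - v))"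
proof -
  have "(LINT x:- sublevel V M|lborel. f x)
    \<le> (\<integral>x. (A + B * (V x - v)) * exp (- (\<kappa> - c) * (V x - v)) * exp (- c * (M - v)) \<partial>lborel)"
    unfolding set_lebesgue_integral_def
  proof (rule integral_mono')
    show "integrable lborel (\<lambda>x. (A + B * (V x - v)) * exp (- (\<kappa> - c) * (V x - v)) * exp (- c * (M - v)))"
      using assms by (intro integrable_mult_left linear_exp_integrable) auto
    show pos: "0 \<le> (A + B * (V x - v)) * exp (- (\<kappa> - c) * (V x - v)) * exp (- c * (M - v))" for x
      using assms by (intro mult_nonneg_nonneg add_nonneg_nonneg) auto
    show "indicat_real (- sublevel V M) x *\<^sub>R f x
      \<le> (A + B * (V x - v)) * exp (- (\<kappa> - c) * (V x - v)) * exp (- c * (M - v))" for x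
    proof (cases "V x \<le> M")
      case True
      then show ?thesis using pos[of x] by (simp add: sublevel_def)
    next
      case False
      have "c * (M - v) \<le> c * (V x - v)" using False assms by (intro mult_left_mono) auto
      then have "exp (- \<kappa> * (V x - v)) \<le> exp (- (\<kappa> - c) * (V x - v)) * exp (- c * (M - v))"
        by (simp add: algebra_simps flip: exp_add)
      then have "(A + B * (V x - v)) * exp (- \<kappa> * (V x - v))
        \<le> (A + B * (V x - v)) * (exp (- (\<kappa> - c) * (V x - v)) * exp (- c * (M - v)))"
        using assms by (intro mult_left_mono add_nonneg_nonneg) auto
      then show ?thesis using f(2)[of x] False by (simp add: sublevel_def mult.assoc)
    qed
  qed
  then show ?thesis by simp
qed

text \<open>The constant is built from the envelopes alone, so it serves every sieve index and every
  sample size. Nonemptiness of \<open>F\<close> matters because a real supremum over the empty set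
  carries no information.\<close>

lemma truncation_bounds:
  assumes "0 < \<kappa>" "\<kappa> \<le> K" "0 < c" "c < \<kappa>"
  shows "\<exists>Q>0. \<forall>L \<Xi>\<^sub>0 F M. cond_C \<kappa> K L \<Xi>\<^sub>0 \<longrightarrow> F \<noteq> {} \<longrightarrow> (\<forall>\<xi>\<in>F. cond_C \<kappa> K L \<xi>) \<longrightarrow>
    0 \<le> tail V \<Xi>\<^sub>0 M \<and> tail V \<Xi>\<^sub>0 M \<le> Q * exp (- c * (M - v)) \<and>
    (Q * exp (- c * (M - v)) \<le> 1 \<longrightarrow> dtrunc V F \<Xi>\<^sub>0 M + Rtrunc V F \<Xi>\<^sub>0 M \<le> Q * exp (- c * (M - v)))"
proof -
  have K: "0 < K" using assms by linarith
  have Z: "0 < Zconst V \<kappa>" "0 < Zconst V K" using assms K by (auto intro: Zconst_pos)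
  define D where "D = ln (Zconst V \<kappa>) - ln (Zconst V K)"
  define T where "T A B = (\<integral>x. (A + B * (V x - v)) * exp (- (\<kappa> - c) * (V x - v)) \<partial>lborel)" for A B
  define a where "a = 1 / Zconst V K"
  have a: "0 < a" using Z by (simp add: a_def)
  \<comment> \<open>The factor 2 pays for - ln (1 - \<tau>) \<le> 2 \<tau>, valid for 0 \<le> \<tau>
    \<le> 1 / 2, and the smallness condition on \<open>Q\<close> forces this range. The second term
    bounds \<open>Rtrunc\<close>.\<close>
  define Q where "Q = 2 * \<bar>T a 0\<bar> + \<bar>T (a * \<bar>D\<bar>) (a * K)\<bar> + 1"
  have Q: "0 < Q" "2 * T a 0 + T (a * \<bar>D\<bar>) (a * K) \<le> Q" "2 * T a 0 \<le> Q"
    unfolding Q_def by linarith+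
  have tail: "0 \<le> tail V \<xi> M" "tail V \<xi> M \<le> T a 0 * exp (- c * (M - v))" if "cond_C \<kappa> K L \<xi>" for L \<xi> M
  proof -
    interpret potential_coefficient V \<kappa> K L \<xi>
      using assms that by unfold_locales auto
    show "0 \<le> tail V \<xi> M"
      unfolding tail_def set_lebesgue_integral_def by (intro integral_nonneg_AE) auto
    show "tail V \<xi> M \<le> T a 0 * exp (- c * (M - v))"
      unfolding tail_def T_def
    proof (rule sublevel_tail_integral)
      show "sdens V \<xi> x \<le> (a + 0 * (V x - v)) * exp (- \<kappa> * (V x - v))" for x
        using sdens_bounds(1)[of x] mult_right_mono[OF amax_bounds(2), of "exp (- \<kappa> * (V x - v))"]
        by (simp add: a_def)
    qed (use assms a in auto)
  qed
  have "0 \<le> tail V \<Xi>\<^sub>0 M \<and> tail V \<Xi>\<^sub>0 M \<le> Q * exp (- c * (M - v)) \<and>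
    (Q * exp (- c * (M - v)) \<le> 1 \<longrightarrow> dtrunc V F \<Xi>\<^sub>0 M + Rtrunc V F \<Xi>\<^sub>0 M \<le> Q * exp (- c * (M - v)))"
    if \<Xi>: "cond_C \<kappa> K L \<Xi>\<^sub>0" and F: "F \<noteq> {}" "\<forall>\<xi>\<in>F. cond_C \<kappa> K L \<xi>" for L \<Xi>\<^sub>0 F M
  proof (intro conjI impI)
    define E where "E = exp (- c * (M - v))"
    have E: "0 < E" by (simp add: E_def)
    show t0: "0 \<le> tail V \<Xi>\<^sub>0 M" using tail[OF \<Xi>] by simp
    have T0: "0 \<le> T a 0 * E" using tail[OF \<Xi>, of M] by (simp add: E_def)
    have QE: "2 * T a 0 * E \<le> Q * E" using Q E by (intro mult_right_mono) auto
    show "tail V \<Xi>\<^sub>0 M \<le> Q * exp (- c * (M - v))"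
      using tail(2)[OF \<Xi>, of M] T0 QE unfolding E_def[symmetric] by linarith
    assume small: "Q * exp (- c * (M - v)) \<le> 1"
    define \<tau> where "\<tau> = T a 0 * E"
    have \<tau>: "0 \<le> \<tau>" "\<tau> \<le> 1 / 2" using T0 QE small unfolding \<tau>_def E_def[symmetric] by linarith+
    have "tail_sup V F \<Xi>\<^sub>0 M \<le> \<tau>"
      unfolding tail_sup_def \<tau>_def E_def using tail(2) \<Xi> F by (intro cSUP_least) auto
    then have "ln (1 - \<tau>) \<le> ln (1 - tail_sup V F \<Xi>\<^sub>0 M)" using \<tau> by simp
    moreover have "- \<tau> - 2 * \<tau>\<^sup>2 \<le> ln (1 - \<tau>)" using \<tau> by (intro ln_one_minus_pos_lower_bound)
    moreover have "2 * \<tau>\<^sup>2 \<le> \<tau>" using \<tau> mult_left_mono[of \<tau> "1 / 2" \<tau>] by (simp add: power2_eq_square)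
    ultimately have "dtrunc V F \<Xi>\<^sub>0 M \<le> 2 * \<tau>" unfolding dtrunc_def by linarith
    moreover have "Rtrunc V F \<Xi>\<^sub>0 M \<le> T (a * \<bar>D\<bar>) (a * K) * E"
      unfolding Rtrunc_def
    proof (rule cSUP_least[OF F(1)])
      fix \<xi> assume "\<xi> \<in> F"
      then interpret coefficient_pair V \<kappa> K L \<Xi>\<^sub>0 \<xi>
        using assms \<Xi> F by unfold_locales auto
      show "(LINT x:- sublevel V M|lborel. sdens V \<Xi>\<^sub>0 x * \<bar>ln (sdens V \<Xi>\<^sub>0 x / sdens V \<xi> x)\<bar>) \<le> T (a * \<bar>D\<bar>) (a * K) * E"
        unfolding T_def E_def
      proof (rule sublevel_tail_integral)
        fix x
        show "0 \<le> sdens V \<Xi>\<^sub>0 x * \<bar>ln (sdens V \<Xi>\<^sub>0 x / sdens V \<xi> x)\<bar>" by simp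
        have "sdens V \<Xi>\<^sub>0 x * \<bar>ln (sdens V \<Xi>\<^sub>0 x / sdens V \<xi> x)\<bar> \<le> (a * exp (- \<kappa> * (V x - v))) * (\<bar>D\<bar> + K * (V x - v))"
        proof (rule mult_mono)
          show "sdens V \<Xi>\<^sub>0 x \<le> a * exp (- \<kappa> * (V x - v))"
            using a.sdens_bounds(1)[of x] mult_right_mono[OF a.amax_bounds(2), of "exp (- \<kappa> * (V x - v))"]
            by (simp add: a_def)
          show "\<bar>ln (sdens V \<Xi>\<^sub>0 x / sdens V \<xi> x)\<bar> \<le> \<bar>D\<bar> + K * (V x - v)"
            using log_ratio_bound[of x] by (simp add: ln_div D_def)
        qed (use a in auto)
        then show "sdens V \<Xi>\<^sub>0 x * \<bar>ln (sdens V \<Xi>\<^sub>0 x / sdens V \<xi> x)\<bar>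
          \<le> (a * \<bar>D\<bar> + a * K * (V x - v)) * exp (- \<kappa> * (V x - v))"
          by (simp add: algebra_simps)
      qed (use assms a K in auto)
    qed
    moreover have "2 * \<tau> + T (a * \<bar>D\<bar>) (a * K) * E \<le> Q * E"
      using mult_right_mono[OF Q(2), of E] E by (simp add: \<tau>_def distrib_right)
    ultimately show "dtrunc V F \<Xi>\<^sub>0 M + Rtrunc V F \<Xi>\<^sub>0 M \<le> Q * exp (- c * (M - v))"
      unfolding E_def by linarith
  qed
  then show ?thesis using Q(1) by blast
qed

end

section \<open>Balancing the terms of the risk bound\<close>

lemma with_prob_ge_mono:
  assumes "with_prob_ge P p E" "q \<le> p" "\<And>\<omega>. \<omega> \<in> space P \<Longrightarrow> E \<omega> \<Longrightarrow> E' \<omega>"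
  shows "with_prob_ge P q E'"
proof -
  obtain A where A: "A \<in> sets P" "\<forall>\<omega>\<in>A. E \<omega>" "p \<le> measure P A"
    using assms(1) by (auto simp: with_prob_ge_def)
  moreover have "\<forall>\<omega>\<in>A. E' \<omega>" using A assms(3) sets.sets_into_space by blast
  ultimately show ?thesis using assms(2) unfolding with_prob_ge_def by (blast intro: order.trans)
qed

text \<open>With l = ln (1 / \<gamma>) the denominator is l - 1 + exp (- l), which is positive and
  at most l^2 / 2 by Taylor's formula.\<close>

lemma Bgamma_ge_2:
  assumes "0 < \<gamma>" "\<gamma> < 1"
  shows "2 \<le> Bgamma \<gamma>"
proof -
  define l where "l = ln (1 / \<gamma>)"
  have l: "0 < l" "exp (- l) = \<gamma>" using assms by (auto simp: l_def ln_div)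
  have "0 < exp (- l) / 2 * l\<^sup>2" using l assms by simp
  also have "\<dots> \<le> l - 1 + exp (- l)" using l by (intro exp_minus_quadratic_lower_bound) auto
  finally have pos: "0 < l - 1 + \<gamma>" using l by simp
  obtain u where u: "exp (- l) = (\<Sum>m<3. (- l) ^ m / fact m) + exp u / fact 3 * (- l) ^ 3"
    using Maclaurin_exp_le[of "- l" 3] by blast
  have "exp u / fact 3 * (- l) ^ 3 \<le> 0" using l by (intro mult_nonneg_nonpos) auto
  then have "\<gamma> \<le> 1 - l + l\<^sup>2 / 2" using u l by (simp add: numeral_3_eq_3 power2_eq_square)
  then show ?thesis
    using pos unfolding Bgamma_def l_def[symmetric] by (simp add: pos_le_divide_eq)
qed

text \<open>With s = 1 / (2 \<beta> + 3) and m of order u^(-s), the approximation term has order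
  u^(2 s (\<beta> + 1)) and the stochastic term u m has order u^(1 - s). These exponents coincide,
  which is the balance behind the choice of m.\<close>

lemma risk_bound_rate:
  fixes b :: "nat \<Rightarrow> real" and m :: "nat \<Rightarrow> nat" and \<beta> b\<^sub>0 C\<^sub>0 Q p \<delta> :: real
  defines "u \<equiv> \<lambda>n. b n * ln (real n) / real n"
  assumes "0 < \<beta>" "1 < p" "0 \<le> Q" "0 < C\<^sub>0" "0 < \<delta>" "\<delta> < 1"
    and b_pos: "\<And>n. 2 \<le> n \<Longrightarrow> 0 < b n" and b_O: "b \<in> O(\<lambda>n. ln (real n))"
    and b0: "0 < b\<^sub>0" "\<forall>\<^sub>F n in sequentially. b\<^sub>0 \<le> b n"
    and m: "(\<lambda>n. real (m n)) \<in> \<Theta>(\<lambda>n. (real n / (b n * ln (real n))) powr (1 / (2 * \<beta> + 3)))"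
  shows "\<forall>\<^sub>F n in sequentially. m\<^sub>0 \<le> m n"
    and "\<exists>C>0. \<forall>\<^sub>F n in sequentially.
      C\<^sub>0 * (real (m n) powr (- 2 * (\<beta> + 1)) + b n * (real (m n) * ln (real n) + ln (1 / \<delta>)) / real n
        + Q * real n powr (- p)) \<le> C * u n powr ((2 * \<beta> + 2) / (2 * \<beta> + 3))"
proof -
  define s where "s = 1 / (2 * \<beta> + 3)"
  define e where "e = (2 * \<beta> + 2) / (2 * \<beta> + 3)"
  have s: "0 < s" using assms by (simp add: s_def)
  have e: "e = 1 - s" "e = s * (2 * (\<beta> + 1))" "e \<le> 1"
    using assms by (auto simp: e_def s_def field_simps)
  have u_pos: "0 < u n" if "2 \<le> n" for n
    using that b_pos[OF that] by (simp add: u_def)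
  have u_lim: "u \<longlonglongrightarrow> 0"
  proof -
    obtain c where c: "0 < c" "\<forall>\<^sub>F n in sequentially. norm (b n) \<le> c * norm (ln (real n))"
      using b_O by (rule landau_o.bigE)
    have "\<forall>\<^sub>F n in sequentially. norm (u n) \<le> c * ((ln (real n))\<^sup>2 / real n)"
      using c(2)
    proof eventually_elim
      case (elim n)
      have "norm (b n) * norm (ln (real n)) / real n \<le> c * norm (ln (real n)) * norm (ln (real n)) / real n"
        using elim by (intro divide_right_mono mult_right_mono) auto
      then show ?case by (simp add: u_def abs_mult power2_eq_square mult.assoc)
    qed
    moreover have "(\<lambda>n. c * ((ln (real n))\<^sup>2 / real n)) \<longlonglongrightarrow> 0"
      by real_asymp
    ultimately show ?thesis by (rule Lim_null_comparison)
  qed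
  have ev2: "\<forall>\<^sub>F n in sequentially. (2::nat) \<le> n" by (rule eventually_ge_at_top)
  have g: "(real n / (b n * ln (real n))) powr (1 / (2 * \<beta> + 3)) = u n powr (- s)" if "2 \<le> n" for n
  proof -
    have "real n / (b n * ln (real n)) = 1 / u n" by (simp add: u_def)
    then show ?thesis using u_pos[OF that] by (simp add: s_def powr_divide powr_minus_divide)
  qed
  obtain c\<^sub>2 where c2: "0 < c\<^sub>2" "\<forall>\<^sub>F n in sequentially. real (m n) \<le> c\<^sub>2 * u n powr (- s)"
  proof -
    obtain c where "0 < c" "\<forall>\<^sub>F n in sequentially. norm (real (m n)) \<le> c * norm ((real n / (b n * ln (real n))) powr (1 / (2 * \<beta> + 3)))"
      using bigthetaD1[OF m] by (rule landau_o.bigE)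
    then show ?thesis using that[of c] eventually_elim2[OF _ ev2] g by (smt (verit) abs_of_nonneg eventually_mono of_nat_0_le_iff powr_ge_zero real_norm_def)
  qed
  obtain c\<^sub>1 where c1: "0 < c\<^sub>1" "\<forall>\<^sub>F n in sequentially. c\<^sub>1 * u n powr (- s) \<le> real (m n)"
  proof -
    obtain c where "0 < c" "\<forall>\<^sub>F n in sequentially. norm (real (m n)) \<ge> c * norm ((real n / (b n * ln (real n))) powr (1 / (2 * \<beta> + 3)))"
      using bigthetaD2[OF m] by (rule landau_omega.bigE)
    then show ?thesis using that[of c] eventually_elim2[OF _ ev2] g by (smt (verit) abs_of_nonneg eventually_mono of_nat_0_le_iff powr_ge_zero real_norm_def)
  qed
  show "\<forall>\<^sub>F n in sequentially. m\<^sub>0 \<le> m n"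
  proof -
    \<comment> \<open>Once \<open>u n\<close> is below \<open>w powr (- 1 / s)\<close>, the power
      \<open>u n powr (- s)\<close> is at least \<open>w\<close>, and the lower bound on
      \<open>m n\<close> exceeds \<open>m\<^sub>0\<close>.\<close>
    define w where "w = (real m\<^sub>0 + 1) / c\<^sub>1"
    have w: "0 < w" using c1 by (simp add: w_def)
    then have "\<forall>\<^sub>F n in sequentially. u n < w powr (- 1 / s)"
      by (intro order_tendstoD(2)[OF u_lim]) simp
    then show ?thesis using c1(2) ev2
    proof eventually_elim
      case (elim n)
      have "(w powr (- 1 / s)) powr (- s) \<le> u n powr (- s)"
        using elim u_pos[of n] s by (intro powr_mono2') auto
      then have "w \<le> u n powr (- s)" using s w by (simp add: powr_powr)
      then have "c\<^sub>1 * w \<le> c\<^sub>1 * u n powr (- s)" using c1 by (intro mult_left_mono) auto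
      then have "real m\<^sub>0 + 1 \<le> real (m n)" using elim c1 by (simp add: w_def)
      then show ?case by linarith
    qed
  qed
  \<comment> \<open>One summand each for approximation, for sampling together with the confidence
    term, and for truncation.\<close>
  define C\<^sub>1 where "C\<^sub>1 = c\<^sub>1 powr (- 2 * (\<beta> + 1)) + (c\<^sub>2 + ln (1 / \<delta>) / ln 2) + Q / (b\<^sub>0 * ln 2)"
  have l: "0 \<le> ln (1 / \<delta>)" using assms by simp
  have C1: "0 < C\<^sub>1"
    unfolding C\<^sub>1_def using c1 c2 l b0 assms by (intro add_pos_nonneg add_pos_pos divide_nonneg_nonneg) auto
  have "\<forall>\<^sub>F n in sequentially. u n < 1" by (rule order_tendstoD(2)[OF u_lim]) simp
  then have "\<forall>\<^sub>F n in sequentially.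
      C\<^sub>0 * (real (m n) powr (- 2 * (\<beta> + 1)) + b n * (real (m n) * ln (real n) + ln (1 / \<delta>)) / real n
        + Q * real n powr (- p)) \<le> C\<^sub>0 * C\<^sub>1 * u n powr e"
    using c1(2) c2(2) b0(2) ev2
  proof eventually_elim
    case (elim n)
    have u: "0 < u n" using elim u_pos by simp
    have n: "0 < real n" "ln 2 \<le> ln (real n)" "0 < ln (real n)" using elim by auto
    have ue: "u n \<le> u n powr e" using powr_mono'[of e 1 "u n"] e(3) u elim by simp
    have "real (m n) powr (- 2 * (\<beta> + 1)) \<le> (c\<^sub>1 * u n powr (- s)) powr (- 2 * (\<beta> + 1))"
      using elim c1 u assms by (intro powr_mono2') auto
    also have "\<dots> = c\<^sub>1 powr (- 2 * (\<beta> + 1)) * u n powr e"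
      using c1 e(2) by (simp add: powr_mult powr_powr algebra_simps)
    finally have 1: "real (m n) powr (- 2 * (\<beta> + 1)) \<le> c\<^sub>1 powr (- 2 * (\<beta> + 1)) * u n powr e" .
    have "u n * real (m n) \<le> u n * (c\<^sub>2 * u n powr (- s))"
      using elim u by (intro mult_left_mono) auto
    also have "\<dots> = c\<^sub>2 * u n powr e"
      using u e(1) powr_add[of "u n" 1 "- s"] by simp
    finally have 2: "u n * real (m n) \<le> c\<^sub>2 * u n powr e" .
    have "u n * (ln (1 / \<delta>) / ln (real n)) \<le> u n powr e * (ln (1 / \<delta>) / ln 2)"
      using ue l n u by (intro mult_mono divide_left_mono) auto
    then have 3: "u n * (ln (1 / \<delta>) / ln (real n)) \<le> ln (1 / \<delta>) / ln 2 * u n powr e"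
      by (simp add: mult.commute)
    have "b n * (real (m n) * ln (real n) + ln (1 / \<delta>)) / real n = u n * real (m n) + u n * (ln (1 / \<delta>) / ln (real n))"
      using n by (simp add: u_def field_simps)
    also have "\<dots> \<le> (c\<^sub>2 + ln (1 / \<delta>) / ln 2) * u n powr e"
      unfolding distrib_right using 2 3 by (rule add_mono)
    finally have 4: "b n * (real (m n) * ln (real n) + ln (1 / \<delta>)) / real n \<le> (c\<^sub>2 + ln (1 / \<delta>) / ln 2) * u n powr e" .
    \<comment> \<open>Truncation is absorbed: 1 / n is at most a multiple of \<open>u n\<close>
      because \<open>b n\<close> stays above \<open>b\<^sub>0\<close>, and \<open>u n\<close> is
      below its power with exponent \<open>e \<le> 1\<close>.\<close>
    have "real n powr (- p) \<le> real n powr (- 1)"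
      using elim assms by (intro powr_mono) auto
    also have "\<dots> = 1 / real n" using n by (simp add: powr_minus_divide)
    also have "\<dots> \<le> u n / (b\<^sub>0 * ln 2)"
    proof -
      have "b\<^sub>0 * ln 2 \<le> b n * ln (real n)" using elim n b0 by (intro mult_mono) auto
      then have "b\<^sub>0 * ln 2 / real n \<le> u n" unfolding u_def by (intro divide_right_mono) auto
      then show ?thesis using b0 n by (simp add: field_simps)
    qed
    also have "\<dots> \<le> u n powr e / (b\<^sub>0 * ln 2)" using ue b0 by (intro divide_right_mono) auto
    finally have "Q * real n powr (- p) \<le> Q * (u n powr e / (b\<^sub>0 * ln 2))"
      using assms by (intro mult_left_mono) auto
    then have 5: "Q * real n powr (- p) \<le> Q / (b\<^sub>0 * ln 2) * u n powr e" by simp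
    have "real (m n) powr (- 2 * (\<beta> + 1)) + b n * (real (m n) * ln (real n) + ln (1 / \<delta>)) / real n
        + Q * real n powr (- p) \<le> C\<^sub>1 * u n powr e"
      unfolding C\<^sub>1_def distrib_right[of _ _ "u n powr e"] using 1 4[unfolded distrib_right] 5 by (intro add_mono) auto
    then show ?case unfolding mult.assoc using assms by (intro mult_left_mono) auto
  qed
  then show "\<exists>C>0. \<forall>\<^sub>F n in sequentially.
      C\<^sub>0 * (real (m n) powr (- 2 * (\<beta> + 1)) + b n * (real (m n) * ln (real n) + ln (1 / \<delta>)) / real n
        + Q * real n powr (- p)) \<le> C * u n powr ((2 * \<beta> + 2) / (2 * \<beta> + 3))"
    using C1 assms unfolding e_def by (intro exI[of _ "C\<^sub>0 * C\<^sub>1"]) auto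
qed

lemma ratio_order_lower_bound:
  assumes "ratio_order V \<Xi>\<^sub>0 m\<^sub>0 \<X> C_tr b"
  shows "\<exists>b\<^sub>0>0. \<forall>\<^sub>F n in sequentially. b\<^sub>0 \<le> b n"
proof -
  obtain \<gamma> where \<gamma>: "\<And>n. 2 \<le> n \<Longrightarrow> 0 < \<gamma> (Mtrunc V C_tr n) \<and> \<gamma> (Mtrunc V C_tr n) < 1"
    and b: "b \<in> \<Theta>(\<lambda>n. Bgamma (\<gamma> (Mtrunc V C_tr n)))" and b_pos: "\<And>n. 2 \<le> n \<Longrightarrow> 0 < b n"
    using assms unfolding ratio_order_def Let_def by auto
  obtain c where c: "0 < c" "\<forall>\<^sub>F n in sequentially. norm (b n) \<ge> c * norm (Bgamma (\<gamma> (Mtrunc V C_tr n)))"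
    using bigthetaD2[OF b] by (rule landau_omega.bigE)
  have "\<forall>\<^sub>F n in sequentially. c * 2 \<le> b n"
    using c(2) eventually_ge_at_top[of "2::nat"]
  proof eventually_elim
    case (elim n)
    have "c * 2 \<le> c * norm (Bgamma (\<gamma> (Mtrunc V C_tr n)))"
      using c(1) Bgamma_ge_2[of "\<gamma> (Mtrunc V C_tr n)"] \<gamma>[OF elim(2)] by (intro mult_left_mono) auto
    then show ?case using elim b_pos[OF elim(2)] by simp
  qed
  then show ?thesis using c(1) by (intro exI[of _ "c * 2"]) auto
qed

section \<open>From the oracle inequality to the error bound and the rate in probability\<close>

theorem theorem6p7:
  fixes V :: "real ^ 'd \<Rightarrow> real" and K a\<^sub>0 r_lo r_hi :: real
  assumes "cond_P V" and "cond_G V"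
    and "0 < r_lo" and "r_lo \<le> r_hi" and "r_hi < a\<^sub>0"
  shows "\<exists>C_mode>0. \<forall>\<kappa> \<beta> H H\<^sub>1. 0 < \<kappa> \<and> \<kappa> < K \<and> 1 < \<beta> \<longrightarrow> (\<exists>C_inv>0.
    \<forall>(\<Xi>\<^sub>0 :: real \<Rightarrow> real) L U \<eta>\<^sub>0 m\<^sub>0 C_KL C_ent \<X> c_a \<epsilon> C_tr b C_or
      (P :: nat \<Rightarrow> 'w measure) (X :: nat \<Rightarrow> nat \<Rightarrow> 'w \<Rightarrow> real ^ 'd)
      (\<Xi>hat :: nat \<Rightarrow> nat \<Rightarrow> 'w \<Rightarrow> real \<Rightarrow> real).
      max 1 (inverse (Zconst V K)) \<le> U \<longrightarrow>
      cond_C \<kappa> K L \<Xi>\<^sub>0 \<longrightarrow>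
      \<Xi>\<^sub>0 \<in> holder_ball \<beta> U H \<longrightarrow>
      0 < \<eta>\<^sub>0 \<longrightarrow> (\<forall>r\<in>{0..U}. \<kappa> + \<eta>\<^sub>0 \<le> \<Xi>\<^sub>0 r \<and> \<Xi>\<^sub>0 r \<le> K - \<eta>\<^sub>0) \<longrightarrow>
      requ_sieve V \<kappa> K \<beta> U H\<^sub>1 \<Xi>\<^sub>0 \<eta>\<^sub>0 m\<^sub>0 C_KL C_ent \<X> \<longrightarrow>
      (\<forall>m\<ge>m\<^sub>0. \<forall>\<xi>\<in>\<X> m. cond_C \<kappa> K L \<xi>) \<longrightarrow>
      amax V \<Xi>\<^sub>0 = a\<^sub>0 \<longrightarrow>
      (\<exists>s_lo s_hi. vmin V < s_lo \<and> s_lo \<le> s_hi \<and> {s_lo..s_hi} \<inter> critical_values V = {} \<and>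
         sfun V \<Xi>\<^sub>0 ` {r_lo..r_hi} \<subseteq> {s_lo..s_hi}) \<longrightarrow>
      c_a < \<kappa> \<longrightarrow> 0 < \<epsilon> \<longrightarrow> c_a < \<Xi>\<^sub>0 0 - \<epsilon> \<longrightarrow> 0 < C_tr \<longrightarrow> 1 < C_tr * c_a \<longrightarrow>
      ratio_order V \<Xi>\<^sub>0 m\<^sub>0 \<X> C_tr b \<longrightarrow>
      (\<forall>n\<ge>2. iid_sample (P n) n (X n) (sdens V \<Xi>\<^sub>0)) \<longrightarrow>
      (\<forall>n\<ge>2. \<forall>m\<ge>m\<^sub>0. \<forall>\<omega>\<in>space (P n).
         is_arg_min (neg_loglik V n (\<lambda>i. X n i \<omega>)) (\<lambda>\<xi>. \<xi> \<in> \<X> m) (\<Xi>hat n m \<omega>)) \<longrightarrow>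
      0 < C_or \<longrightarrow>
      (\<forall>n\<ge>2. \<forall>m\<ge>m\<^sub>0. \<forall>\<delta>\<in>{0<..<1}. with_prob_ge (P n) (conf_level V \<Xi>\<^sub>0 C_tr n \<delta>)
         (\<lambda>\<omega>. KL V \<Xi>\<^sub>0 (\<Xi>hat n m \<omega>) \<le> Rbound V \<Xi>\<^sub>0 \<beta> \<X> b C_tr C_or n m \<delta>)) \<longrightarrow>
      (\<forall>n\<ge>2. \<forall>m\<ge>m\<^sub>0. \<forall>\<delta>\<in>{0<..<1}.
         Rbound V \<Xi>\<^sub>0 \<beta> \<X> b C_tr C_or n m \<delta> \<le> C_mode \<longrightarrow>
         with_prob_ge (P n) (conf_level V \<Xi>\<^sub>0 C_tr n \<delta>)
           (\<lambda>\<omega>. L2_dist r_lo r_hi (\<Xi>hat n m \<omega>) \<Xi>\<^sub>0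
                  \<le> C_inv * Rbound V \<Xi>\<^sub>0 \<beta> \<X> b C_tr C_or n m \<delta> powr (\<beta> / (2 * (\<beta> + 1))))) \<and>
      (\<forall>m :: nat \<Rightarrow> nat.
         (\<lambda>n. real (m n)) \<in> \<Theta>(\<lambda>n. (real n / (b n * ln (real n))) powr (1 / (2 * \<beta> + 3))) \<longrightarrow>
         bigO_P P (\<lambda>n \<omega>. L2_dist r_lo r_hi (\<Xi>hat n (m n) \<omega>) \<Xi>\<^sub>0)
           (\<lambda>n. (b n * ln (real n) / real n) powr (\<beta> / (2 * \<beta> + 3)))))"
proof -
  interpret potential V using assms(1) by unfold_locales
  show ?thesis
  proof (rule exI[of _ 1], intro conjI[OF zero_less_one] allI impI)
    fix \<kappa> \<beta> H H\<^sub>1 :: real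
    assume "0 < \<kappa> \<and> \<kappa> < K \<and> 1 < \<beta>"
    then have \<kappa>: "0 < \<kappa>" "\<kappa> \<le> K" and \<beta>: "1 < \<beta>" by auto
    \<comment> \<open>This constant is obtained before \<open>\<Xi>\<^sub>0\<close>, the sieve and
      the sample are introduced, so it can serve as the uniform \<open>C_inv\<close>.\<close>
    obtain C where C: "0 < C" and stable: "\<And>L U \<xi> \<zeta> R. cond_C \<kappa> K L \<xi> \<Longrightarrow> cond_C \<kappa> K L \<zeta> \<Longrightarrow>
        inverse (Zconst V K) \<le> U \<Longrightarrow> \<xi> \<in> holder_ball \<beta> U H \<Longrightarrow> \<zeta> \<in> holder_ball \<beta> U H\<^sub>1 \<Longrightarrow> amax V \<xi> = a\<^sub>0 \<Longrightarrow>
        KL V \<xi> \<zeta> \<le> R \<Longrightarrow> 0 \<le> R \<and> L2_dist r_lo r_hi \<zeta> \<xi> \<le> C * R powr (\<beta> / (2 * (\<beta> + 1)))"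
      using inverse_stability_nonneg[OF \<kappa> \<beta> assms(3-5), of H H\<^sub>1] by blast
    show "\<exists>C_inv>0.
    \<forall>(\<Xi>\<^sub>0 :: real \<Rightarrow> real) L U \<eta>\<^sub>0 m\<^sub>0 C_KL C_ent \<X> c_a \<epsilon> C_tr b C_or
      (P :: nat \<Rightarrow> 'w measure) (X :: nat \<Rightarrow> nat \<Rightarrow> 'w \<Rightarrow> real ^ 'd)
      (\<Xi>hat :: nat \<Rightarrow> nat \<Rightarrow> 'w \<Rightarrow> real \<Rightarrow> real).
      max 1 (inverse (Zconst V K)) \<le> U \<longrightarrow>
      cond_C \<kappa> K L \<Xi>\<^sub>0 \<longrightarrow>
      \<Xi>\<^sub>0 \<in> holder_ball \<beta> U H \<longrightarrow>
      0 < \<eta>\<^sub>0 \<longrightarrow> (\<forall>r\<in>{0..U}. \<kappa> + \<eta>\<^sub>0 \<le> \<Xi>\<^sub>0 r \<and> \<Xi>\<^sub>0 r \<le> K - \<eta>\<^sub>0) \<longrightarrow>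
      requ_sieve V \<kappa> K \<beta> U H\<^sub>1 \<Xi>\<^sub>0 \<eta>\<^sub>0 m\<^sub>0 C_KL C_ent \<X> \<longrightarrow>
      (\<forall>m\<ge>m\<^sub>0. \<forall>\<xi>\<in>\<X> m. cond_C \<kappa> K L \<xi>) \<longrightarrow>
      amax V \<Xi>\<^sub>0 = a\<^sub>0 \<longrightarrow>
      (\<exists>s_lo s_hi. vmin V < s_lo \<and> s_lo \<le> s_hi \<and> {s_lo..s_hi} \<inter> critical_values V = {} \<and>
         sfun V \<Xi>\<^sub>0 ` {r_lo..r_hi} \<subseteq> {s_lo..s_hi}) \<longrightarrow>
      c_a < \<kappa> \<longrightarrow> 0 < \<epsilon> \<longrightarrow> c_a < \<Xi>\<^sub>0 0 - \<epsilon> \<longrightarrow> 0 < C_tr \<longrightarrow> 1 < C_tr * c_a \<longrightarrow>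
      ratio_order V \<Xi>\<^sub>0 m\<^sub>0 \<X> C_tr b \<longrightarrow>
      (\<forall>n\<ge>2. iid_sample (P n) n (X n) (sdens V \<Xi>\<^sub>0)) \<longrightarrow>
      (\<forall>n\<ge>2. \<forall>m\<ge>m\<^sub>0. \<forall>\<omega>\<in>space (P n).
         is_arg_min (neg_loglik V n (\<lambda>i. X n i \<omega>)) (\<lambda>\<xi>. \<xi> \<in> \<X> m) (\<Xi>hat n m \<omega>)) \<longrightarrow>
      0 < C_or \<longrightarrow>
      (\<forall>n\<ge>2. \<forall>m\<ge>m\<^sub>0. \<forall>\<delta>\<in>{0<..<1}. with_prob_ge (P n) (conf_level V \<Xi>\<^sub>0 C_tr n \<delta>)
         (\<lambda>\<omega>. KL V \<Xi>\<^sub>0 (\<Xi>hat n m \<omega>) \<le> Rbound V \<Xi>\<^sub>0 \<beta> \<X> b C_tr C_or n m \<delta>)) \<longrightarrow>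
      (\<forall>n\<ge>2. \<forall>m\<ge>m\<^sub>0. \<forall>\<delta>\<in>{0<..<1}.
         Rbound V \<Xi>\<^sub>0 \<beta> \<X> b C_tr C_or n m \<delta> \<le> 1 \<longrightarrow>
         with_prob_ge (P n) (conf_level V \<Xi>\<^sub>0 C_tr n \<delta>)
           (\<lambda>\<omega>. L2_dist r_lo r_hi (\<Xi>hat n m \<omega>) \<Xi>\<^sub>0
                  \<le> C_inv * Rbound V \<Xi>\<^sub>0 \<beta> \<X> b C_tr C_or n m \<delta> powr (\<beta> / (2 * (\<beta> + 1))))) \<and>
      (\<forall>m :: nat \<Rightarrow> nat.
         (\<lambda>n. real (m n)) \<in> \<Theta>(\<lambda>n. (real n / (b n * ln (real n))) powr (1 / (2 * \<beta> + 3))) \<longrightarrow>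
         bigO_P P (\<lambda>n \<omega>. L2_dist r_lo r_hi (\<Xi>hat n (m n) \<omega>) \<Xi>\<^sub>0)
           (\<lambda>n. (b n * ln (real n) / real n) powr (\<beta> / (2 * \<beta> + 3))))"
    proof (rule exI[of _ C], intro conjI[OF C] allI impI)
      fix \<Xi>\<^sub>0 :: "real \<Rightarrow> real" and L U \<eta>\<^sub>0 :: real and m\<^sub>0 :: nat and C_KL C_ent :: real
        and \<X> :: "nat \<Rightarrow> (real \<Rightarrow> real) set" and c_a \<epsilon> C_tr :: real and b :: "nat \<Rightarrow> real" and C_or :: real
        and P :: "nat \<Rightarrow> 'w measure" and X :: "nat \<Rightarrow> nat \<Rightarrow> 'w \<Rightarrow> real ^ 'd"
        and \<Xi>hat :: "nat \<Rightarrow> nat \<Rightarrow> 'w \<Rightarrow> real \<Rightarrow> real"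
      assume U: "max 1 (inverse (Zconst V K)) \<le> U"
        and \<Xi>C: "cond_C \<kappa> K L \<Xi>\<^sub>0" and \<Xi>H: "\<Xi>\<^sub>0 \<in> holder_ball \<beta> U H"
        and sieve: "requ_sieve V \<kappa> K \<beta> U H\<^sub>1 \<Xi>\<^sub>0 \<eta>\<^sub>0 m\<^sub>0 C_KL C_ent \<X>"
        and sieve_C: "\<forall>m\<ge>m\<^sub>0. \<forall>\<xi>\<in>\<X> m. cond_C \<kappa> K L \<xi>" and a0: "amax V \<Xi>\<^sub>0 = a\<^sub>0"
        and ca: "c_a < \<kappa>" and Ctr: "0 < C_tr" "1 < C_tr * c_a"
        and ratio: "ratio_order V \<Xi>\<^sub>0 m\<^sub>0 \<X> C_tr b"
        and argmin: "\<forall>n\<ge>2. \<forall>m\<ge>m\<^sub>0. \<forall>\<omega>\<in>space (P n).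
          is_arg_min (neg_loglik V n (\<lambda>i. X n i \<omega>)) (\<lambda>\<xi>. \<xi> \<in> \<X> m) (\<Xi>hat n m \<omega>)"
        and Cor: "0 < C_or"
        and risk: "\<forall>n\<ge>2. \<forall>m\<ge>m\<^sub>0. \<forall>\<delta>\<in>{0<..<1}. with_prob_ge (P n) (conf_level V \<Xi>\<^sub>0 C_tr n \<delta>)
          (\<lambda>\<omega>. KL V \<Xi>\<^sub>0 (\<Xi>hat n m \<omega>) \<le> Rbound V \<Xi>\<^sub>0 \<beta> \<X> b C_tr C_or n m \<delta>)"
      \<comment> \<open>Nonemptiness comes from the approximating element that
        \<open>requ_sieve\<close> provides; it gives meaning to the suprema in the truncation
        terms.\<close>
      have sieve_holder: "\<X> m \<subseteq> holder_ball \<beta> U H\<^sub>1" and sieve_ne: "\<X> m \<noteq> {}" if "m\<^sub>0 \<le> m" for m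
        using sieve that unfolding requ_sieve_def sieve_class_def by blast+
      have error: "0 \<le> R \<and> L2_dist r_lo r_hi (\<Xi>hat n m \<omega>) \<Xi>\<^sub>0 \<le> C * R powr (\<beta> / (2 * (\<beta> + 1)))"
        if "2 \<le> n" "m\<^sub>0 \<le> m" "\<omega> \<in> space (P n)" "KL V \<Xi>\<^sub>0 (\<Xi>hat n m \<omega>) \<le> R" for n m \<omega> R
      proof -
        have "\<Xi>hat n m \<omega> \<in> \<X> m" using argmin that by (auto simp: is_arg_min_def)
        then show ?thesis
          using sieve_C U sieve_holder[of m] that by (intro stable[OF \<Xi>C _ _ \<Xi>H _ a0]) auto
      qed
      show "(\<forall>n\<ge>2. \<forall>m\<ge>m\<^sub>0. \<forall>\<delta>\<in>{0<..<1}.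
         Rbound V \<Xi>\<^sub>0 \<beta> \<X> b C_tr C_or n m \<delta> \<le> 1 \<longrightarrow>
         with_prob_ge (P n) (conf_level V \<Xi>\<^sub>0 C_tr n \<delta>)
           (\<lambda>\<omega>. L2_dist r_lo r_hi (\<Xi>hat n m \<omega>) \<Xi>\<^sub>0
                  \<le> C * Rbound V \<Xi>\<^sub>0 \<beta> \<X> b C_tr C_or n m \<delta> powr (\<beta> / (2 * (\<beta> + 1))))) \<and>
      (\<forall>m :: nat \<Rightarrow> nat.
         (\<lambda>n. real (m n)) \<in> \<Theta>(\<lambda>n. (real n / (b n * ln (real n))) powr (1 / (2 * \<beta> + 3))) \<longrightarrow>
         bigO_P P (\<lambda>n \<omega>. L2_dist r_lo r_hi (\<Xi>hat n (m n) \<omega>) \<Xi>\<^sub>0)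
           (\<lambda>n. (b n * ln (real n) / real n) powr (\<beta> / (2 * \<beta> + 3))))"
      proof (intro conjI allI impI ballI)
        fix n m :: nat and \<delta> :: real
        assume "2 \<le> n" "m\<^sub>0 \<le> m" "\<delta> \<in> {0<..<1}"
        then show "with_prob_ge (P n) (conf_level V \<Xi>\<^sub>0 C_tr n \<delta>)
           (\<lambda>\<omega>. L2_dist r_lo r_hi (\<Xi>hat n m \<omega>) \<Xi>\<^sub>0
                  \<le> C * Rbound V \<Xi>\<^sub>0 \<beta> \<X> b C_tr C_or n m \<delta> powr (\<beta> / (2 * (\<beta> + 1))))"
          using error by (intro with_prob_ge_mono[OF risk[rule_format]]) auto
      next
        fix m :: "nat \<Rightarrow> nat"
        assume m: "(\<lambda>n. real (m n)) \<in> \<Theta>(\<lambda>n. (real n / (b n * ln (real n))) powr (1 / (2 * \<beta> + 3)))"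
        have ca_pos: "0 < c_a" using Ctr by (metis less_trans zero_less_mult_pos zero_less_one)
        obtain Q where Q: "0 < Q" and trunc: "\<And>L \<Xi>\<^sub>0 F M. cond_C \<kappa> K L \<Xi>\<^sub>0 \<Longrightarrow> F \<noteq> {} \<Longrightarrow> \<forall>\<xi>\<in>F. cond_C \<kappa> K L \<xi> \<Longrightarrow>
            0 \<le> tail V \<Xi>\<^sub>0 M \<and> tail V \<Xi>\<^sub>0 M \<le> Q * exp (- c_a * (M - v)) \<and>
            (Q * exp (- c_a * (M - v)) \<le> 1 \<longrightarrow> dtrunc V F \<Xi>\<^sub>0 M + Rtrunc V F \<Xi>\<^sub>0 M \<le> Q * exp (- c_a * (M - v)))"
          using truncation_bounds[OF \<kappa> ca_pos ca] by blast
        define p where "p = C_tr * c_a"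
        have exp_M: "exp (- c_a * (Mtrunc V C_tr n - v)) = real n powr (- p)" if "2 \<le> n" for n
          using that by (simp add: Mtrunc_def powr_def p_def mult_ac)
        obtain b\<^sub>0 where b0: "0 < b\<^sub>0" "\<forall>\<^sub>F n in sequentially. b\<^sub>0 \<le> b n"
          using ratio_order_lower_bound[OF ratio] by blast
        have b: "\<And>n. 2 \<le> n \<Longrightarrow> 0 < b n" "b \<in> O(\<lambda>n. ln (real n))"
          using ratio by (auto simp: ratio_order_def)
        define u where "u n = b n * ln (real n) / real n" for n
        show "bigO_P P (\<lambda>n \<omega>. L2_dist r_lo r_hi (\<Xi>hat n (m n) \<omega>) \<Xi>\<^sub>0)
           (\<lambda>n. (b n * ln (real n) / real n) powr (\<beta> / (2 * \<beta> + 3)))"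
          unfolding bigO_P_def
        proof (intro allI impI)
          fix e :: real assume "0 < e"
          \<comment> \<open>Half of the failure probability \<open>e\<close> goes to the confidence
            parameter, the other half to observations outside the sublevel set. The 1 / 2 keeps
            \<delta> below 1.\<close>
          define \<delta> where "\<delta> = min (e / 2) (1 / 2)"
          have \<delta>: "0 < \<delta>" "\<delta> < 1" "\<delta> \<le> e / 2" using \<open>0 < e\<close> by (auto simp: \<delta>_def)
          have "1 < p" using Ctr by (simp add: p_def)
          obtain D where D: "0 < D" "\<forall>\<^sub>F n in sequentially.
              C_or * (real (m n) powr (- 2 * (\<beta> + 1)) + b n * (real (m n) * ln (real n) + ln (1 / \<delta>)) / real n
                + Q * real n powr (- p)) \<le> D * u n powr ((2 * \<beta> + 2) / (2 * \<beta> + 3))"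
            using risk_bound_rate(2)[OF _ \<open>1 < p\<close> _ Cor \<delta>(1,2) b b0 m, of Q] \<beta> Q unfolding u_def by auto
          have "\<forall>\<^sub>F n in sequentially. m\<^sub>0 \<le> m n"
            using \<beta> Q by (intro risk_bound_rate(1)[OF _ \<open>1 < p\<close> _ Cor \<delta>(1,2) b b0 m, of Q]) auto
          moreover have "(\<lambda>n. Q * real n powr (- p)) \<longlonglongrightarrow> 0"
            using \<open>1 < p\<close> by (intro tendsto_mult_right_zero tendsto_neg_powr filterlim_real_sequentially) auto
          then have "\<forall>\<^sub>F n in sequentially. Q * real n powr (- p) < 1"
            by (rule order_tendstoD) simp
          \<comment> \<open>All n observations must fall into the sublevel set, which by Bernoulli's
            inequality costs at most n times the tail; \<open>1 < p\<close> makes this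
            vanish.\<close>
          moreover have "(\<lambda>n. Q * real n powr (1 - p)) \<longlonglongrightarrow> 0"
            using \<open>1 < p\<close> by (intro tendsto_mult_right_zero tendsto_neg_powr filterlim_real_sequentially) auto
          then have "\<forall>\<^sub>F n in sequentially. Q * real n powr (1 - p) < e / 2"
            by (rule order_tendstoD) (use \<open>0 < e\<close> in simp)
          ultimately have "\<forall>\<^sub>F n in sequentially. with_prob_ge (P n) (1 - e)
            (\<lambda>\<omega>. \<bar>L2_dist r_lo r_hi (\<Xi>hat n (m n) \<omega>) \<Xi>\<^sub>0\<bar>
              \<le> C * D powr (\<beta> / (2 * (\<beta> + 1))) * u n powr (\<beta> / (2 * \<beta> + 3)))"
            using D(2) eventually_ge_at_top[of "2::nat"]
          proof eventually_elim
            case (elim n)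
            then have mn: "m\<^sub>0 \<le> m n" and n: "2 \<le> n" by auto
            define R where "R = Rbound V \<Xi>\<^sub>0 \<beta> \<X> b C_tr C_or n (m n) \<delta>"
            define \<tau> where "\<tau> = tail V \<Xi>\<^sub>0 (Mtrunc V C_tr n)"
            have tr: "0 \<le> \<tau>" "\<tau> \<le> Q * real n powr (- p)"
              "dtrunc V (\<X> (m n)) \<Xi>\<^sub>0 (Mtrunc V C_tr n) + Rtrunc V (\<X> (m n)) \<Xi>\<^sub>0 (Mtrunc V C_tr n) \<le> Q * real n powr (- p)"
              using trunc[OF \<Xi>C sieve_ne[OF mn], of "Mtrunc V C_tr n"] sieve_C mn elim
              unfolding \<tau>_def exp_M[OF n] by auto
            have "R \<le> C_or * (real (m n) powr (- 2 * (\<beta> + 1)) + b n * (real (m n) * ln (real n) + ln (1 / \<delta>)) / real n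
                + Q * real n powr (- p))"
              unfolding R_def Rbound_def using tr(3) Cor by (intro mult_left_mono) auto
            also have "\<dots> \<le> D * u n powr ((2 * \<beta> + 2) / (2 * \<beta> + 3))" by fact
            finally have R: "R \<le> D * u n powr ((2 * \<beta> + 2) / (2 * \<beta> + 3))" .
            have "real n * \<tau> \<le> real n * (Q * real n powr (- p))"
              using tr by (intro mult_left_mono) auto
            also have "\<dots> = Q * real n powr (1 - p)"
              using n powr_add[of "real n" 1 "- p"] by simp
            also have "\<dots> \<le> e / 2" using elim by simp
            finally have n\<tau>: "real n * \<tau> \<le> e / 2" .
            have "1 - e \<le> (1 - \<delta>) * (1 - real n * \<tau>)"
            proof -
              have "0 \<le> \<delta> * (real n * \<tau>)" using \<delta> tr by simp
              moreover have "(1 - \<delta>) * (1 - real n * \<tau>) = 1 - \<delta> - real n * \<tau> + \<delta> * (real n * \<tau>)"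
                by (simp add: algebra_simps)
              ultimately show ?thesis using n\<tau> \<delta>(3) by linarith
            qed
            also have "\<dots> \<le> (1 - \<delta>) * (1 - \<tau>) ^ n"
              using Bernoulli_inequality[of "- \<tau>" n] tr elim \<delta> by (intro mult_left_mono) auto
            finally have "1 - e \<le> conf_level V \<Xi>\<^sub>0 C_tr n \<delta>"
              by (simp add: conf_level_def \<tau>_def)
            then show ?case
            proof (rule with_prob_ge_mono[OF risk[rule_format, OF n mn, of \<delta>], rotated])
              fix \<omega> assume "\<omega> \<in> space (P n)" "KL V \<Xi>\<^sub>0 (\<Xi>hat n (m n) \<omega>) \<le> Rbound V \<Xi>\<^sub>0 \<beta> \<X> b C_tr C_or n (m n) \<delta>"
              then have err: "0 \<le> R" "L2_dist r_lo r_hi (\<Xi>hat n (m n) \<omega>) \<Xi>\<^sub>0 \<le> C * R powr (\<beta> / (2 * (\<beta> + 1)))"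
                using error[OF n mn] by (auto simp: R_def)
              have "R powr (\<beta> / (2 * (\<beta> + 1))) \<le> (D * u n powr ((2 * \<beta> + 2) / (2 * \<beta> + 3))) powr (\<beta> / (2 * (\<beta> + 1)))"
                using err R \<beta> by (intro powr_mono2) auto
              also have "\<dots> = D powr (\<beta> / (2 * (\<beta> + 1))) * u n powr (\<beta> / (2 * \<beta> + 3))"
              proof -
                have "(2 * \<beta> + 2) / (2 * \<beta> + 3) * (\<beta> / (2 * (\<beta> + 1))) = \<beta> / (2 * \<beta> + 3)"
                  using \<beta> by (simp add: divide_simps)
                then show ?thesis using D(1) by (simp only: powr_mult powr_powr)
              qed
              finally have "C * R powr (\<beta> / (2 * (\<beta> + 1))) \<le> C * (D powr (\<beta> / (2 * (\<beta> + 1))) * u n powr (\<beta> / (2 * \<beta> + 3)))"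
                using C by (intro mult_left_mono) auto
              moreover have "0 \<le> L2_dist r_lo r_hi (\<Xi>hat n (m n) \<omega>) \<Xi>\<^sub>0"
                unfolding L2_dist_def set_lebesgue_integral_def by (intro real_sqrt_ge_zero integral_nonneg_AE) auto
              ultimately show "\<bar>L2_dist r_lo r_hi (\<Xi>hat n (m n) \<omega>) \<Xi>\<^sub>0\<bar>
                \<le> C * D powr (\<beta> / (2 * (\<beta> + 1))) * u n powr (\<beta> / (2 * \<beta> + 3))"
                using err(2) by (simp add: mult.assoc)
            qed (use \<delta> in auto)
          qed
          then show "\<exists>C. \<forall>\<^sub>F n in sequentially. with_prob_ge (P n) (1 - e)
            (\<lambda>\<omega>. \<bar>L2_dist r_lo r_hi (\<Xi>hat n (m n) \<omega>) \<Xi>\<^sub>0\<bar> \<le> C * (b n * ln (real n) / real n) powr (\<beta> / (2 * \<beta> + 3)))"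
            unfolding u_def by blast
        qed
      qed
    qed
  qed
qed

end
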